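(* Let $\gamma_x:\mathbb{R}\to\mathbb{R}^n$, $x\in\mathbb{R}^n$, be a smoothly varying family of smooth curves with $\gamma_x(0)=x$, let $W$ be a one-dimensional Brownian motion, and let $f:\mathbb{R}^n\to\mathbb{R}^n$ be smooth. If the process $X_t$ satisfies the 2-jet SDE driven by the field of 2-jets $x\mapsto j_2(\gamma_x)$, then the process $(X_t,f(X_t))$ in $\mathbb{R}^n\times\mathbb{R}^n$ satisfies the 2-jet SDE driven by the 2-jets of the product curves, $j_2(\gamma_{X_t}\times (f\circ\gamma_{X_t}))$, where $(\gamma_x\times(f\circ\gamma_x))(s)=(\gamma_x(s),f(\gamma_x(s)))$. That is, $$d\big(X_t,f(X_t)\big)=\tfrac12\big(\gamma_{X_t}''(0),(f\circ\gamma_{X_t})''(0)\big)\,dt+\big(\gamma_{X_t}'(0),(f\circ\gamma_{X_t})'(0)\big)\,dW_t .$$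
   Context: The 2-jet $j_2(\gamma)$ of a smooth curve $\gamma$ at $0$ is the equivalence class of all smooth curves agreeing with $\gamma$ up to and including order $t^2$ at $t=0$. A process $X_t$ is said to satisfy the 2-jet SDE driven by $j_2(\gamma_{X_t})$ and $W$ if it satisfies the It\^o stochastic differential equation $$dX_t=\tfrac12\gamma_{X_t}''(0)\,dt+\gamma_{X_t}'(0)\,dW_t,$$ whose coefficients depend only on the 2-jets $j_2(\gamma_x)$. The same convention applies to a process $(X_t,Y_t)$ driven by 2-jets of curves in $\mathbb{R}^{n}\times\mathbb{R}^n$ that start at $(X_t,Y_t)$ at parameter $0$ and are determined by $X_t$. Such a 2-jet SDE is also the (coordinate-free) limit as $\delta t\to0$ of the scheme $X_{t+\delta t}=\gamma_{X_t}(W_{t+\delta t}-W_t)$. *)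

theory Defs
  imports "HOL-Probability.Probability"
begin

section \<open>Smooth maps and 2-jets of curves\<close>

primrec Ck_map :: "nat \<Rightarrow> ('a::real_normed_vector \<Rightarrow> 'b::real_normed_vector) \<Rightarrow> bool" where
  "Ck_map 0 f \<longleftrightarrow> continuous_on UNIV f"
| "Ck_map (Suc k) f \<longleftrightarrow>
     (\<forall>x. f differentiable (at x)) \<and> (\<forall>v. Ck_map k (\<lambda>x. frechet_derivative f (at x) v))"

definition smooth_map :: "('a::real_normed_vector \<Rightarrow> 'b::real_normed_vector) \<Rightarrow> bool" where
  "smooth_map f \<longleftrightarrow> (\<forall>k. Ck_map k f)"

definition smooth_family :: "('a::real_normed_vector \<Rightarrow> real \<Rightarrow> 'b::real_normed_vector) \<Rightarrow> bool" where
  "smooth_family \<gamma> \<longleftrightarrow> smooth_map (\<lambda>p. \<gamma> (fst p) (snd p))"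

definition first_deriv0 :: "(real \<Rightarrow> 'a::real_normed_vector) \<Rightarrow> 'a" where
  "first_deriv0 \<gamma> = vector_derivative \<gamma> (at 0)"

definition second_deriv0 :: "(real \<Rightarrow> 'a::real_normed_vector) \<Rightarrow> 'a" where
  "second_deriv0 \<gamma> = vector_derivative (\<lambda>s. vector_derivative \<gamma> (at s)) (at 0)"

definition agree_order2 :: "(real \<Rightarrow> 'a::real_normed_vector) \<Rightarrow> (real \<Rightarrow> 'a) \<Rightarrow> bool" where
  "agree_order2 \<gamma> \<eta> \<longleftrightarrow> smooth_map \<gamma> \<and> smooth_map \<eta> \<and> \<gamma> 0 = \<eta> 0 \<and>
     first_deriv0 \<gamma> = first_deriv0 \<eta> \<and> second_deriv0 \<gamma> = second_deriv0 \<eta>"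

lemma Ck_map_const: "Ck_map k (\<lambda>x. c)"
  by (induction k arbitrary: c) auto

lemma smooth_map_const: "smooth_map (\<lambda>x. c)"
  by (simp add: smooth_map_def Ck_map_const)

quotient_type (overloaded) 'a jet2 = "real \<Rightarrow> 'a::real_normed_vector" / partial: agree_order2
proof (rule part_equivpI)
  show "\<exists>\<gamma>::real \<Rightarrow> 'a. agree_order2 \<gamma> \<gamma>"
    by (rule exI[of _ "\<lambda>_. 0"]) (simp add: agree_order2_def smooth_map_const)
qed (auto simp: symp_def transp_def agree_order2_def)

text \<open>The jet of a curve that is not smooth is unspecified.\<close>

definition j2 :: "(real \<Rightarrow> 'a::real_normed_vector) \<Rightarrow> 'a jet2" where
  "j2 \<gamma> = abs_jet2 \<gamma>"

lift_definition jet_point :: "'a::real_normed_vector jet2 \<Rightarrow> 'a" is "\<lambda>\<gamma>. \<gamma> 0"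
  by (simp add: agree_order2_def)

lift_definition jet_deriv1 :: "'a::real_normed_vector jet2 \<Rightarrow> 'a" is first_deriv0
  by (simp add: agree_order2_def)

lift_definition jet_deriv2 :: "'a::real_normed_vector jet2 \<Rightarrow> 'a" is second_deriv0
  by (simp add: agree_order2_def)

lemma j2_eq_iff:
  assumes "smooth_map \<gamma>" "smooth_map \<eta>"
  shows "j2 \<gamma> = j2 \<eta> \<longleftrightarrow> agree_order2 \<gamma> \<eta>"
  using assms Quotient3_rel[OF Quotient3_jet2, of \<gamma> \<eta>] by (auto simp: j2_def agree_order2_def)

lemma
  assumes "smooth_map \<gamma>"
  shows jet_point_j2: "jet_point (j2 \<gamma>) = \<gamma> 0"
    and jet_deriv1_j2: "jet_deriv1 (j2 \<gamma>) = first_deriv0 \<gamma>"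
    and jet_deriv2_j2: "jet_deriv2 (j2 \<gamma>) = second_deriv0 \<gamma>"
  using assms
  by (simp_all add: j2_def agree_order2_def jet_point.abs_eq jet_deriv1.abs_eq jet_deriv2.abs_eq)


section \<open>Brownian motion and the Ito integral\<close>

text \<open>
  Time runs through \<open>[0, \<infinity>)\<close>; values of processes and \<open>\<sigma>\<close>-algebras at negative times
  play no role. The filtration is not required to be complete or right-continuous; this is why
  progressive measurability is demanded in addition to almost sure continuity of paths.
\<close>

definition filtered_prob_space :: "'w measure \<Rightarrow> (real \<Rightarrow> 'w measure) \<Rightarrow> bool" where
  "filtered_prob_space M F \<longleftrightarrow>
     prob_space M \<and> filtration (space M) F \<and> (\<forall>t\<ge>0. subalgebra M (F t))"

definition progressive :: "(real \<Rightarrow> 'w measure) \<Rightarrow> (real \<Rightarrow> 'w \<Rightarrow> 'b::topological_space) \<Rightarrow> bool" where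
  "progressive F X \<longleftrightarrow>
     (\<forall>t\<ge>0. (\<lambda>p. X (fst p) (snd p)) \<in> borel_measurable (restrict_space borel {0..t} \<Otimes>\<^sub>M F t))"

definition brownian_motion ::
    "'w measure \<Rightarrow> (real \<Rightarrow> 'w measure) \<Rightarrow> (real \<Rightarrow> 'w \<Rightarrow> real) \<Rightarrow> bool" where
  "brownian_motion M F W \<longleftrightarrow>
     (\<forall>t\<ge>0. W t \<in> borel_measurable (F t)) \<and>
     (AE \<omega> in M. W 0 \<omega> = 0) \<and>
     (AE \<omega> in M. continuous_on {0..} (\<lambda>t. W t \<omega>)) \<and>
     (\<forall>s\<ge>0. \<forall>t>s.
        distributed M lborel (\<lambda>\<omega>. W t \<omega> - W s \<omega>) (normal_density 0 (sqrt (t - s))) \<and>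
        prob_space.indep_set M (sets (F s))
          (sets (vimage_algebra (space M) (\<lambda>\<omega>. W t \<omega> - W s \<omega>) borel)))"

definition conv_in_prob ::
    "'w measure \<Rightarrow> (nat \<Rightarrow> 'w \<Rightarrow> 'b::euclidean_space) \<Rightarrow> ('w \<Rightarrow> 'b) \<Rightarrow> bool" where
  "conv_in_prob M Y L \<longleftrightarrow>
     (\<forall>n. Y n \<in> borel_measurable M) \<and> L \<in> borel_measurable M \<and>
     (\<forall>\<epsilon>>0. (\<lambda>n. measure M {\<omega> \<in> space M. dist (Y n \<omega>) (L \<omega>) > \<epsilon>}) \<longlonglongrightarrow> 0)"

text \<open>
  The data \<open>k, \<tau>, \<xi>\<close> describe the simple integrand taking the value \<open>\<xi> i\<close> on \<open>(\<tau> i, \<tau> (i + 1)]\<close>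
  for \<open>i < k\<close>.
\<close>

definition simple_data ::
    "'w measure \<Rightarrow> (real \<Rightarrow> 'w measure) \<Rightarrow> real \<Rightarrow> nat \<Rightarrow> (nat \<Rightarrow> real) \<Rightarrow>
     (nat \<Rightarrow> 'w \<Rightarrow> 'b::euclidean_space) \<Rightarrow> bool" where
  "simple_data M F T k \<tau> \<xi> \<longleftrightarrow>
     \<tau> 0 = 0 \<and> \<tau> k = T \<and> (\<forall>i<k. \<tau> i \<le> \<tau> (Suc i)) \<and>
     (\<forall>i<k. \<xi> i \<in> borel_measurable (F (\<tau> i)) \<and> (\<exists>C. \<forall>\<omega>\<in>space M. norm (\<xi> i \<omega>) \<le> C))"

definition simple_integrand ::
    "nat \<Rightarrow> (nat \<Rightarrow> real) \<Rightarrow> (nat \<Rightarrow> 'w \<Rightarrow> 'b::euclidean_space) \<Rightarrow> real \<Rightarrow> 'w \<Rightarrow> 'b" where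
  "simple_integrand k \<tau> \<xi> s \<omega> = (\<Sum>i<k. indicator {\<tau> i<..\<tau> (Suc i)} s *\<^sub>R \<xi> i \<omega>)"

definition simple_ito_integral ::
    "(real \<Rightarrow> 'w \<Rightarrow> real) \<Rightarrow> nat \<Rightarrow> (nat \<Rightarrow> real) \<Rightarrow> (nat \<Rightarrow> 'w \<Rightarrow> 'b::euclidean_space) \<Rightarrow> 'w \<Rightarrow> 'b" where
  "simple_ito_integral W k \<tau> \<xi> \<omega> = (\<Sum>i<k. (W (\<tau> (Suc i)) \<omega> - W (\<tau> i) \<omega>) *\<^sub>R \<xi> i \<omega>)"

text \<open>
  \<open>has_ito_integral M F W H T I\<close>: the random variable \<open>I\<close> is a version of the Ito integral of \<open>H\<close>
  against \<open>W\<close> over \<open>[0, T]\<close>, for progressive \<open>H\<close> with almost surely square integrable paths,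
  obtained by approximating \<open>H\<close> by simple integrands in \<open>L\<^sup>2([0, T])\<close> in probability.
\<close>

definition has_ito_integral ::
    "'w measure \<Rightarrow> (real \<Rightarrow> 'w measure) \<Rightarrow> (real \<Rightarrow> 'w \<Rightarrow> real) \<Rightarrow>
     (real \<Rightarrow> 'w \<Rightarrow> 'b::euclidean_space) \<Rightarrow> real \<Rightarrow> ('w \<Rightarrow> 'b) \<Rightarrow> bool" where
  "has_ito_integral M F W H T I \<longleftrightarrow>
     progressive F H \<and>
     (AE \<omega> in M. set_integrable lborel {0..T} (\<lambda>s. (norm (H s \<omega>))\<^sup>2)) \<and>
     (\<exists>k \<tau> \<xi>. (\<forall>n. simple_data M F T (k n) (\<tau> n) (\<xi> n)) \<and>
        conv_in_prob M
          (\<lambda>n \<omega>. LINT s:{0..T}|lborel. (norm (simple_integrand (k n) (\<tau> n) (\<xi> n) s \<omega> - H s \<omega>))\<^sup>2)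
          (\<lambda>\<omega>. 0) \<and>
        conv_in_prob M (\<lambda>n. simple_ito_integral W (k n) (\<tau> n) (\<xi> n)) I)"

text \<open>\<open>ito_equation M F W X a b\<close> expresses \<open>dX = a dt + b dW\<close> for coefficient processes \<open>a, b\<close>.\<close>

definition ito_equation ::
    "'w measure \<Rightarrow> (real \<Rightarrow> 'w measure) \<Rightarrow> (real \<Rightarrow> 'w \<Rightarrow> real) \<Rightarrow>
     (real \<Rightarrow> 'w \<Rightarrow> 'b::euclidean_space) \<Rightarrow> (real \<Rightarrow> 'w \<Rightarrow> 'b) \<Rightarrow> (real \<Rightarrow> 'w \<Rightarrow> 'b) \<Rightarrow> bool" where
  "ito_equation M F W X a b \<longleftrightarrow>
     progressive F X \<and> (AE \<omega> in M. continuous_on {0..} (\<lambda>t. X t \<omega>)) \<and>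
     progressive F a \<and>
     (\<forall>t\<ge>0. (AE \<omega> in M. set_integrable lborel {0..t} (\<lambda>s. a s \<omega>)) \<and>
        has_ito_integral M F W b t (\<lambda>\<omega>. X t \<omega> - X 0 \<omega> - (LINT s:{0..t}|lborel. a s \<omega>)))"

text \<open>The process \<open>J\<close> of 2-jets may depend on more than the current value of \<open>X\<close>.\<close>

definition satisfies_2jet_SDE ::
    "'w measure \<Rightarrow> (real \<Rightarrow> 'w measure) \<Rightarrow> (real \<Rightarrow> 'w \<Rightarrow> real) \<Rightarrow>
     (real \<Rightarrow> 'w \<Rightarrow> 'b::euclidean_space) \<Rightarrow> (real \<Rightarrow> 'w \<Rightarrow> 'b jet2) \<Rightarrow> bool" where
  "satisfies_2jet_SDE M F W X J \<longleftrightarrow>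
     (\<forall>t\<ge>0. \<forall>\<omega>\<in>space M. jet_point (J t \<omega>) = X t \<omega>) \<and>
     ito_equation M F W X
       (\<lambda>t \<omega>. (1/2) *\<^sub>R jet_deriv2 (J t \<omega>)) (\<lambda>t \<omega>. jet_deriv1 (J t \<omega>))"

definition curve_prod :: "(real \<Rightarrow> 'a) \<Rightarrow> (real \<Rightarrow> 'b) \<Rightarrow> real \<Rightarrow> 'a \<times> 'b" where
  "curve_prod \<alpha> \<beta> s = (\<alpha> s, \<beta> s)"

end

(*
  A 2-jet SDE is the limit of the scheme y' = y + (gamma_x(dW) - x), where x is the value of the
  solution X at the left end of a step of a uniform grid and y that of the scheme. The scheme stays
  uniformly close to X: gamma_x(s) = x + s gamma_x'(0) + s^2/2 gamma_x''(0) + O(s^3), the terms of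
  first order are Riemann sums for the Ito integral of gamma_X'(0), and in the terms of second order
  dW^2 may be replaced by dt. Both errors are martingale transforms, bounded uniformly over the grid
  by a maximal inequality in terms of the quadratic variation of the transform alone.

  For smooth g the increment of g along the scheme is the increment of the curve
  s |-> g (y + gamma_x(s) - x) between 0 and dW, which for y = x is g o gamma_x. A one-dimensional
  Taylor expansion of this curve therefore yields the jets of g o gamma_x, and no second derivative
  of g itself has to be computed. The coefficients of dW in that expansion, truncated, are the simple
  integrands that approximate (g o gamma_X)'(0). The theorem is the case g x = (x, f x).
*)

theory Submission
  imports Defs
begin

section \<open>Calculus of smooth maps\<close>

text \<open>The hypothesis offers, for each time separately, some sequence of simple integrands
  converging in probability; nothing is given at all nodes at once, and no moments of the
  coefficients are known. Estimates are therefore made in probability, by cutting off a transform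
  when its quadratic variation or its size gets too large, and uniformity over nodes is recovered
  from fixed times by refining grids. The increments of \<open>X\<close> over a step are not
  functions of \<open>dW\<close>, which rules out expanding \<open>g\<close> along \<open>X\<close>
  itself; those of the scheme are. Its curves start at \<open>X\<close> and are merely translated to
  \<open>y\<close>, so its increments do not depend on \<open>y\<close> and its distance to
  \<open>X\<close> is a plain sum of one-step errors. Since \<open>has_ito_integral\<close> asks for
  one approximating sequence, one may pass to a subsequence of grids on which the errors vanish
  almost surely, uniformly over the nodes. From there the argument concerns a single continuous
  path, where sums of third order are at most the largest increment times the sum of
  squares.\<close>

lemma frechet_derivative_eqI:
  "(f has_derivative f') (at x) \<Longrightarrow> frechet_derivative f (at x) = f'"
  using frechet_derivative_at by metis

lemma Ck_map_SucI:
  assumes "\<And>x. (f has_derivative f' x) (at x)" and "\<And>v. Ck_map k (\<lambda>x. f' x v)"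
  shows "Ck_map (Suc k) f"
proof -
  have "frechet_derivative f (at x) = f' x" for x
    by (rule frechet_derivative_eqI) (rule assms(1))
  then show ?thesis
    using assms by (auto simp: differentiable_def)
qed

lemma Ck_map_has_derivative:
  "Ck_map (Suc k) f \<Longrightarrow> (f has_derivative frechet_derivative f (at x)) (at x)"
  by (simp add: frechet_derivative_works)

lemma Ck_map_imp_continuous: "Ck_map k f \<Longrightarrow> continuous_on UNIV f"
proof (cases k)
  case (Suc j)
  assume "Ck_map k f"
  then have "f differentiable_on UNIV"
    using Suc by (simp add: differentiable_on_def)
  then show ?thesis
    by (rule differentiable_imp_continuous_on)
qed simp

text \<open>\<open>Ck_map (Suc k)\<close> constrains the derivatives only, so the loss of one order
  is pushed down through all directional derivatives; at the bottom it is the continuity of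
  differentiable maps.\<close>

lemma Ck_map_SucD: "Ck_map (Suc k) f \<Longrightarrow> Ck_map k f"
proof (induction k arbitrary: f)
  case 0
  then show ?case
    using Ck_map_imp_continuous[of "Suc 0" f] by simp
next
  case (Suc k)
  show ?case
    using Suc.prems Suc.IH[of "\<lambda>x. frechet_derivative f (at x) v" for v]
    by (metis Ck_map.simps(2))
qed

lemma Ck_map_bounded_linear_compose:
  assumes L: "bounded_linear L" and "Ck_map k f"
  shows "Ck_map k (\<lambda>x. L (f x))"
  using assms(2)
proof (induction k arbitrary: f)
  case 0
  then show ?case
    using L by (simp add: bounded_linear.continuous_on)
next
  case (Suc k)
  show ?case
  proof (rule Ck_map_SucI)
    show "((\<lambda>x. L (f x)) has_derivative (\<lambda>v. L (frechet_derivative f (at x) v))) (at x)" for x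
      using bounded_linear.has_derivative[OF L Ck_map_has_derivative[OF Suc.prems]] .
    show "Ck_map k (\<lambda>x. L (frechet_derivative f (at x) v))" for v
      using Suc by simp
  qed
qed

lemma Ck_map_bounded_linear: "bounded_linear L \<Longrightarrow> Ck_map k L"
proof (induction k)
  case (Suc k)
  show ?case
    by (rule Ck_map_SucI[where f' = "\<lambda>_. L"])
       (auto intro: bounded_linear_imp_has_derivative Suc Ck_map_const)
qed (simp add: linear_continuous_on)

lemma Ck_map_add: "Ck_map k f \<Longrightarrow> Ck_map k g \<Longrightarrow> Ck_map k (\<lambda>x. f x + g x)"
proof (induction k arbitrary: f g)
  case (Suc k)
  show ?case
  proof (rule Ck_map_SucI)
    show "((\<lambda>x. f x + g x) has_derivative
      (\<lambda>v. frechet_derivative f (at x) v + frechet_derivative g (at x) v)) (at x)" for x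
      by (intro has_derivative_add Ck_map_has_derivative[where k=k] Suc.prems)
    show "Ck_map k (\<lambda>x. frechet_derivative f (at x) v + frechet_derivative g (at x) v)" for v
      using Suc by simp
  qed
qed (simp add: continuous_on_add)

lemma Ck_map_sum: "(\<And>i. i \<in> I \<Longrightarrow> Ck_map k (f i)) \<Longrightarrow> Ck_map k (\<lambda>x. \<Sum>i\<in>I. f i x)"
  by (induction I rule: infinite_finite_induct) (auto intro: Ck_map_const Ck_map_add)

lemma Ck_map_scaleR:
  fixes u :: "'a::real_normed_vector \<Rightarrow> real"
  shows "Ck_map k u \<Longrightarrow> Ck_map k f \<Longrightarrow> Ck_map k (\<lambda>x. u x *\<^sub>R f x)"
proof (induction k arbitrary: u f)
  case (Suc k)
  show ?case
  proof (rule Ck_map_SucI)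
    show "((\<lambda>x. u x *\<^sub>R f x) has_derivative
      (\<lambda>v. u x *\<^sub>R frechet_derivative f (at x) v + frechet_derivative u (at x) v *\<^sub>R f x)) (at x)" for x
      by (intro has_derivative_scaleR Ck_map_has_derivative[where k=k] Suc.prems)
    show "Ck_map k (\<lambda>x. u x *\<^sub>R frechet_derivative f (at x) v + frechet_derivative u (at x) v *\<^sub>R f x)" for v
      using Suc.prems by (intro Ck_map_add Suc.IH) (auto intro: Ck_map_SucD simp del: Ck_map.simps simp: Ck_map.simps(2)[of k])
  qed
qed (simp add: continuous_on_scaleR)

text \<open>The chain rule gives \<open>Df (g x) (Dg x v)\<close>, whose direction moves with
  \<open>x\<close>, whereas \<open>Ck_map\<close> controls derivatives in fixed directions.
  Expanding the direction in the basis of the Euclidean space in between leaves finitely many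
  products of a scalar function with a fixed directional derivative of \<open>f\<close> along
  \<open>g\<close>.\<close>

lemma Ck_map_compose:
  fixes g :: "'a::real_normed_vector \<Rightarrow> 'b::euclidean_space"
  shows "Ck_map k f \<Longrightarrow> Ck_map k g \<Longrightarrow> Ck_map k (\<lambda>x. f (g x))"
proof (induction k arbitrary: f g)
  case 0
  then show ?case
    by (metis Ck_map.simps(1) UNIV_I continuous_on_compose2 subsetI)
next
  case (Suc k)
  let ?Df = "\<lambda>x. frechet_derivative f (at x)" and ?Dg = "\<lambda>x. frechet_derivative g (at x)"
  have eq: "?Df y w = (\<Sum>b\<in>Basis. (w \<bullet> b) *\<^sub>R ?Df y b)" for y w
  proof -
    have "linear (?Df y)"
      using Ck_map_has_derivative[OF Suc.prems(1)] by (rule has_derivative_linear)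
    then have "?Df y (\<Sum>b\<in>Basis. (w \<bullet> b) *\<^sub>R b) = (\<Sum>b\<in>Basis. (w \<bullet> b) *\<^sub>R ?Df y b)"
      by (simp add: linear_sum linear_cmul o_def)
    then show ?thesis by (simp add: euclidean_representation)
  qed
  show ?case
  proof (rule Ck_map_SucI)
    have "((\<lambda>x. f (g x)) has_derivative (\<lambda>v. ?Df (g x) (?Dg x v))) (at x)" for x
      using diff_chain_at[OF Ck_map_has_derivative[OF Suc.prems(2)] Ck_map_has_derivative[OF Suc.prems(1)]]
      by (simp add: o_def)
    then show "((\<lambda>x. f (g x)) has_derivative
        (\<lambda>v. \<Sum>b\<in>Basis. (?Dg x v \<bullet> b) *\<^sub>R ?Df (g x) b)) (at x)" for x
      by (simp only: eq[symmetric])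
    show "Ck_map k (\<lambda>x. \<Sum>b\<in>Basis. (?Dg x v \<bullet> b) *\<^sub>R ?Df (g x) b)" for v
      using Suc.prems
      by (intro Ck_map_sum Ck_map_scaleR Ck_map_bounded_linear_compose[OF bounded_linear_inner_left] Suc.IH)
         (auto intro: Ck_map_SucD simp del: Ck_map.simps simp: Ck_map.simps(2)[of k])
  qed
qed

lemma Ck_map_Pair: "Ck_map k f \<Longrightarrow> Ck_map k g \<Longrightarrow> Ck_map k (\<lambda>x. (f x, g x))"
  using Ck_map_add[OF Ck_map_bounded_linear_compose[of "\<lambda>y. (y, 0)" k f]
      Ck_map_bounded_linear_compose[of "\<lambda>y. (0, y)" k g]]
  by (simp add: bounded_linear_Pair bounded_linear_zero bounded_linear_ident)

lemma smooth_map_bounded_linear: "bounded_linear L \<Longrightarrow> smooth_map L"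
  by (simp add: smooth_map_def Ck_map_bounded_linear)

lemma smooth_map_add: "smooth_map f \<Longrightarrow> smooth_map g \<Longrightarrow> smooth_map (\<lambda>x. f x + g x)"
  by (simp add: smooth_map_def Ck_map_add)

lemma smooth_map_Pair: "smooth_map f \<Longrightarrow> smooth_map g \<Longrightarrow> smooth_map (\<lambda>x. (f x, g x))"
  by (simp add: smooth_map_def Ck_map_Pair)

lemma smooth_map_compose:
  fixes g :: "'a::real_normed_vector \<Rightarrow> 'b::euclidean_space"
  shows "smooth_map f \<Longrightarrow> smooth_map g \<Longrightarrow> smooth_map (\<lambda>x. f (g x))"
  by (simp add: smooth_map_def Ck_map_compose)

lemma smooth_map_imp_continuous: "smooth_map f \<Longrightarrow> continuous_on UNIV f"
  using Ck_map_imp_continuous smooth_map_def by blast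

lemma smooth_map_directional_derivative:
  "smooth_map f \<Longrightarrow> smooth_map (\<lambda>x. frechet_derivative f (at x) v)"
  unfolding smooth_map_def by (metis Ck_map.simps(2))

lemma smooth_map_has_derivative:
  "smooth_map f \<Longrightarrow> (f has_derivative frechet_derivative f (at x)) (at x)"
  unfolding smooth_map_def using Ck_map_has_derivative by blast

lemma smooth_map_has_vector_derivative:
  assumes "smooth_map \<alpha>"
  shows "(\<alpha> has_vector_derivative vector_derivative \<alpha> (at s)) (at s)"
    and "((\<lambda>s. vector_derivative \<alpha> (at s)) has_vector_derivative
           vector_derivative (\<lambda>s. vector_derivative \<alpha> (at s)) (at s)) (at s)"
proof -
  have eq: "vector_derivative \<alpha> (at s) = frechet_derivative \<alpha> (at s) 1" for s
    using smooth_map_has_derivative[OF assms]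
    by (metis differentiableI frechet_derivative_works has_vector_derivative_def
        frechet_derivative_eqI mult.right_neutral scaleR_one vector_derivative_works)
  have *: "smooth_map \<beta> \<Longrightarrow> (\<beta> has_vector_derivative vector_derivative \<beta> (at s)) (at s)" for \<beta> :: "real \<Rightarrow> 'a" and s
    using smooth_map_has_derivative[of \<beta>] vector_derivative_works differentiableI by blast
  show "(\<alpha> has_vector_derivative vector_derivative \<alpha> (at s)) (at s)"
    by (rule *) (rule assms)
  show "((\<lambda>s. vector_derivative \<alpha> (at s)) has_vector_derivative
           vector_derivative (\<lambda>s. vector_derivative \<alpha> (at s)) (at s)) (at s)"
    by (rule *) (simp add: eq smooth_map_directional_derivative assms)
qed

lemma jets_curve_prod:
  assumes "smooth_map \<alpha>" and "smooth_map \<beta>"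
  shows "first_deriv0 (curve_prod \<alpha> \<beta>) = (first_deriv0 \<alpha>, first_deriv0 \<beta>)"
    and "second_deriv0 (curve_prod \<alpha> \<beta>) = (second_deriv0 \<alpha>, second_deriv0 \<beta>)"
proof -
  have eq: "vector_derivative (curve_prod \<alpha> \<beta>) (at s) = (vector_derivative \<alpha> (at s), vector_derivative \<beta> (at s))" for s
    unfolding curve_prod_def[abs_def]
    by (intro vector_derivative_at has_vector_derivative_Pair smooth_map_has_vector_derivative assms)
  then show "first_deriv0 (curve_prod \<alpha> \<beta>) = (first_deriv0 \<alpha>, first_deriv0 \<beta>)"
    by (simp add: first_deriv0_def)
  show "second_deriv0 (curve_prod \<alpha> \<beta>) = (second_deriv0 \<alpha>, second_deriv0 \<beta>)"
    unfolding second_deriv0_def eq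
    by (intro vector_derivative_at has_vector_derivative_Pair smooth_map_has_vector_derivative assms)
qed

section \<open>Taylor expansion of curves with a remainder uniform in the base point\<close>

text \<open>The mean value inequality on the symmetric interval from -|s| to |s| treats both signs
  of \<open>s\<close> at once; Brownian increments have either sign.\<close>

lemma norm_diff_le_of_vector_derivative_bound:
  fixes \<psi> :: "real \<Rightarrow> 'a::real_normed_vector"
  assumes "\<And>u. \<bar>u\<bar> \<le> \<bar>s\<bar> \<Longrightarrow> (\<psi> has_vector_derivative \<psi>' u) (at u)"
    and "\<And>u. \<bar>u\<bar> \<le> \<bar>s\<bar> \<Longrightarrow> norm (\<psi>' u) \<le> B"
  shows "norm (\<psi> s - \<psi> 0) \<le> B * \<bar>s\<bar>"
proof -
  have "norm (\<psi> s - \<psi> 0) \<le> B * norm (s - 0)"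
  proof (rule differentiable_bound[where S = "{-\<bar>s\<bar>..\<bar>s\<bar>}" and f' = "\<lambda>u h. h *\<^sub>R \<psi>' u"])
    fix u assume "u \<in> {-\<bar>s\<bar>..\<bar>s\<bar>}"
    then have u: "\<bar>u\<bar> \<le> \<bar>s\<bar>" by auto
    show "(\<psi> has_derivative (\<lambda>h. h *\<^sub>R \<psi>' u)) (at u within {-\<bar>s\<bar>..\<bar>s\<bar>})"
      using assms(1)[OF u] has_derivative_at_withinI unfolding has_vector_derivative_def by blast
    show "onorm (\<lambda>h. h *\<^sub>R \<psi>' u) \<le> B"
      using assms(2)[OF u] by (simp add: onorm_scaleR_left[OF bounded_linear_ident] onorm_id)
  qed auto
  then show ?thesis by simp
qed

text \<open>Three uses of the mean value inequality, for the second derivative, the first and the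
  curve itself, each after subtracting what is known at 0. Each contributes a factor |s|; the
  constant 1 instead of 1/6 is good enough for remainders that only have to be of third
  order.\<close>

lemma taylor2_bound:
  fixes \<phi> :: "real \<Rightarrow> 'a::real_normed_vector"
  assumes d: "\<And>u. (\<phi> has_vector_derivative \<phi>' u) (at u)" "\<And>u. (\<phi>' has_vector_derivative \<phi>'' u) (at u)"
      "\<And>u. (\<phi>'' has_vector_derivative \<phi>''' u) (at u)"
    and B: "\<And>u. \<bar>u\<bar> \<le> \<bar>s\<bar> \<Longrightarrow> norm (\<phi>''' u) \<le> B"
  shows "norm (\<phi> s - \<phi> 0 - s *\<^sub>R \<phi>' 0 - (s\<^sup>2/2) *\<^sub>R \<phi>'' 0) \<le> B * \<bar>s\<bar>^3"
proof -
  have "0 \<le> B" using order_trans[OF norm_ge_zero B[of 0]] by simp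
  have 2: "norm (\<phi>'' u - \<phi>'' 0) \<le> B * \<bar>s\<bar>" if "\<bar>u\<bar> \<le> \<bar>s\<bar>" for u
  proof -
    have "norm (\<phi>'' u - \<phi>'' 0) \<le> B * \<bar>u\<bar>"
      using that by (intro norm_diff_le_of_vector_derivative_bound[where \<psi>' = \<phi>'''] d B) auto
    also have "\<dots> \<le> B * \<bar>s\<bar>" using that \<open>0 \<le> B\<close> by (intro mult_left_mono) auto
    finally show ?thesis .
  qed
  have 1: "norm (\<phi>' u - u *\<^sub>R \<phi>'' 0 - \<phi>' 0) \<le> B * \<bar>s\<bar> * \<bar>s\<bar>" if "\<bar>u\<bar> \<le> \<bar>s\<bar>" for u
  proof -
    have "norm ((\<phi>' u - u *\<^sub>R \<phi>'' 0) - (\<phi>' 0 - 0 *\<^sub>R \<phi>'' 0)) \<le> (B * \<bar>s\<bar>) * \<bar>u\<bar>"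
      using that
      by (intro norm_diff_le_of_vector_derivative_bound[where \<psi>' = "\<lambda>u. \<phi>'' u - \<phi>'' 0"] 2)
         (auto intro!: derivative_eq_intros d)
    also have "\<dots> \<le> B * \<bar>s\<bar> * \<bar>s\<bar>" using that \<open>0 \<le> B\<close> by (intro mult_left_mono) auto
    finally show ?thesis by simp
  qed
  have "norm ((\<phi> s - s *\<^sub>R \<phi>' 0 - (s\<^sup>2/2) *\<^sub>R \<phi>'' 0) - (\<phi> 0 - 0 *\<^sub>R \<phi>' 0 - (0\<^sup>2/2) *\<^sub>R \<phi>'' 0)) \<le> (B * \<bar>s\<bar> * \<bar>s\<bar>) * \<bar>s\<bar>"
  proof (rule norm_diff_le_of_vector_derivative_bound[where \<psi>' = "\<lambda>u. \<phi>' u - u *\<^sub>R \<phi>'' 0 - \<phi>' 0"])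
    fix u assume u: "\<bar>u\<bar> \<le> \<bar>s\<bar>"
    show "norm (\<phi>' u - u *\<^sub>R \<phi>'' 0 - \<phi>' 0) \<le> B * \<bar>s\<bar> * \<bar>s\<bar>" by (rule 1[OF u])
    show "((\<lambda>a. \<phi> a - a *\<^sub>R \<phi>' 0 - (a\<^sup>2/2) *\<^sub>R \<phi>'' 0) has_vector_derivative \<phi>' u - u *\<^sub>R \<phi>'' 0 - \<phi>' 0) (at u)"
      by (auto intro!: derivative_eq_intros d simp: algebra_simps)
  qed
  then show ?thesis by (simp add: power3_eq_cube algebra_simps)
qed

text \<open>Differentiation in the curve parameter is taken as the direction (0, 1) of the product
  space, so that the result is again a smooth map of base point and parameter together and the
  operation can be iterated.\<close>

definition param_deriv :: "('p::real_normed_vector \<times> real \<Rightarrow> 'c::real_normed_vector) \<Rightarrow> 'p \<times> real \<Rightarrow> 'c" where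
  "param_deriv \<Phi> p = frechet_derivative \<Phi> (at p) (0, 1)"

lemma smooth_param_deriv: "smooth_map \<Phi> \<Longrightarrow> smooth_map (param_deriv \<Phi>)"
  unfolding param_deriv_def[abs_def] by (rule smooth_map_directional_derivative)

lemma param_deriv_has_vector_derivative:
  assumes "smooth_map \<Phi>"
  shows "((\<lambda>s. \<Phi> (p, s)) has_vector_derivative param_deriv \<Phi> (p, s)) (at s)"
proof -
  have "((\<lambda>s. \<Phi> (p, s)) has_derivative (\<lambda>h. frechet_derivative \<Phi> (at (p, s)) (0, h))) (at s)"
  proof (rule has_derivative_compose[OF _ smooth_map_has_derivative[OF assms]])
    show "((\<lambda>s. (p, s)) has_derivative Pair 0) (at s)"
      by (intro has_derivative_Pair has_derivative_const has_derivative_ident)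
  qed
  moreover have "frechet_derivative \<Phi> (at (p, s)) (0, h) = h *\<^sub>R param_deriv \<Phi> (p, s)" for h
    using linear_cmul[OF has_derivative_linear[OF smooth_map_has_derivative[OF assms]], of "(p, s)" h "(0, 1)"]
    by (simp add: param_deriv_def)
  ultimately show ?thesis
    by (simp add: has_vector_derivative_def)
qed

lemma smooth_curve_taylor:
  fixes \<Phi> :: "'p::euclidean_space \<times> real \<Rightarrow> 'c::real_normed_vector"
  assumes "smooth_map \<Phi>"
  shows "continuous_on UNIV (\<lambda>p. first_deriv0 (\<lambda>s. \<Phi> (p, s)))"
    and "continuous_on UNIV (\<lambda>p. second_deriv0 (\<lambda>s. \<Phi> (p, s)))"
    and "compact K \<Longrightarrow> \<exists>C\<ge>0. \<forall>p\<in>K. \<forall>s. \<bar>s\<bar> \<le> 1 \<longrightarrow>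
           norm (\<Phi> (p, s) - \<Phi> (p, 0) - s *\<^sub>R first_deriv0 (\<lambda>s. \<Phi> (p, s))
             - (s\<^sup>2/2) *\<^sub>R second_deriv0 (\<lambda>s. \<Phi> (p, s))) \<le> C * \<bar>s\<bar>^3"
proof -
  let ?D = "param_deriv"
  note d = param_deriv_has_vector_derivative
  have s: "smooth_map (?D \<Phi>)" "smooth_map (?D (?D \<Phi>))" "smooth_map (?D (?D (?D \<Phi>)))"
    by (intro smooth_param_deriv assms)+
  have v1: "vector_derivative (\<lambda>s. \<Phi> (p, s)) (at s) = ?D \<Phi> (p, s)" for p s
    by (intro vector_derivative_at d assms)
  then have f: "first_deriv0 (\<lambda>s. \<Phi> (p, s)) = ?D \<Phi> (p, 0)" for p
    by (simp add: first_deriv0_def)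
  have g: "second_deriv0 (\<lambda>s. \<Phi> (p, s)) = ?D (?D \<Phi>) (p, 0)" for p
    unfolding second_deriv0_def v1 by (intro vector_derivative_at d s)
  have c: "continuous_on UNIV (\<lambda>p. \<Psi> (p, 0))" if "smooth_map \<Psi>" for \<Psi> :: "'p \<times> real \<Rightarrow> 'c"
    by (rule continuous_on_compose2[OF smooth_map_imp_continuous[OF that]]) (auto intro!: continuous_intros)
  show "continuous_on UNIV (\<lambda>p. first_deriv0 (\<lambda>s. \<Phi> (p, s)))"
    unfolding f by (intro c s)
  show "continuous_on UNIV (\<lambda>p. second_deriv0 (\<lambda>s. \<Phi> (p, s)))"
    unfolding g by (intro c s)
  assume K: "compact K"
  \<comment> \<open>The third derivative is jointly continuous, hence bounded on the compact
    product; this bound is the constant common to all base points in \<open>K\<close>.\<close>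
  have "compact (?D (?D (?D \<Phi>)) ` (K \<times> {-1..1}))"
    by (intro compact_continuous_image compact_Times K compact_Icc)
       (rule continuous_on_subset[OF smooth_map_imp_continuous[OF s(3)]], simp)
  then obtain C where C: "\<And>q. q \<in> K \<times> {-1..1} \<Longrightarrow> norm (?D (?D (?D \<Phi>)) q) \<le> C" "C > 0"
    using compact_imp_bounded bounded_pos by (metis imageI)
  show "\<exists>C\<ge>0. \<forall>p\<in>K. \<forall>s. \<bar>s\<bar> \<le> 1 \<longrightarrow>
           norm (\<Phi> (p, s) - \<Phi> (p, 0) - s *\<^sub>R first_deriv0 (\<lambda>s. \<Phi> (p, s))
             - (s\<^sup>2/2) *\<^sub>R second_deriv0 (\<lambda>s. \<Phi> (p, s))) \<le> C * \<bar>s\<bar>^3"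
    unfolding f g
  proof (intro exI[of _ C] conjI ballI allI impI)
    fix p s assume "p \<in> K" "\<bar>s\<bar> \<le> (1::real)"
    then show "norm (\<Phi> (p, s) - \<Phi> (p, 0) - s *\<^sub>R ?D \<Phi> (p, 0) - (s\<^sup>2/2) *\<^sub>R ?D (?D \<Phi>) (p, 0)) \<le> C * \<bar>s\<bar>^3"
      by (intro taylor2_bound[where \<phi> = "\<lambda>s. \<Phi> (p, s)" and \<phi>' = "\<lambda>s. ?D \<Phi> (p, s)" and
            \<phi>'' = "\<lambda>s. ?D (?D \<Phi>) (p, s)" and \<phi>''' = "\<lambda>s. ?D (?D (?D \<Phi>)) (p, s)"] d s assms C) auto
  qed (use C in simp)
qed

section \<open>A maximal inequality for martingale transforms\<close>

text \<open>\<open>G\<close> is the past and \<open>Z\<close> the new noise. The factor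
  \<open>h\<close> is later the identity, which makes cross terms vanish, or the square, which
  produces the variance.\<close>

lemma (in prob_space) expectation_indep_mult:
  fixes Z \<phi> :: "'a \<Rightarrow> real"
  assumes G: "subalgebra M G"
    and indep: "indep_set (sets G) (sets (vimage_algebra (space M) Z borel))"
    and \<phi>: "\<phi> \<in> borel_measurable G" "integrable M \<phi>"
    and h: "h \<in> borel_measurable borel" "integrable M (\<lambda>\<omega>. h (Z \<omega>))"
    and Z: "Z \<in> borel_measurable M"
  shows "integrable M (\<lambda>\<omega>. \<phi> \<omega> * h (Z \<omega>))"
    and "expectation (\<lambda>\<omega>. \<phi> \<omega> * h (Z \<omega>)) = expectation \<phi> * expectation (\<lambda>\<omega>. h (Z \<omega>))"
proof -
  have "sigma_sets (space M) {\<phi> -` A \<inter> space M |A. A \<in> sets borel} \<subseteq> sets G"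
  proof -
    have "sigma_sets (space G) {\<phi> -` A \<inter> space G |A. A \<in> sets borel} \<subseteq> sets G"
      using \<phi>(1) by (intro sets.sigma_sets_subset) (auto intro: measurable_sets)
    then show ?thesis using G by (simp add: subalgebra_def)
  qed
  then have "indep_set (sigma_sets (space M) {\<phi> -` A \<inter> space M |A. A \<in> sets borel})
      (sigma_sets (space M) {Z -` A \<inter> space M |A. A \<in> sets borel})"
    using indep unfolding indep_set_def sets_vimage_algebra
    by (rule_tac indep_sets_mono_sets) (auto split: bool.split)
  then have "indep_var borel \<phi> borel Z"
    using \<phi>(2) Z by (auto simp: indep_var_eq)
  then have "indep_var borel (id \<circ> \<phi>) borel (h \<circ> Z)"
    by (rule indep_var_compose) (use h in auto)
  then have *: "indep_var borel \<phi> borel (\<lambda>\<omega>. h (Z \<omega>))"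
    by (simp add: o_def)
  show "integrable M (\<lambda>\<omega>. \<phi> \<omega> * h (Z \<omega>))"
    using indep_var_integrable[OF * \<phi>(2) h(2)] .
  show "expectation (\<lambda>\<omega>. \<phi> \<omega> * h (Z \<omega>)) = expectation \<phi> * expectation (\<lambda>\<omega>. h (Z \<omega>))"
    using indep_var_lebesgue_integral[OF * \<phi>(2) h(2)] .
qed

lemma (in prob_space) exceeds_event:
  fixes U :: "nat \<Rightarrow> 'a \<Rightarrow> 'b::euclidean_space"
  assumes "\<And>k. k \<le> n \<Longrightarrow> U k \<in> borel_measurable M"
  shows "{\<omega>\<in>space M. \<exists>k\<le>n. \<epsilon> < norm (U k \<omega>)} \<in> events"
proof -
  have "{\<omega>\<in>space M. \<epsilon> < norm (U k \<omega>)} \<in> events" if "k \<le> n" for k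
  proof -
    note [measurable] = assms[OF that]
    show ?thesis by measurable
  qed
  then have "(\<Union>k\<in>{..n}. {\<omega>\<in>space M. \<epsilon> < norm (U k \<omega>)}) \<in> events"
    by (intro sets.finite_UN) auto
  also have "(\<Union>k\<in>{..n}. {\<omega>\<in>space M. \<epsilon> < norm (U k \<omega>)}) = {\<omega>\<in>space M. \<exists>k\<le>n. \<epsilon> < norm (U k \<omega>)}"
    by auto
  finally show ?thesis .
qed

text \<open>Martingale differences with deterministic conditional variance \<open>v i\<close>. There
  are two instances: the Brownian increments with \<open>v\<close> the step length, and their
  squares minus the step length. Positivity of \<open>v\<close> allows a bound on \<open>v i\<close>
  times a squared coefficient to be turned into a bound on the coefficient.\<close>

locale noise_sequence = prob_space M for M :: "'w measure" +
  fixes G :: "nat \<Rightarrow> 'w measure" and Z :: "nat \<Rightarrow> 'w \<Rightarrow> real" and v :: "nat \<Rightarrow> real" and N :: nat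
  assumes subalg: "i \<le> N \<Longrightarrow> subalgebra M (G i)"
    and sets_mono: "i \<le> j \<Longrightarrow> j \<le> N \<Longrightarrow> sets (G i) \<subseteq> sets (G j)"
    and adapted: "i < N \<Longrightarrow> Z i \<in> borel_measurable (G (Suc i))"
    and indep: "i < N \<Longrightarrow> indep_set (sets (G i)) (sets (vimage_algebra (space M) (Z i) borel))"
    and square_integrable: "i < N \<Longrightarrow> integrable M (\<lambda>\<omega>. (Z i \<omega>)\<^sup>2)"
    and mean: "i < N \<Longrightarrow> expectation (Z i) = 0"
    and var: "i < N \<Longrightarrow> expectation (\<lambda>\<omega>. (Z i \<omega>)\<^sup>2) = v i"
    and v_pos: "i < N \<Longrightarrow> 0 < v i"
begin

lemma measurable_mono:
  "f \<in> measurable (G i) L \<Longrightarrow> i \<le> j \<Longrightarrow> j \<le> N \<Longrightarrow> f \<in> measurable (G j) L"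
  using sets_mono subalg by (intro measurable_from_subalg[of "G j" "G i"]) (auto simp: subalgebra_def)

lemma measurable_M: "f \<in> measurable (G i) L \<Longrightarrow> i \<le> N \<Longrightarrow> f \<in> measurable M L"
  using subalg by (rule measurable_from_subalg)

lemma transform_measurable:
  fixes \<eta> :: "nat \<Rightarrow> 'w \<Rightarrow> 'b::euclidean_space"
  assumes "\<And>i. i < N \<Longrightarrow> \<eta> i \<in> borel_measurable (G i)" and "k \<le> N"
  shows "(\<lambda>\<omega>. \<Sum>j<k. Z j \<omega> *\<^sub>R \<eta> j \<omega>) \<in> borel_measurable (G k)"
proof (rule borel_measurable_sum)
  fix j assume "j \<in> {..<k}"
  then have "Z j \<in> borel_measurable (G k)" and "\<eta> j \<in> borel_measurable (G k)"
    using measurable_mono[OF adapted, of j k] measurable_mono[OF assms(1), of j k] assms(2) by auto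
  then show "(\<lambda>\<omega>. Z j \<omega> *\<^sub>R \<eta> j \<omega>) \<in> borel_measurable (G k)"
    by (rule borel_measurable_scaleR)
qed

text \<open>The discrete Ito isometry: the coefficient of the last noise is known before that noise,
  so the cross term has expectation 0 and the square factorizes.\<close>

lemma transform_second_moment:
  fixes \<eta> :: "nat \<Rightarrow> 'w \<Rightarrow> 'b::euclidean_space"
  assumes \<eta>: "\<And>i. i < N \<Longrightarrow> \<eta> i \<in> borel_measurable (G i)"
    and bound: "\<And>i \<omega>. i < N \<Longrightarrow> \<omega> \<in> space M \<Longrightarrow> norm (\<eta> i \<omega>) \<le> C"
    and "k \<le> N"
  shows "integrable M (\<lambda>\<omega>. (norm (\<Sum>j<k. Z j \<omega> *\<^sub>R \<eta> j \<omega>))\<^sup>2)"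
    and "expectation (\<lambda>\<omega>. (norm (\<Sum>j<k. Z j \<omega> *\<^sub>R \<eta> j \<omega>))\<^sup>2)
      = (\<Sum>j<k. v j * expectation (\<lambda>\<omega>. (norm (\<eta> j \<omega>))\<^sup>2))"
proof -
  define S where "S k \<omega> = (\<Sum>j<k. Z j \<omega> *\<^sub>R \<eta> j \<omega>)" for k \<omega>
  have "integrable M (\<lambda>\<omega>. (norm (S k \<omega>))\<^sup>2) \<and>
    expectation (\<lambda>\<omega>. (norm (S k \<omega>))\<^sup>2) = (\<Sum>j<k. v j * expectation (\<lambda>\<omega>. (norm (\<eta> j \<omega>))\<^sup>2))"
    using \<open>k \<le> N\<close>
  proof (induction k)
    case 0
    then show ?case by (simp add: S_def)
  next
    case (Suc k)
    then have k: "k < N" and IH: "integrable M (\<lambda>\<omega>. (norm (S k \<omega>))\<^sup>2)"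
      "expectation (\<lambda>\<omega>. (norm (S k \<omega>))\<^sup>2) = (\<Sum>j<k. v j * expectation (\<lambda>\<omega>. (norm (\<eta> j \<omega>))\<^sup>2))"
      by auto
    note sq = square_integrable[OF k] and ind = indep[OF k] and sub = subalg[OF less_imp_le[OF k]]
    have ZM: "Z k \<in> borel_measurable M"
      using adapted[OF k] k by (intro measurable_M) auto
    have SG: "S k \<in> borel_measurable (G k)"
      unfolding S_def using \<eta> k by (intro transform_measurable) auto
    have SM[measurable]: "S k \<in> borel_measurable M" and \<eta>M[measurable]: "\<eta> k \<in> borel_measurable M"
      using SG \<eta>[OF k] k by (auto intro: measurable_M)
    have C: "0 \<le> C"
      using bound[OF k] not_empty by (meson ex_in_conv norm_ge_zero order_trans)
    let ?\<phi> = "\<lambda>\<omega>. 2 * (S k \<omega> \<bullet> \<eta> k \<omega>)" and ?\<psi> = "\<lambda>\<omega>. (norm (\<eta> k \<omega>))\<^sup>2"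
    have \<phi>G: "?\<phi> \<in> borel_measurable (G k)" and \<psi>G: "?\<psi> \<in> borel_measurable (G k)"
      using SG \<eta>[OF k] by measurable
    \<comment> \<open>The inner product is at most \<open>C\<close> times the norm of
      \<open>S k\<close>, and a norm is at most 1 plus its square, which is integrable by the
      induction hypothesis.\<close>
    have \<phi>i: "integrable M ?\<phi>"
    proof (rule Bochner_Integration.integrable_bound)
      show "integrable M (\<lambda>\<omega>. 2 * C * (1 + (norm (S k \<omega>))\<^sup>2))"
        using IH(1) by simp
      show "AE \<omega> in M. norm (?\<phi> \<omega>) \<le> norm (2 * C * (1 + (norm (S k \<omega>))\<^sup>2))"
      proof (rule AE_I2)
        fix \<omega> assume \<omega>: "\<omega> \<in> space M"
        have "\<bar>S k \<omega> \<bullet> \<eta> k \<omega>\<bar> \<le> norm (S k \<omega>) * C"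
          using Cauchy_Schwarz_ineq2[of "S k \<omega>" "\<eta> k \<omega>"] mult_left_mono[OF bound[OF k \<omega>], of "norm (S k \<omega>)"]
          by simp
        also have "\<dots> \<le> (1 + (norm (S k \<omega>))\<^sup>2) * C"
        proof (rule mult_right_mono[OF _ C])
          have "0 \<le> (norm (S k \<omega>) - 1/2)\<^sup>2" by simp
          then show "norm (S k \<omega>) \<le> 1 + (norm (S k \<omega>))\<^sup>2"
            by (simp add: power2_eq_square algebra_simps)
        qed
        finally show "norm (?\<phi> \<omega>) \<le> norm (2 * C * (1 + (norm (S k \<omega>))\<^sup>2))"
          using C by (simp add: abs_mult algebra_simps)
      qed
    qed (rule measurable_M[OF \<phi>G less_imp_le[OF k]])
    have \<psi>i: "integrable M ?\<psi>"
      using bound[OF k] by (intro integrable_const_bound[where B = "C\<^sup>2"]) (auto intro!: power_mono)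
    have Zi: "integrable M (\<lambda>\<omega>. Z k \<omega>)"
      using square_integrable_imp_integrable[OF ZM sq] .
    note m1 = expectation_indep_mult[OF sub ind \<phi>G \<phi>i _ _ ZM, where h = "\<lambda>z. z"]
    note m2 = expectation_indep_mult[OF sub ind \<psi>G \<psi>i _ _ ZM, where h = "\<lambda>z. z\<^sup>2"]
    have eq: "(norm (S (Suc k) \<omega>))\<^sup>2 = (norm (S k \<omega>))\<^sup>2 + ?\<phi> \<omega> * Z k \<omega> + ?\<psi> \<omega> * (Z k \<omega>)\<^sup>2" for \<omega>
    proof -
      have "S (Suc k) \<omega> = S k \<omega> + Z k \<omega> *\<^sub>R \<eta> k \<omega>" by (simp add: S_def)
      then show ?thesis
        by (simp only: power2_norm_eq_inner)
           (simp add: inner_add inner_commute algebra_simps power2_eq_square[of "Z k \<omega>"])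
    qed
    have i1: "integrable M (\<lambda>\<omega>. ?\<phi> \<omega> * Z k \<omega>)" and i2: "integrable M (\<lambda>\<omega>. ?\<psi> \<omega> * (Z k \<omega>)\<^sup>2)"
      using m1(1) m2(1) Zi sq by auto
    have "expectation (\<lambda>\<omega>. (norm (S (Suc k) \<omega>))\<^sup>2) =
        expectation (\<lambda>\<omega>. (norm (S k \<omega>))\<^sup>2) + expectation (\<lambda>\<omega>. ?\<phi> \<omega> * Z k \<omega>) + expectation (\<lambda>\<omega>. ?\<psi> \<omega> * (Z k \<omega>)\<^sup>2)"
      unfolding eq using i1 i2 IH(1) by simp
    also have "\<dots> = (\<Sum>j<Suc k. v j * expectation (\<lambda>\<omega>. (norm (\<eta> j \<omega>))\<^sup>2))"
      using m1(2) m2(2) Zi sq IH(2) mean[OF k] var[OF k] by simp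
    finally have "expectation (\<lambda>\<omega>. (norm (S (Suc k) \<omega>))\<^sup>2) = (\<Sum>j<Suc k. v j * expectation (\<lambda>\<omega>. (norm (\<eta> j \<omega>))\<^sup>2))" .
    moreover have "integrable M (\<lambda>\<omega>. (norm (S (Suc k) \<omega>))\<^sup>2)"
      unfolding eq using i1 i2 IH(1) by simp
    ultimately show ?case by simp
  qed
  then show "integrable M (\<lambda>\<omega>. (norm (\<Sum>j<k. Z j \<omega> *\<^sub>R \<eta> j \<omega>))\<^sup>2)"
    "expectation (\<lambda>\<omega>. (norm (\<Sum>j<k. Z j \<omega> *\<^sub>R \<eta> j \<omega>))\<^sup>2)
      = (\<Sum>j<k. v j * expectation (\<lambda>\<omega>. (norm (\<eta> j \<omega>))\<^sup>2))"
    by (simp_all add: S_def)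
qed

lemma transform_exceeds_event:
  fixes \<eta> :: "nat \<Rightarrow> 'w \<Rightarrow> 'b::euclidean_space"
  assumes \<eta>: "\<And>i. i < N \<Longrightarrow> \<eta> i \<in> borel_measurable (G i)"
  shows "{\<omega>\<in>space M. \<exists>k\<le>N. \<epsilon> < norm (\<Sum>j<k. Z j \<omega> *\<^sub>R \<eta> j \<omega>)} \<in> events"
  by (intro exceeds_event measurable_M[OF transform_measurable] \<eta>)

text \<open>An inequality of Lenglart type for coefficients that may be unbounded. Coefficients are
  replaced by 0 once the budget \<open>\<delta>\<close> for the quadratic variation is overdrawn or
  the sum has passed \<open>\<epsilon>\<close>. The stopped transform has second moment at most
  \<open>\<delta>\<close>, and within the budget its terminal value is already large whenever some
  partial sum was, so Markov's inequality at time \<open>N\<close> controls the maximum.\<close>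

lemma max_transform_inequality:
  fixes \<eta> :: "nat \<Rightarrow> 'w \<Rightarrow> 'b::euclidean_space"
  assumes \<eta>: "\<And>i. i < N \<Longrightarrow> \<eta> i \<in> borel_measurable (G i)"
    and "0 < \<epsilon>" "0 < \<delta>"
  shows "prob {\<omega>\<in>space M. \<exists>k\<le>N. \<epsilon> < norm (\<Sum>j<k. Z j \<omega> *\<^sub>R \<eta> j \<omega>)} \<le>
    prob {\<omega>\<in>space M. \<delta> < (\<Sum>j<N. v j * (norm (\<eta> j \<omega>))\<^sup>2)} + \<delta> / \<epsilon>\<^sup>2"
proof -
  define S where "S k \<omega> = (\<Sum>j<k. Z j \<omega> *\<^sub>R \<eta> j \<omega>)" for k \<omega>
  define A where "A k \<omega> = (\<Sum>j<k. v j * (norm (\<eta> j \<omega>))\<^sup>2)" for k \<omega>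
  \<comment> \<open>The budget is checked with \<open>A (Suc k)\<close>, that is including the
    coefficient about to be used. This is still known at time \<open>k\<close>, and it keeps the
    stopped transform from ever overspending.\<close>
  define P where "P k \<omega> \<longleftrightarrow> A (Suc k) \<omega> \<le> \<delta> \<and> (\<forall>i\<le>k. norm (S i \<omega>) \<le> \<epsilon>)" for k \<omega>
  define \<zeta> where "\<zeta> k \<omega> = (if P k \<omega> then \<eta> k \<omega> else 0)" for k \<omega>
  define S' where "S' k \<omega> = (\<Sum>j<k. Z j \<omega> *\<^sub>R \<zeta> j \<omega>)" for k \<omega>
  \<comment> \<open>While \<open>P k\<close> holds, \<open>v k\<close> times the squared norm of
    \<open>\<eta> k\<close> is at most \<open>\<delta>\<close>, so the coefficient is at most
    \<open>sqrt (\<delta> / v k)\<close>; the sum of these bounds serves all indices.\<close>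
  define C where "C = (\<Sum>j<N. sqrt (\<delta> / v j))"
  have [measurable]: "S k \<in> borel_measurable M" if "k \<le> N" for k
    unfolding S_def using that by (intro measurable_M[OF transform_measurable] \<eta>)
  have A_measurable: "A k \<in> borel_measurable L" if "\<And>j. j < k \<Longrightarrow> \<eta> j \<in> borel_measurable L" for k L
    unfolding A_def using that
    by (intro borel_measurable_sum borel_measurable_times borel_measurable_power borel_measurable_norm
        borel_measurable_const measurable_compose[OF _ borel_measurable_norm]) auto
  have [measurable]: "A N \<in> borel_measurable M"
    by (rule A_measurable) (rule measurable_M[OF \<eta>], auto)
  have \<zeta>G: "\<zeta> k \<in> borel_measurable (G k)" if k: "k < N" for k
  proof -
    have "Measurable.pred (G k) (\<lambda>\<omega>. norm (S i \<omega>) \<le> \<epsilon>)" if "i \<le> k" for i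
    proof -
      have [measurable]: "S i \<in> borel_measurable (G k)"
        unfolding S_def using that k by (intro measurable_mono[OF transform_measurable] \<eta>) auto
      show ?thesis by measurable
    qed
    then have *: "Measurable.pred (G k) (\<lambda>\<omega>. \<forall>i\<in>{..k}. norm (S i \<omega>) \<le> \<epsilon>)"
      by (rule_tac pred_intros_finite(3)) auto
    have [measurable]: "A (Suc k) \<in> borel_measurable (G k)"
      using k by (intro A_measurable measurable_mono[OF \<eta>]) auto
    have "P k = (\<lambda>\<omega>. A (Suc k) \<omega> \<le> \<delta> \<and> (\<forall>i\<in>{..k}. norm (S i \<omega>) \<le> \<epsilon>))"
      by (auto simp: P_def fun_eq_iff)
    moreover have "Measurable.pred (G k) (\<lambda>\<omega>. A (Suc k) \<omega> \<le> \<delta>)" by measurable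
    ultimately have "Measurable.pred (G k) (P k)"
      using pred_intros_logic(3)[OF _ *] by simp
    then show ?thesis
      unfolding \<zeta>_def[abs_def] using \<eta>[OF k] by measurable
  qed
  have v: "0 \<le> v j" if "j < N" for j using v_pos[OF that] by simp
  have C: "norm (\<zeta> k \<omega>) \<le> C" if k: "k < N" for k \<omega>
  proof (cases "P k \<omega>")
    case True
    have "v k * (norm (\<eta> k \<omega>))\<^sup>2 \<le> A (Suc k) \<omega>"
      unfolding A_def using k v by (intro member_le_sum) auto
    then have "(norm (\<eta> k \<omega>))\<^sup>2 \<le> \<delta> / v k"
      using True v_pos[OF k] by (simp add: P_def field_simps)
    then have "norm (\<eta> k \<omega>) \<le> sqrt (\<delta> / v k)"
      by (rule real_le_rsqrt)
    also have "\<dots> \<le> C"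
      unfolding C_def using k v \<open>0 < \<delta>\<close> by (intro member_le_sum) auto
    finally show ?thesis using True by (simp add: \<zeta>_def)
  next
    case False
    then show ?thesis
      unfolding \<zeta>_def C_def using v \<open>0 < \<delta>\<close> by (auto intro!: sum_nonneg)
  qed
  have A_mono: "A i \<omega> \<le> A j \<omega>" if "i \<le> j" "j \<le> N" for i j \<omega>
    unfolding A_def using that v by (intro sum_mono2) auto
  \<comment> \<open>If \<open>P k\<close> holds, the whole sum is below \<open>A (Suc k)\<close>; if
    not, its last term is 0 and the induction hypothesis remains.\<close>
  have le_\<delta>: "(\<Sum>j<k. v j * (norm (\<zeta> j \<omega>))\<^sup>2) \<le> \<delta>" if "k \<le> N" for k \<omega>
    using that
  proof (induction k)
    case 0 then show ?case using \<open>0 < \<delta>\<close> by simp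
  next
    case (Suc k)
    show ?case
    proof (cases "P k \<omega>")
      case True
      have "(\<Sum>j<Suc k. v j * (norm (\<zeta> j \<omega>))\<^sup>2) \<le> A (Suc k) \<omega>"
        unfolding A_def \<zeta>_def using v Suc.prems by (intro sum_mono) auto
      then show ?thesis using True by (simp add: P_def)
    next
      case False
      then show ?thesis using Suc by (simp add: \<zeta>_def)
    qed
  qed
  \<comment> \<open>As long as the budget lasts, the stopped sum freezes at its first value beyond \<open>\<epsilon>\<close>.\<close>
  have stopped: "\<epsilon> < norm (S' n \<omega>)" if "A N \<omega> \<le> \<delta>" "k \<le> N" "\<epsilon> < norm (S k \<omega>)" "n = N" for \<omega> k n
  proof -
    define m where "m = (LEAST m. \<epsilon> < norm (S m \<omega>))"
    have m: "\<epsilon> < norm (S m \<omega>)" "m \<le> k"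
      unfolding m_def using that(3) by (auto intro: LeastI Least_le)
    have less: "norm (S i \<omega>) \<le> \<epsilon>" if "i < m" for i
      using not_less_Least[of i "\<lambda>m. \<epsilon> < norm (S m \<omega>)"] that unfolding m_def by auto
    have Pm: "P j \<omega> \<longleftrightarrow> j < m" if "j < N" for j
    proof
      assume "P j \<omega>"
      then show "j < m" using m(1) unfolding P_def by (metis leD leI)
    next
      assume "j < m"
      moreover have "A (Suc j) \<omega> \<le> \<delta>"
        using A_mono[of "Suc j" N \<omega>] that \<open>A N \<omega> \<le> \<delta>\<close> by simp
      ultimately show "P j \<omega>" using less by (auto simp: P_def)
    qed
    have "S' N \<omega> = (\<Sum>j<N. if j < m then Z j \<omega> *\<^sub>R \<eta> j \<omega> else 0)"
      unfolding S'_def \<zeta>_def by (intro sum.cong) (auto simp: Pm)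
    also have "\<dots> = S m \<omega>"
      unfolding S_def using m \<open>k \<le> N\<close> by (intro sum.mono_neutral_cong_right) auto
    finally show ?thesis using m \<open>n = N\<close> by simp
  qed
  have Ci: "integrable M (\<lambda>\<omega>. (norm (S' N \<omega>))\<^sup>2)" and
    E: "expectation (\<lambda>\<omega>. (norm (S' N \<omega>))\<^sup>2) = (\<Sum>j<N. v j * expectation (\<lambda>\<omega>. (norm (\<zeta> j \<omega>))\<^sup>2))"
    unfolding S'_def using transform_second_moment[of \<zeta> C N] \<zeta>G C by auto
  have \<zeta>i: "integrable M (\<lambda>\<omega>. (norm (\<zeta> j \<omega>))\<^sup>2)" if "j < N" for j
    using C[OF that] measurable_M[OF \<zeta>G[OF that]] that
    by (intro integrable_const_bound[where B = "C\<^sup>2"]) (auto intro!: power_mono)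
  have [measurable]: "S' N \<in> borel_measurable M"
    unfolding S'_def by (intro measurable_M[OF transform_measurable] \<zeta>G) auto
  have "expectation (\<lambda>\<omega>. (norm (S' N \<omega>))\<^sup>2) = expectation (\<lambda>\<omega>. \<Sum>j<N. v j * (norm (\<zeta> j \<omega>))\<^sup>2)"
    unfolding E using \<zeta>i by simp
  also have "\<dots> \<le> expectation (\<lambda>\<omega>. \<delta>)"
    using \<zeta>i le_\<delta>[of N] by (intro integral_mono) auto
  finally have E': "expectation (\<lambda>\<omega>. (norm (S' N \<omega>))\<^sup>2) \<le> \<delta>"
    by (simp add: prob_space)
  have sub: "{\<omega>\<in>space M. \<exists>k\<le>N. \<epsilon> < norm (S k \<omega>)} \<subseteq>
    {\<omega>\<in>space M. \<delta> < A N \<omega>} \<union> {\<omega>\<in>space M. \<epsilon>\<^sup>2 \<le> (norm (S' N \<omega>))\<^sup>2}"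
  proof (intro subsetI UnCI, elim CollectE conjE exE, intro CollectI conjI)
    fix \<omega> k
    assume "\<omega> \<notin> {\<omega>\<in>space M. \<epsilon>\<^sup>2 \<le> (norm (S' N \<omega>))\<^sup>2}" and k: "\<omega> \<in> space M" "k \<le> N" "\<epsilon> < norm (S k \<omega>)"
    then have "\<not> \<epsilon> < norm (S' N \<omega>)"
      using \<open>0 < \<epsilon>\<close> power_mono[of \<epsilon> "norm (S' N \<omega>)" 2] by auto
    then show "\<delta> < A N \<omega>"
      using stopped[OF _ k(2,3) refl] by (meson not_le)
  qed
  have "prob {\<omega>\<in>space M. \<exists>k\<le>N. \<epsilon> < norm (S k \<omega>)} \<le>
    prob {\<omega>\<in>space M. \<delta> < A N \<omega>} + prob {\<omega>\<in>space M. \<epsilon>\<^sup>2 \<le> (norm (S' N \<omega>))\<^sup>2}"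
    by (rule order_trans[OF finite_measure_mono[OF sub] measure_Un_le]) measurable
  also have "prob {\<omega>\<in>space M. \<epsilon>\<^sup>2 \<le> (norm (S' N \<omega>))\<^sup>2} \<le> expectation (\<lambda>\<omega>. (norm (S' N \<omega>))\<^sup>2) / \<epsilon>\<^sup>2"
    using \<open>0 < \<epsilon>\<close> by (intro integral_Markov_inequality_measure[where A = "space M"] Ci) auto
  also have "\<dots> \<le> \<delta> / \<epsilon>\<^sup>2"
    using E' by (intro divide_right_mono) auto
  finally show ?thesis by (simp add: S_def A_def)
qed

end

section \<open>Brownian increments and simple integrals\<close>

text \<open>The first moments serve the increment, the others its centred square, whose variance is
  3 - 2 + 1 = 2 times \<open>\<sigma>^4\<close> by the fourth moment of the normal law.\<close>

lemma normal_moments: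
  assumes "prob_space M" and D: "distributed M lborel Y (normal_density 0 \<sigma>)" and "0 < \<sigma>"
  shows "integrable M (\<lambda>\<omega>. (Y \<omega>)\<^sup>2)" and "(\<integral>\<omega>. Y \<omega> \<partial>M) = 0" and "(\<integral>\<omega>. (Y \<omega>)\<^sup>2 \<partial>M) = \<sigma>\<^sup>2"
    and "integrable M (\<lambda>\<omega>. ((Y \<omega>)\<^sup>2 - \<sigma>\<^sup>2)\<^sup>2)" and "(\<integral>\<omega>. (Y \<omega>)\<^sup>2 - \<sigma>\<^sup>2 \<partial>M) = 0"
    and "(\<integral>\<omega>. ((Y \<omega>)\<^sup>2 - \<sigma>\<^sup>2)\<^sup>2 \<partial>M) = 2 * \<sigma>^4"
proof -
  interpret prob_space M by fact
  have moment: "integrable M (\<lambda>\<omega>. g (Y \<omega>)) \<and> expectation (\<lambda>\<omega>. g (Y \<omega>)) = m"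
    if "has_bochner_integral lborel (\<lambda>x. normal_density 0 \<sigma> x * g x) m" "g \<in> borel_measurable lborel" for g m
    using that distributed_integrable[OF D that(2)] distributed_integral[OF D that(2)]
    by (simp add: has_bochner_integral_iff)
  have m1: "expectation Y = 0"
    using moment[OF normal_moment_nz_1] \<open>0 < \<sigma>\<close> by simp
  have m2: "integrable M (\<lambda>\<omega>. (Y \<omega>)\<^sup>2)" "expectation (\<lambda>\<omega>. (Y \<omega>)\<^sup>2) = \<sigma>\<^sup>2"
    using moment[of "\<lambda>x. x\<^sup>2" "\<sigma>\<^sup>2"] normal_moment_even[OF \<open>0 < \<sigma>\<close>, of 0 1] by simp_all
  have m4: "integrable M (\<lambda>\<omega>. (Y \<omega>)^4)" "expectation (\<lambda>\<omega>. (Y \<omega>)^4) = 3 * \<sigma>^4"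
  proof -
    have "fact 4 / ((2 / \<sigma>\<^sup>2)\<^sup>2 * fact 2) = 3 * \<sigma>^4"
      using \<open>0 < \<sigma>\<close> by (simp add: fact_numeral field_simps)
    then show "integrable M (\<lambda>\<omega>. (Y \<omega>)^4)" "expectation (\<lambda>\<omega>. (Y \<omega>)^4) = 3 * \<sigma>^4"
      using moment[of "\<lambda>x. x^4" "3 * \<sigma>^4"] normal_moment_even[OF \<open>0 < \<sigma>\<close>, of 0 2] by simp_all
  qed
  have eq: "((Y \<omega>)\<^sup>2 - \<sigma>\<^sup>2)\<^sup>2 = (Y \<omega>)^4 - 2 * \<sigma>\<^sup>2 * (Y \<omega>)\<^sup>2 + \<sigma>^4" for \<omega>
    by (simp add: power2_eq_square power4_eq_xxxx algebra_simps)
  show "integrable M (\<lambda>\<omega>. (Y \<omega>)\<^sup>2)" "expectation Y = 0" "expectation (\<lambda>\<omega>. (Y \<omega>)\<^sup>2) = \<sigma>\<^sup>2"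
    by fact+
  show "integrable M (\<lambda>\<omega>. ((Y \<omega>)\<^sup>2 - \<sigma>\<^sup>2)\<^sup>2)" "expectation (\<lambda>\<omega>. (Y \<omega>)\<^sup>2 - \<sigma>\<^sup>2) = 0"
    "expectation (\<lambda>\<omega>. ((Y \<omega>)\<^sup>2 - \<sigma>\<^sup>2)\<^sup>2) = 2 * \<sigma>^4"
    unfolding eq using m2 m4 power_add[of \<sigma> 2 2] by (simp_all add: prob_space mult.assoc)
qed

text \<open>Values are read off at right ends because simple integrands live on cells open to the
  left and closed to the right.\<close>

lemma step_function_integral:
  fixes h :: "real \<Rightarrow> real" and q :: "nat \<Rightarrow> real"
  assumes q: "\<And>j. j < N \<Longrightarrow> q j \<le> q (Suc j)" and step: "\<And>j s. j < N \<Longrightarrow> q j < s \<Longrightarrow> s \<le> q (Suc j) \<Longrightarrow> h s = h (q (Suc j))"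
  shows "set_integrable lborel {q 0..q N} h"
    and "(LINT s:{q 0..q N}|lborel. h s) = (\<Sum>j<N. (q (Suc j) - q j) * h (q (Suc j)))"
proof -
  have mono: "q i \<le> q n" if "i \<le> n" "n \<le> N" for i n
    using that
  proof (induction n rule: dec_induct)
    case (step n)
    then show ?case using q[of n] by simp
  qed simp
  have eq: "(\<Sum>j<n. indicator {q j<..q (Suc j)} s *\<^sub>R h (q (Suc j))) = indicator {q 0<..q n} s *\<^sub>R h s" if "n \<le> N" for n s
    using that
  proof (induction n)
    case (Suc n)
    then have "indicator {q 0<..q (Suc n)} s = indicator {q 0<..q n} s + (indicator {q n<..q (Suc n)} s :: real)"
      using mono[of 0 n] q[of n] by (auto simp: indicator_def)
    moreover have "indicator {q n<..q (Suc n)} s *\<^sub>R h (q (Suc n)) = indicator {q n<..q (Suc n)} s *\<^sub>R h s"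
      using step[of n s] Suc.prems by (auto simp: indicator_def)
    ultimately show ?case using Suc by (auto simp: distrib_right)
  qed simp
  have "has_bochner_integral lborel (\<lambda>s. \<Sum>j<N. indicator {q j<..q (Suc j)} s *\<^sub>R h (q (Suc j)))
      (\<Sum>j<N. (q (Suc j) - q j) *\<^sub>R h (q (Suc j)))"
  proof (rule has_bochner_integral_sum)
    fix j assume "j \<in> {..<N}"
    then have "has_bochner_integral lborel (indicator {q j<..q (Suc j)} :: real \<Rightarrow> real) (q (Suc j) - q j)"
      using has_bochner_integral_real_indicator[of "{q j<..q (Suc j)}" lborel] q[of j] by simp
    then show "has_bochner_integral lborel (\<lambda>s. indicator {q j<..q (Suc j)} s *\<^sub>R h (q (Suc j))) ((q (Suc j) - q j) *\<^sub>R h (q (Suc j)))"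
      by (rule has_bochner_integral_scaleR_left)
  qed
  then have "has_bochner_integral lborel (\<lambda>s. indicator {q 0<..q N} s *\<^sub>R h s) (\<Sum>j<N. (q (Suc j) - q j) *\<^sub>R h (q (Suc j)))"
    using eq[of N] by simp
  \<comment> \<open>The half-open cells miss the left end \<open>q 0\<close>, where \<open>h\<close>
    is arbitrary; it is added back as a null set.\<close>
  then have h: "has_bochner_integral lborel (\<lambda>s. indicator {q 0..q N} s *\<^sub>R h s) (\<Sum>j<N. (q (Suc j) - q j) *\<^sub>R h (q (Suc j)))"
  proof (rule has_bochner_integral_cong_AE[THEN iffD1, rotated 3])
    show "AE s in lborel. indicator {q 0<..q N} s *\<^sub>R h s = indicator {q 0..q N} s *\<^sub>R h s"
      using AE_lborel_singleton[of "q 0"] by eventually_elim (auto simp: indicator_def)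
    show [measurable]: "(\<lambda>s. indicator {q 0<..q N} s *\<^sub>R h s) \<in> borel_measurable lborel"
      using \<open>has_bochner_integral lborel (\<lambda>s. indicator {q 0<..q N} s *\<^sub>R h s) _\<close> by (auto simp: has_bochner_integral_iff)
    have "(\<lambda>s. indicator {q 0<..q N} s *\<^sub>R h s + indicator {q 0} s *\<^sub>R h (q 0)) \<in> borel_measurable lborel"
      by measurable
    also have "(\<lambda>s. indicator {q 0<..q N} s *\<^sub>R h s + indicator {q 0} s *\<^sub>R h (q 0)) = (\<lambda>s. indicator {q 0..q N} s *\<^sub>R h s)"
      using mono[of 0 N] by (auto simp: indicator_def fun_eq_iff)
    finally show "(\<lambda>s. indicator {q 0..q N} s *\<^sub>R h s) \<in> borel_measurable lborel" .
  qed
  show "set_integrable lborel {q 0..q N} h"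
    "(LINT s:{q 0..q N}|lborel. h s) = (\<Sum>j<N. (q (Suc j) - q j) * h (q (Suc j)))"
    using h by (auto simp: set_integrable_def set_lebesgue_integral_def has_bochner_integral_iff)
qed

section \<open>Simple integrands on a common refinement\<close>

text \<open>This is \<open>simple_data\<close> without boundedness, so that Riemann sums of an
  unbounded process are covered as well.\<close>

definition adapted_data ::
    "(real \<Rightarrow> 'w measure) \<Rightarrow> real \<Rightarrow> nat \<Rightarrow> (nat \<Rightarrow> real) \<Rightarrow> (nat \<Rightarrow> 'w \<Rightarrow> 'b::euclidean_space) \<Rightarrow> bool" where
  "adapted_data F T k \<tau> \<xi> \<longleftrightarrow>
     \<tau> 0 = 0 \<and> \<tau> k = T \<and> (\<forall>i<k. \<tau> i \<le> \<tau> (Suc i)) \<and> (\<forall>i<k. \<xi> i \<in> borel_measurable (F (\<tau> i)))"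

lemma simple_data_imp_adapted: "simple_data M F T k \<tau> \<xi> \<Longrightarrow> adapted_data F T k \<tau> \<xi>"
  by (auto simp: simple_data_def adapted_data_def)

lemma adapted_data_mono: "adapted_data F T k \<tau> \<xi> \<Longrightarrow> i \<le> j \<Longrightarrow> j \<le> k \<Longrightarrow> \<tau> i \<le> \<tau> j"
proof (induction j)
  case (Suc j)
  then show ?case
    by (cases "i = Suc j") (auto simp: adapted_data_def intro: order_trans)
qed simp

text \<open>The node list \<open>\<tau>\<close> may repeat values, while \<open>q\<close> is
  strictly increasing, so that its steps have positive length and it can carry a
  \<open>noise_sequence\<close>.\<close>

definition refines :: "nat \<Rightarrow> (nat \<Rightarrow> real) \<Rightarrow> nat \<Rightarrow> (nat \<Rightarrow> real) \<Rightarrow> bool" where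
  "refines N q k \<tau> \<longleftrightarrow> strict_mono_on {..N} q \<and> \<tau> ` {..k} \<subseteq> q ` {..N}"

text \<open>No node of \<open>\<tau>\<close> lies strictly inside a cell of \<open>q\<close>; hence
  cells of \<open>\<tau>\<close> are unions of cells of \<open>q\<close> and simple integrands are
  constant on the latter.\<close>

lemma refines_less:
  assumes "refines N q k \<tau>" and "i \<le> k" and "j < N" and "\<tau> i < q (Suc j)"
  shows "\<tau> i \<le> q j"
proof -
  obtain u where u: "u \<le> N" "\<tau> i = q u" using assms by (auto simp: refines_def)
  have "\<not> Suc j \<le> u"
    using assms u strict_mono_onD[of "{..N}" q "Suc j" u] by (cases "Suc j = u") (auto simp: refines_def)
  then show ?thesis
    using assms u strict_mono_onD[of "{..N}" q u j] by (cases "u = j") (auto simp: refines_def)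
qed

lemma refined_indicator:
  assumes "refines N q k \<tau>" and "i < k" and "j < N" and "q j < s" and "s \<le> q (Suc j)"
  shows "indicator {\<tau> i<..\<tau> (Suc i)} s = (indicator {\<tau> i<..\<tau> (Suc i)} (q (Suc j)) :: real)"
  using refines_less[OF assms(1), of i j] refines_less[OF assms(1), of "Suc i" j] assms
  by (auto simp: indicator_def not_le not_less)

lemma simple_integrand_step:
  assumes "refines N q k \<tau>" and "j < N" and "q j < s" and "s \<le> q (Suc j)"
  shows "simple_integrand k \<tau> \<xi> s \<omega> = simple_integrand k \<tau> \<xi> (q (Suc j)) \<omega>"
  unfolding simple_integrand_def using refined_indicator[OF assms(1) _ assms(2-)] by auto

text \<open>The increment of \<open>W\<close> over a cell of \<open>\<tau>\<close> telescopes over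
  the cells of \<open>q\<close> inside it; exchanging the two sums does the rest. For a repeated
  node the inner sum is empty.\<close>

lemma simple_ito_integral_refine:
  assumes r: "refines N q k \<tau>" and a: "adapted_data F T k \<tau> \<xi>"
  shows "simple_ito_integral W k \<tau> \<xi> \<omega> =
    (\<Sum>j<N. (W (q (Suc j)) \<omega> - W (q j) \<omega>) *\<^sub>R simple_integrand k \<tau> \<xi> (q (Suc j)) \<omega>)"
proof -
  have "W (\<tau> (Suc i)) \<omega> - W (\<tau> i) \<omega> =
      (\<Sum>j<N. (W (q (Suc j)) \<omega> - W (q j) \<omega>) * indicator {\<tau> i<..\<tau> (Suc i)} (q (Suc j)))" if i: "i < k" for i
  proof -
    obtain u v where uv: "u \<le> N" "v \<le> N" "\<tau> i = q u" "\<tau> (Suc i) = q v"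
      using r i by (auto simp: refines_def image_subset_iff image_iff) (metis Suc_leI atMost_iff less_imp_le)
    have q: "q x \<le> q y \<longleftrightarrow> x \<le> y" "q x < q y \<longleftrightarrow> x < y" if "x \<le> N" "y \<le> N" for x y
      using r that by (auto simp: refines_def strict_mono_on_less_eq strict_mono_on_less)
    have "u \<le> v" using adapted_data_mono[OF a, of i "Suc i"] i uv q by auto
    have "(\<Sum>j<N. (W (q (Suc j)) \<omega> - W (q j) \<omega>) * indicator {\<tau> i<..\<tau> (Suc i)} (q (Suc j))) =
        (\<Sum>j=u..<v. W (q (Suc j)) \<omega> - W (q j) \<omega>)"
    proof (rule sum.mono_neutral_cong_right)
      show "\<forall>j\<in>{..<N} - {u..<v}. (W (q (Suc j)) \<omega> - W (q j) \<omega>) * indicator {\<tau> i<..\<tau> (Suc i)} (q (Suc j)) = 0"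
        using uv q by (auto simp: indicator_def)
      show "(W (q (Suc j)) \<omega> - W (q j) \<omega>) * indicator {\<tau> i<..\<tau> (Suc i)} (q (Suc j)) = W (q (Suc j)) \<omega> - W (q j) \<omega>"
        if "j \<in> {u..<v}" for j
        using uv q that by (auto simp: indicator_def)
    qed (use uv in auto)
    also have "\<dots> = W (q v) \<omega> - W (q u) \<omega>"
      using sum_Suc_diff'[OF \<open>u \<le> v\<close>, of "\<lambda>j. W (q j) \<omega>"] by simp
    finally show ?thesis using uv by simp
  qed
  then have "simple_ito_integral W k \<tau> \<xi> \<omega> =
      (\<Sum>i<k. \<Sum>j<N. ((W (q (Suc j)) \<omega> - W (q j) \<omega>) * indicator {\<tau> i<..\<tau> (Suc i)} (q (Suc j))) *\<^sub>R \<xi> i \<omega>)"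
    unfolding simple_ito_integral_def by (intro sum.cong refl) (simp only: lessThan_iff scaleR_sum_left)
  also have "\<dots> = (\<Sum>j<N. \<Sum>i<k. ((W (q (Suc j)) \<omega> - W (q j) \<omega>) * indicator {\<tau> i<..\<tau> (Suc i)} (q (Suc j))) *\<^sub>R \<xi> i \<omega>)"
    by (rule sum.swap)
  finally show ?thesis
    by (simp only: simple_integrand_def scaleR_sum_right scaleR_scaleR)
qed

lemma common_refinement:
  assumes "adapted_data F T k \<tau> \<xi>" and "adapted_data F T k' \<tau>' \<xi>'"
  obtains N q where "refines N q k \<tau>" "refines N q k' \<tau>'" "q 0 = 0" "q N = T"
proof -
  define P where "P = \<tau> ` {..k} \<union> \<tau>' ` {..k'}"
  have P: "finite P" "P \<noteq> {}" "0 \<in> P" "T \<in> P"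
    using assms by (auto simp: P_def adapted_data_def image_iff)
  have in_P: "0 \<le> p \<and> p \<le> T" if "p \<in> P" for p
    using that adapted_data_mono[OF assms(1)] adapted_data_mono[OF assms(2)] assms
    by (auto simp: P_def adapted_data_def) (metis le0 order_refl)+
  define q where "q = (!) (sorted_list_of_set P)"
  \<comment> \<open>Nodes are numbered from 0, so the number of cells is one less than the number of
    distinct nodes.\<close>
  define N where "N = card P - 1"
  have N: "i \<le> N \<longleftrightarrow> i < card P" for i
    using P card_gt_0_iff[of P] unfolding N_def by auto
  have q_image: "q ` {..N} = P"
  proof -
    have "q ` {..N} = set (sorted_list_of_set P)"
      unfolding q_def set_conv_nth using N by auto
    then show ?thesis using P by simp
  qed
  have q_mono: "strict_mono_on {..N} q"
    unfolding q_def using strict_sorted_list_of_set[of P] N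
    by (intro strict_mono_onI) (auto simp: sorted_wrt_iff_nth_less)
  have le: "q 0 \<le> q i" "q i \<le> q N" if "i \<le> N" for i
    using that q_mono by (auto simp: strict_mono_on_less_eq)
  have "q 0 = 0"
    using P(3) in_P[of "q 0"] le q_image by (metis antisym atMost_iff image_iff zero_le)
  moreover have "q N = T"
    using P(4) in_P[of "q N"] le q_image by (metis antisym atMost_iff image_iff order_refl)
  ultimately show ?thesis
    using that[of N q] q_mono q_image unfolding refines_def P_def by auto
qed

locale brownian_setting =
  fixes M :: "'w measure" and F :: "real \<Rightarrow> 'w measure" and W :: "real \<Rightarrow> 'w \<Rightarrow> real"
  assumes filtered: "filtered_prob_space M F" and brownian: "brownian_motion M F W"
begin

sublocale prob_space M
  using filtered by (simp add: filtered_prob_space_def)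

lemma subalgebra_F: "0 \<le> t \<Longrightarrow> subalgebra M (F t)"
  using filtered by (simp add: filtered_prob_space_def)

lemma F_mono: "s \<le> t \<Longrightarrow> sets (F s) \<subseteq> sets (F t)" and space_F: "space (F t) = space M"
  using filtered by (auto simp: filtered_prob_space_def filtration_def)

lemma subalgebra_F_F: "s \<le> t \<Longrightarrow> subalgebra (F t) (F s)"
  by (simp add: subalgebra_def F_mono space_F)

lemma measurable_F_mono: "f \<in> measurable (F s) L \<Longrightarrow> s \<le> t \<Longrightarrow> f \<in> measurable (F t) L"
  by (rule measurable_from_subalg[OF subalgebra_F_F])

lemma measurable_F_M: "f \<in> measurable (F s) L \<Longrightarrow> 0 \<le> s \<Longrightarrow> f \<in> measurable M L"
  by (rule measurable_from_subalg[OF subalgebra_F])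

lemma W_adapted: "0 \<le> t \<Longrightarrow> W t \<in> borel_measurable (F t)"
  using brownian by (simp add: brownian_motion_def)

lemma W_continuous: "AE \<omega> in M. continuous_on {0..} (\<lambda>t. W t \<omega>)"
  using brownian by (simp add: brownian_motion_def)

lemma brownian_noise:
  assumes q: "strict_mono_on {..N} q" "0 \<le> q 0"
  shows "noise_sequence M (\<lambda>i. F (q i)) (\<lambda>i \<omega>. W (q (Suc i)) \<omega> - W (q i) \<omega>) (\<lambda>i. q (Suc i) - q i) N"
    and "noise_sequence M (\<lambda>i. F (q i)) (\<lambda>i \<omega>. (W (q (Suc i)) \<omega> - W (q i) \<omega>)\<^sup>2 - (q (Suc i) - q i))
      (\<lambda>i. 2 * (q (Suc i) - q i)\<^sup>2) N"
proof -
  have mono: "q i \<le> q j" if "i \<le> j" "j \<le> N" for i j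
    using q(1) that by (auto simp: strict_mono_on_less_eq)
  have pos: "0 \<le> q i" if "i \<le> N" for i
    using q(2) mono[of 0 i] that by simp
  have less: "q i < q (Suc i)" if "i < N" for i
    using q(1) that by (auto simp: strict_mono_on_less)
  let ?Y = "\<lambda>i \<omega>. W (q (Suc i)) \<omega> - W (q i) \<omega>"
  have ad: "?Y i \<in> borel_measurable (F (q (Suc i)))" if "i < N" for i
    using pos that less[OF that] by (intro borel_measurable_diff W_adapted measurable_F_mono[OF W_adapted]) auto
  have D: "distributed M lborel (?Y i) (normal_density 0 (sqrt (q (Suc i) - q i)))"
    and ind: "indep_set (sets (F (q i))) (sets (vimage_algebra (space M) (?Y i) borel))" if "i < N" for i
    using brownian pos[of i] less[OF that] that by (auto simp: brownian_motion_def)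
  note mom = normal_moments[OF prob_space_axioms D]
  have s: "0 < sqrt (q (Suc i) - q i)" if "i < N" for i using less[OF that] by simp
  have s2: "(sqrt (q (Suc i) - q i))\<^sup>2 = q (Suc i) - q i" if "i < N" for i using less[OF that] by simp
  have s4: "(sqrt (q (Suc i) - q i))^4 = (q (Suc i) - q i)\<^sup>2" if "i < N" for i
    using arg_cong[OF s2[OF that], of "\<lambda>x. x\<^sup>2"] by simp
  show "noise_sequence M (\<lambda>i. F (q i)) ?Y (\<lambda>i. q (Suc i) - q i) N"
  proof unfold_locales
    fix i j assume "i \<le> j" "j \<le> N"
    then show "sets (F (q i)) \<subseteq> sets (F (q j))" by (rule F_mono[OF mono])
  next
    fix i assume i: "i < N"
    show "integrable M (\<lambda>\<omega>. (?Y i \<omega>)\<^sup>2)" "expectation (?Y i) = 0"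
      "expectation (\<lambda>\<omega>. (?Y i \<omega>)\<^sup>2) = q (Suc i) - q i" "0 < q (Suc i) - q i"
      using mom(1-3)[OF i s[OF i]] s2[OF i] less[OF i] by simp_all
  qed (fact ad ind subalgebra_F[OF pos])+
  \<comment> \<open>The centred square is a Borel function of the increment, generates a smaller
    \<sigma>-algebra and so inherits the independence of the past.\<close>
  have sets: "sets (vimage_algebra (space M) (\<lambda>\<omega>. (?Y i \<omega>)\<^sup>2 - c) borel) \<subseteq> sets (vimage_algebra (space M) (?Y i) borel)" for i c
    unfolding sets_vimage_algebra
  proof (rule sigma_sets_mono')
    have *: "(\<lambda>x::real. x\<^sup>2 - c) \<in> borel_measurable borel" by measurable
    show "{(\<lambda>\<omega>. (?Y i \<omega>)\<^sup>2 - c) -` A \<inter> space M |A. A \<in> sets borel} \<subseteq> {?Y i -` A \<inter> space M |A. A \<in> sets borel}"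
    proof safe
      fix A :: "real set" assume "A \<in> sets borel"
      then have "(\<lambda>x. x\<^sup>2 - c) -` A \<in> sets borel"
        using measurable_sets[OF *] by simp
      then show "\<exists>B. (\<lambda>\<omega>. (?Y i \<omega>)\<^sup>2 - c) -` A \<inter> space M = ?Y i -` B \<inter> space M \<and> B \<in> sets borel"
        by (intro exI[of _ "(\<lambda>x. x\<^sup>2 - c) -` A"]) auto
    qed
  qed
  have ind2: "indep_set (sets (F (q i))) (sets (vimage_algebra (space M) (\<lambda>\<omega>. (?Y i \<omega>)\<^sup>2 - c) borel))" if "i < N" for i c
    using ind[OF that] unfolding indep_set_def
    by (rule indep_sets_mono_sets) (use sets in \<open>auto split: bool.split\<close>)
  show "noise_sequence M (\<lambda>i. F (q i)) (\<lambda>i \<omega>. (?Y i \<omega>)\<^sup>2 - (q (Suc i) - q i)) (\<lambda>i. 2 * (q (Suc i) - q i)\<^sup>2) N"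
  proof unfold_locales
    fix i j assume "i \<le> j" "j \<le> N"
    then show "sets (F (q i)) \<subseteq> sets (F (q j))" by (rule F_mono[OF mono])
  next
    fix i assume i: "i < N"
    show "(\<lambda>\<omega>. (?Y i \<omega>)\<^sup>2 - (q (Suc i) - q i)) \<in> borel_measurable (F (q (Suc i)))"
      using ad[OF i] by measurable
    show "0 < 2 * (q (Suc i) - q i)\<^sup>2" using less[OF i] by simp
    show "integrable M (\<lambda>\<omega>. ((?Y i \<omega>)\<^sup>2 - (q (Suc i) - q i))\<^sup>2)"
      "expectation (\<lambda>\<omega>. (?Y i \<omega>)\<^sup>2 - (q (Suc i) - q i)) = 0"
      "expectation (\<lambda>\<omega>. ((?Y i \<omega>)\<^sup>2 - (q (Suc i) - q i))\<^sup>2) = 2 * (q (Suc i) - q i)\<^sup>2"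
      using mom(4-6)[OF i s[OF i]] unfolding s2[OF i] s4[OF i] by simp_all
  qed (fact ind2 subalgebra_F[OF pos])+
qed

text \<open>The value at the right end of a refined cell is known at its left end: the coefficient
  active there belongs to a cell of \<open>\<tau>\<close> that has begun by then.\<close>

lemma simple_integrand_measurable_refined:
  assumes r: "refines N q k \<tau>" and a: "adapted_data F T k \<tau> \<xi>" and j: "j < N"
  shows "simple_integrand k \<tau> \<xi> (q (Suc j)) \<in> borel_measurable (F (q j))"
  unfolding simple_integrand_def[abs_def]
proof (rule borel_measurable_sum)
  fix i assume i: "i \<in> {..<k}"
  show "(\<lambda>\<omega>. indicator {\<tau> i<..\<tau> (Suc i)} (q (Suc j)) *\<^sub>R \<xi> i \<omega>) \<in> borel_measurable (F (q j))"
  proof (cases "q (Suc j) \<in> {\<tau> i<..\<tau> (Suc i)}")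
    case True
    then have "\<tau> i \<le> q j" using refines_less[OF r _ j, of i] i by simp
    then have "\<xi> i \<in> borel_measurable (F (q j))"
      using a i by (rule_tac measurable_F_mono[of "\<xi> i" "\<tau> i"]) (auto simp: adapted_data_def)
    then show ?thesis by simp
  qed simp
qed

text \<open>The Ito isometry in a form for convergence in probability. On a common refinement both
  integrals are transforms of the same Brownian noise, and the quadratic variation of the difference
  is exactly the squared distance of the integrands.\<close>

lemma simple_integral_diff_inequality:
  assumes a: "adapted_data F T k \<tau> \<xi>" and a': "adapted_data F T k' \<tau>' \<xi>'" and "0 < \<epsilon>" "0 < \<delta>"
  shows "prob {\<omega>\<in>space M. \<epsilon> < norm (simple_ito_integral W k \<tau> \<xi> \<omega> - simple_ito_integral W k' \<tau>' \<xi>' \<omega>)} \<le>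
    prob {\<omega>\<in>space M. \<delta> < (LINT s:{0..T}|lborel. (norm (simple_integrand k \<tau> \<xi> s \<omega> - simple_integrand k' \<tau>' \<xi>' s \<omega>))\<^sup>2)}
      + \<delta> / \<epsilon>\<^sup>2"
proof -
  obtain N q where r: "refines N q k \<tau>" "refines N q k' \<tau>'" and q: "q 0 = 0" "q N = T"
    using common_refinement[OF a a'] .
  have sm: "strict_mono_on {..N} q" using r by (simp add: refines_def)
  interpret noise_sequence M "\<lambda>i. F (q i)" "\<lambda>i \<omega>. W (q (Suc i)) \<omega> - W (q i) \<omega>" "\<lambda>i. q (Suc i) - q i" N
    using brownian_noise(1)[OF sm] q by simp
  let ?\<eta> = "\<lambda>j \<omega>. simple_integrand k \<tau> \<xi> (q (Suc j)) \<omega> - simple_integrand k' \<tau>' \<xi>' (q (Suc j)) \<omega>"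
  have \<eta>: "?\<eta> j \<in> borel_measurable (F (q j))" if "j < N" for j
    using simple_integrand_measurable_refined[OF r(1) a that] simple_integrand_measurable_refined[OF r(2) a' that]
    by (rule borel_measurable_diff)
  have 1: "simple_ito_integral W k \<tau> \<xi> \<omega> - simple_ito_integral W k' \<tau>' \<xi>' \<omega> = (\<Sum>j<N. (W (q (Suc j)) \<omega> - W (q j) \<omega>) *\<^sub>R ?\<eta> j \<omega>)" for \<omega>
    unfolding simple_ito_integral_refine[OF r(1) a] simple_ito_integral_refine[OF r(2) a']
    by (simp add: sum_subtractf scaleR_diff_right)
  have 2: "(LINT s:{0..T}|lborel. (norm (simple_integrand k \<tau> \<xi> s \<omega> - simple_integrand k' \<tau>' \<xi>' s \<omega>))\<^sup>2) =
     (\<Sum>j<N. (q (Suc j) - q j) * (norm (?\<eta> j \<omega>))\<^sup>2)" for \<omega>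
    unfolding q[symmetric]
  proof (rule step_function_integral)
    show "q j \<le> q (Suc j)" if "j < N" for j using sm that by (auto simp: strict_mono_on_less_eq)
  next
    fix j s assume j: "j < N" "q j < s" "s \<le> q (Suc j)"
    show "(norm (simple_integrand k \<tau> \<xi> s \<omega> - simple_integrand k' \<tau>' \<xi>' s \<omega>))\<^sup>2 = (norm (?\<eta> j \<omega>))\<^sup>2"
      by (simp only: simple_integrand_step[OF r(1) j] simple_integrand_step[OF r(2) j])
  qed
  have "prob {\<omega>\<in>space M. \<epsilon> < norm (simple_ito_integral W k \<tau> \<xi> \<omega> - simple_ito_integral W k' \<tau>' \<xi>' \<omega>)} \<le>
     prob {\<omega>\<in>space M. \<exists>n\<le>N. \<epsilon> < norm (\<Sum>j<n. (W (q (Suc j)) \<omega> - W (q j) \<omega>) *\<^sub>R ?\<eta> j \<omega>)}"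
  proof (rule finite_measure_mono)
    show "{\<omega>\<in>space M. \<epsilon> < norm (simple_ito_integral W k \<tau> \<xi> \<omega> - simple_ito_integral W k' \<tau>' \<xi>' \<omega>)} \<subseteq>
      {\<omega>\<in>space M. \<exists>n\<le>N. \<epsilon> < norm (\<Sum>j<n. (W (q (Suc j)) \<omega> - W (q j) \<omega>) *\<^sub>R ?\<eta> j \<omega>)}"
    proof (rule subsetI, elim CollectE conjE, intro CollectI conjI exI)
      fix \<omega> assume "\<epsilon> < norm (simple_ito_integral W k \<tau> \<xi> \<omega> - simple_ito_integral W k' \<tau>' \<xi>' \<omega>)"
      then show "\<epsilon> < norm (\<Sum>j<N. (W (q (Suc j)) \<omega> - W (q j) \<omega>) *\<^sub>R ?\<eta> j \<omega>)"
        by (simp only: 1)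
    qed auto
  qed (rule transform_exceeds_event[OF \<eta>])
  also have "\<dots> \<le> prob {\<omega>\<in>space M. \<delta> < (\<Sum>j<N. (q (Suc j) - q j) * (norm (?\<eta> j \<omega>))\<^sup>2)} + \<delta> / \<epsilon>\<^sup>2"
    by (rule max_transform_inequality[OF \<eta> assms(3,4)])
  finally show ?thesis unfolding 2 .
qed

end

section \<open>Riemann sums along uniform grids\<close>

definition grid :: "real \<Rightarrow> nat \<Rightarrow> nat \<Rightarrow> real" where
  "grid T n j = T * real j / real n"

lemma grid_0 [simp]: "grid T n 0 = 0"
  by (simp add: grid_def)

lemma grid_end [simp]: "0 < n \<Longrightarrow> grid T n n = T"
  by (simp add: grid_def)

lemma grid_Suc: "grid T n (Suc j) = grid T n j + T / real n"
  by (simp add: grid_def add_divide_distrib ring_distribs)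

lemma grid_diff [simp]: "grid T n (Suc j) - grid T n j = T / real n"
  by (simp add: grid_Suc)

lemma grid_le_Suc: "0 \<le> T \<Longrightarrow> grid T n j \<le> grid T n (Suc j)"
  by (simp add: grid_Suc)

lemma grid_in: "0 \<le> T \<Longrightarrow> j \<le> n \<Longrightarrow> grid T n j \<in> {0..T}"
  by (auto simp: grid_def divide_simps mult_left_mono)

lemma grid_strict_mono: "0 < T \<Longrightarrow> 0 < n \<Longrightarrow> strict_mono_on A (grid T n)"
  by (intro strict_mono_onI) (simp add: grid_def divide_strict_right_mono)

lemma cell_exists:
  fixes \<tau> :: "nat \<Rightarrow> real"
  assumes "\<tau> 0 < s" "s \<le> \<tau> k"
  shows "\<exists>j<k. \<tau> j < s \<and> s \<le> \<tau> (Suc j)"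
  using assms(2)
proof (induction k)
  case 0
  then show ?case using assms(1) by simp
next
  case (Suc k)
  then show ?case by (cases "s \<le> \<tau> k") (auto simp: less_Suc_eq)
qed

lemma simple_integrand_cell:
  assumes mono: "\<And>i. i < k \<Longrightarrow> \<tau> i \<le> \<tau> (Suc i)" and j: "j < k" "\<tau> j < s" "s \<le> \<tau> (Suc j)"
  shows "simple_integrand k \<tau> \<xi> s \<omega> = \<xi> j \<omega>"
proof -
  have le: "\<tau> a \<le> \<tau> b" if "a \<le> b" "b \<le> k" for a b
    using that
  proof (induction b rule: dec_induct)
    case (step b)
    then show ?case using mono[of b] by simp
  qed simp
  have "s \<notin> {\<tau> i<..\<tau> (Suc i)}" if "i < k" "i \<noteq> j" for i
    using that j le[of "Suc i" j] le[of "Suc j" i] by (cases "i < j") auto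
  then have "simple_integrand k \<tau> \<xi> s \<omega> = (\<Sum>i<k. if i = j then \<xi> j \<omega> else 0)"
    unfolding simple_integrand_def using j by (intro sum.cong) (auto simp: indicator_def)
  then show ?thesis using j by simp
qed

section \<open>Quantities on grids that vanish uniformly over the nodes\<close>

text \<open>Convergence to 0 in the sup norm over the nodes 0, ..., \<open>N r\<close> of the
  \<open>r\<close>-th grid. The sizes \<open>N r\<close> are left free because they will be a
  subsequence found by Borel-Cantelli.\<close>

definition unif_vanishing :: "(nat \<Rightarrow> nat) \<Rightarrow> (nat \<Rightarrow> nat \<Rightarrow> 'b::real_normed_vector) \<Rightarrow> bool" where
  "unif_vanishing N u \<longleftrightarrow> (\<forall>e>0. \<forall>\<^sub>F r in sequentially. \<forall>j\<le>N r. norm (u r j) < e)"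

lemma unif_vanishingD: "unif_vanishing N u \<Longrightarrow> 0 < e \<Longrightarrow> \<forall>\<^sub>F r in sequentially. \<forall>j\<le>N r. norm (u r j) < e"
  by (simp add: unif_vanishing_def)

lemma unif_vanishing_add:
  assumes "unif_vanishing N u" "unif_vanishing N v"
  shows "unif_vanishing N (\<lambda>r j. u r j + v r j)"
  unfolding unif_vanishing_def
proof (intro allI impI)
  fix e :: real assume "0 < e"
  then have "\<forall>\<^sub>F r in sequentially. \<forall>j\<le>N r. norm (u r j) < e/2" "\<forall>\<^sub>F r in sequentially. \<forall>j\<le>N r. norm (v r j) < e/2"
    using unif_vanishingD[OF assms(1), of "e/2"] unif_vanishingD[OF assms(2), of "e/2"] by simp_all
  then show "\<forall>\<^sub>F r in sequentially. \<forall>j\<le>N r. norm (u r j + v r j) < e"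
    by eventually_elim (metis norm_add_less field_sum_of_halves)
qed

lemma unif_vanishing_le:
  assumes "unif_vanishing N u" and "\<forall>\<^sub>F r in sequentially. \<forall>j\<le>N r. norm (v r j) \<le> C * norm (u r j)"
  shows "unif_vanishing N v"
  unfolding unif_vanishing_def
proof (intro allI impI)
  fix e :: real assume e: "0 < e"
  have "\<forall>\<^sub>F r in sequentially. \<forall>j\<le>N r. norm (u r j) < e / (\<bar>C\<bar> + 1)"
    using e by (intro unif_vanishingD assms) auto
  then show "\<forall>\<^sub>F r in sequentially. \<forall>j\<le>N r. norm (v r j) < e"
    using assms(2)
  proof eventually_elim
    case (elim r)
    show ?case
    proof (intro allI impI)
      fix j assume j: "j \<le> N r"
      have "norm (v r j) \<le> C * norm (u r j)" using elim j by auto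
      also have "\<dots> \<le> (\<bar>C\<bar> + 1) * norm (u r j)" by (intro mult_right_mono) auto
      also have "\<dots> < (\<bar>C\<bar> + 1) * (e / (\<bar>C\<bar> + 1))" using elim j by (intro mult_strict_left_mono) auto
      finally show "norm (v r j) < e" by simp
    qed
  qed
qed

text \<open>A maximum tending to 0 times a bounded total weight. In the applications
  \<open>c\<close> consists of the squared increments of the driving path.\<close>

lemma unif_vanishing_sum:
  assumes u: "unif_vanishing N u" and c: "\<forall>\<^sub>F r in sequentially. (\<Sum>j<N r. c r j) \<le> C"
    and c0: "\<And>r j. 0 \<le> c r j"
    and v: "\<forall>\<^sub>F r in sequentially. \<forall>j<N r. norm (v r j) \<le> norm (u r j) * c r j"
  shows "unif_vanishing N (\<lambda>r k. \<Sum>j<k. v r j)"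
  unfolding unif_vanishing_def
proof (intro allI impI)
  fix e :: real assume e: "0 < e"
  have "\<forall>\<^sub>F r in sequentially. \<forall>j\<le>N r. norm (u r j) < e / (\<bar>C\<bar> + 1)"
    using e by (intro unif_vanishingD assms) auto
  then show "\<forall>\<^sub>F r in sequentially. \<forall>k\<le>N r. norm (\<Sum>j<k. v r j) < e"
    using c v
  proof eventually_elim
    case (elim r)
    show ?case
    proof (intro allI impI)
      fix k assume k: "k \<le> N r"
      have "norm (\<Sum>j<k. v r j) \<le> (\<Sum>j<k. e / (\<bar>C\<bar> + 1) * c r j)"
        using elim k c0
        by (intro sum_norm_le) (meson lessThan_iff less_imp_le less_le_trans mult_right_mono order_trans)
      also have "\<dots> \<le> (\<Sum>j<N r. e / (\<bar>C\<bar> + 1) * c r j)"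
        using k c0 e by (intro sum_mono2) auto
      also have "\<dots> \<le> e / (\<bar>C\<bar> + 1) * \<bar>C\<bar>"
        unfolding sum_distrib_left[symmetric] using elim e by (intro mult_left_mono) auto
      also have "\<dots> < e" using e by (simp add: field_simps)
      finally show "norm (\<Sum>j<k. v r j) < e" .
    qed
  qed
qed

lemma grid_modulus:
  fixes h :: "real \<Rightarrow> 'b::real_normed_vector"
  assumes h: "continuous_on {0..T} h" and "0 \<le> T" and N: "filterlim N at_top sequentially" and e: "0 < e"
  shows "\<forall>\<^sub>F r in sequentially. 0 < N r \<and> (\<forall>s\<in>{0..T}. \<forall>s'\<in>{0..T}. \<bar>s - s'\<bar> \<le> T / real (N r) \<longrightarrow> norm (h s - h s') < e)"
proof -
  have "uniformly_continuous_on {0..T} h"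
    using h by (intro compact_uniformly_continuous) auto
  then obtain d where d: "0 < d" "\<And>s s'. s \<in> {0..T} \<Longrightarrow> s' \<in> {0..T} \<Longrightarrow> dist s s' < d \<Longrightarrow> dist (h s) (h s') < e"
    unfolding uniformly_continuous_on_def using e by metis
  have "(\<lambda>r. T / real (N r)) \<longlonglongrightarrow> 0"
    by (intro tendsto_divide_0[OF tendsto_const] filterlim_at_top_imp_at_infinity
        filterlim_compose[OF filterlim_real_sequentially N])
  then have "\<forall>\<^sub>F r in sequentially. T / real (N r) < d"
    using d(1) by (rule order_tendstoD)
  moreover have "\<forall>\<^sub>F r in sequentially. 0 < N r"
    using eventually_compose_filterlim[OF eventually_gt_at_top N] .
  ultimately show ?thesis
  proof eventually_elim
    case (elim r)
    then show ?case
      using d(2) by (auto simp: dist_norm)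
  qed
qed

lemma grid_increment_vanishing:
  fixes h :: "real \<Rightarrow> 'b::real_normed_vector"
  assumes h: "continuous_on {0..T} h" and T: "0 \<le> T" and N: "filterlim N at_top sequentially"
  shows "\<forall>e>0. \<forall>\<^sub>F r in sequentially. \<forall>j<N r. norm (h (grid T (N r) (Suc j)) - h (grid T (N r) j)) < e"
proof (intro allI impI)
  fix e :: real assume "0 < e"
  from grid_modulus[OF h T N this]
  show "\<forall>\<^sub>F r in sequentially. \<forall>j<N r. norm (h (grid T (N r) (Suc j)) - h (grid T (N r) j)) < e"
  proof eventually_elim
    case (elim r)
    show ?case
    proof (intro allI impI)
      fix j assume "j < N r"
      then have "grid T (N r) (Suc j) \<in> {0..T}" "grid T (N r) j \<in> {0..T}"
        using T by (auto intro!: grid_in simp del: atLeastAtMost_iff)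
      then show "norm (h (grid T (N r) (Suc j)) - h (grid T (N r) j)) < e"
        using elim T by (simp del: atLeastAtMost_iff)
    qed
  qed
qed

lemma simple_integrand_L2_limit:
  fixes h :: "real \<Rightarrow> 'b::euclidean_space"
  assumes h: "continuous_on {0..T} h" and T: "0 \<le> T" and N: "filterlim N at_top sequentially"
    and c: "\<forall>e>0. \<forall>\<^sub>F r in sequentially. \<forall>j<N r. norm (c r j \<omega> - h (grid T (N r) j)) < e"
  shows "(\<lambda>r. LINT s:{0..T}|lborel. (norm (simple_integrand (N r) (grid T (N r)) (c r) s \<omega> - h s))\<^sup>2) \<longlonglongrightarrow> 0"
proof (rule tendstoI)
  fix e :: real assume e: "0 < e"
  \<comment> \<open>The integrand is off by at most \<open>2 * d\<close>: \<open>d\<close> for the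
    coefficient and \<open>d\<close> for the oscillation of \<open>h\<close> in a cell. The choice
    makes \<open>(2 * d)\<^sup>2 * T\<close> equal to \<open>e * T / (T + 1)\<close>.\<close>
  define d where "d = sqrt (e / (T + 1)) / 2"
  have d: "0 < d" and dT: "(2 * d)\<^sup>2 * T < e"
    using e T by (auto simp: d_def power_mult_distrib field_simps)
  have "\<forall>\<^sub>F r in sequentially. \<forall>j<N r. norm (c r j \<omega> - h (grid T (N r) j)) < d"
    using c d by auto
  then show "\<forall>\<^sub>F r in sequentially. dist (LINT s:{0..T}|lborel. (norm (simple_integrand (N r) (grid T (N r)) (c r) s \<omega> - h s))\<^sup>2) 0 < e"
    using grid_modulus[OF h T N d]
  proof eventually_elim
    case (elim r)
    have close: "norm (simple_integrand (N r) (grid T (N r)) (c r) s \<omega> - h s) \<le> 2 * d" if s: "0 < s" "s \<le> T" for s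
    proof -
      obtain j where j: "j < N r" "grid T (N r) j < s" "s \<le> grid T (N r) (Suc j)"
        using cell_exists[of "grid T (N r)" s "N r"] s elim by auto
      have "norm (c r j \<omega> - h (grid T (N r) j)) < d"
        using elim j by auto
      moreover have "norm (h (grid T (N r) j) - h s) < d"
        using elim j s T grid_in[OF T, of j "N r"] by (auto simp: grid_Suc)
      ultimately have "norm ((c r j \<omega> - h (grid T (N r) j)) + (h (grid T (N r) j) - h s)) < d + d"
        by (rule norm_add_less)
      moreover have "simple_integrand (N r) (grid T (N r)) (c r) s \<omega> = c r j \<omega>"
        using j T by (intro simple_integrand_cell grid_le_Suc)
      ultimately show ?thesis by simp
    qed
    have "(LINT s:{0..T}|lborel. (norm (simple_integrand (N r) (grid T (N r)) (c r) s \<omega> - h s))\<^sup>2) \<le> (LINT s:{0..T}|lborel. (2 * d)\<^sup>2)"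
      unfolding set_lebesgue_integral_def
    proof (rule integral_mono_AE')
      \<comment> \<open>Time 0 lies in no cell, so the simple integrand is 0 there whatever
        \<open>h\<close> is; a null set.\<close>
      show "AE s in lborel. indicator {0..T} s *\<^sub>R (norm (simple_integrand (N r) (grid T (N r)) (c r) s \<omega> - h s))\<^sup>2
          \<le> indicator {0..T} s *\<^sub>R (2 * d)\<^sup>2"
        using AE_lborel_singleton[of 0]
      proof eventually_elim
        case (elim s)
        show ?case
        proof (cases "s \<in> {0..T}")
          case True
          then show ?thesis using power_mono[OF close[of s] norm_ge_zero, of 2] elim by simp
        qed simp
      qed
      show "integrable lborel (\<lambda>s. indicator {0..T} s *\<^sub>R (2 * d)\<^sup>2)"
        by (intro integrable_scaleR_left integrable_real_indicator) (auto simp: emeasure_lborel_Icc_eq)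
    qed auto
    also have "\<dots> = (2 * d)\<^sup>2 * T"
      using T by (simp add: set_integral_const)
    finally have "(LINT s:{0..T}|lborel. (norm (simple_integrand (N r) (grid T (N r)) (c r) s \<omega> - h s))\<^sup>2) < e"
      using dT by simp
    moreover have "0 \<le> (LINT s:{0..T}|lborel. (norm (simple_integrand (N r) (grid T (N r)) (c r) s \<omega> - h s))\<^sup>2)"
      unfolding set_lebesgue_integral_def by (intro integral_nonneg_AE) auto
    ultimately show ?case by (simp add: dist_real_def)
  qed
qed

lemma riemann_sum_vanishing:
  fixes h :: "real \<Rightarrow> 'b::euclidean_space"
  assumes h: "continuous_on {0..T} h" and T: "0 \<le> T" and N: "filterlim N at_top sequentially"
  shows "unif_vanishing N (\<lambda>r k. (\<Sum>j<k. (T / real (N r)) *\<^sub>R h (grid T (N r) j)) - (LINT s:{0..grid T (N r) k}|lborel. h s))"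
  unfolding unif_vanishing_def
proof (intro allI impI)
  fix e :: real assume e: "0 < e"
  define d where "d = e / (T + 1)"
  have d: "0 < d" and dT: "d * T < e" using e T by (auto simp: d_def field_simps)
  show "\<forall>\<^sub>F r in sequentially. \<forall>k\<le>N r.
    norm ((\<Sum>j<k. (T / real (N r)) *\<^sub>R h (grid T (N r) j)) - (LINT s:{0..grid T (N r) k}|lborel. h s)) < e"
    using grid_modulus[OF h T N d]
  proof eventually_elim
    case (elim r)
    let ?t = "grid T (N r)" and ?D = "T / real (N r)"
    \<comment> \<open>The Henstock-Kurzweil integral is used for splitting the interval at the
      nodes.\<close>
    have eq: "(LINT s:{0..t}|lborel. h s) = integral {0..t} h" and int: "h integrable_on {0..t}" if "t \<le> T" for t
    proof -
      have c: "continuous_on {0..t} h"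
        using h that by (auto intro: continuous_on_subset)
      then show "(LINT s:{0..t}|lborel. h s) = integral {0..t} h" "h integrable_on {0..t}"
        using set_borel_integral_eq_integral[of "{0..t}" h] borel_integrable_compact[OF compact_Icc c]
        by (auto simp: set_integrable_def)
    qed
    \<comment> \<open>Each cell adds an error of at most \<open>d\<close> times its length, so the
      bound at every node stays below \<open>d * T\<close>.\<close>
    have "norm ((\<Sum>j<k. ?D *\<^sub>R h (?t j)) - integral {0..?t k} h) \<le> d * ?t k" if "k \<le> N r" for k
      using that
    proof (induction k)
      case (Suc k)
      have t: "0 \<le> ?t k" "?t k \<le> ?t (Suc k)" "?t (Suc k) \<le> T"
        using grid_in[OF T, of k "N r"] grid_in[OF T, of "Suc k" "N r"] grid_le_Suc[OF T] Suc.prems by auto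
      have sub: "h integrable_on {?t k..?t (Suc k)}"
        using integrable_subinterval_real[OF int[OF t(3)], of "?t k" "?t (Suc k)"] t by auto
      have "norm (integral {?t k..?t (Suc k)} (\<lambda>s. h (?t k) - h s)) \<le> d * (?t (Suc k) - ?t k)"
      proof (rule integral_bound)
        show "continuous_on {?t k..?t (Suc k)} (\<lambda>s. h (?t k) - h s)"
          using t by (intro continuous_intros continuous_on_subset[OF h]) auto
        show "norm (h (?t k) - h s) \<le> d" if "s \<in> {?t k..?t (Suc k)}" for s
          using that t elim by (auto simp: grid_Suc intro!: less_imp_le)
      qed (use t in auto)
      moreover have "integral {?t k..?t (Suc k)} (\<lambda>s. h (?t k) - h s) = ?D *\<^sub>R h (?t k) - integral {?t k..?t (Suc k)} h"
        using Henstock_Kurzweil_Integration.integral_diff[OF integrable_const_ivl sub, of "h (?t k)"] t(2) by simp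
      moreover have "integral {0..?t (Suc k)} h = integral {0..?t k} h + integral {?t k..?t (Suc k)} h"
        using Henstock_Kurzweil_Integration.integral_combine[OF t(1,2) int[OF t(3)]] by simp
      ultimately have "norm (((\<Sum>j<k. ?D *\<^sub>R h (?t j)) - integral {0..?t k} h) +
          (?D *\<^sub>R h (?t k) - integral {?t k..?t (Suc k)} h)) \<le> d * ?t k + d * (?t (Suc k) - ?t k)"
        using Suc by (intro order_trans[OF norm_triangle_ineq] add_mono) auto
      then show ?case
        using \<open>integral {0..?t (Suc k)} h = _\<close> by (simp add: grid_Suc algebra_simps)
    qed simp
    moreover have "d * ?t k \<le> d * T" if "k \<le> N r" for k
      using grid_in[OF T that] d by (intro mult_left_mono) auto
    ultimately show ?case
      using dT eq grid_in[OF T, of _ "N r"] by (smt (verit) atLeastAtMost_iff)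
  qed
qed

lemma simple_integrand_measurable: "(\<lambda>s. simple_integrand k \<tau> \<xi> s \<omega>) \<in> borel_measurable borel"
  unfolding simple_integrand_def by measurable

text \<open>Needed for adding L2 distances: the integral of a function that is not integrable is 0
  by convention, so estimates by such integrals would be void.\<close>

lemma simple_integrand_diff_integrable:
  fixes h :: "real \<Rightarrow> 'b::euclidean_space"
  assumes h: "continuous_on {0..T} h"
  shows "set_integrable lborel {0..T} (\<lambda>s. (norm (simple_integrand k \<tau> \<xi> s \<omega> - h s))\<^sup>2)"
proof -
  obtain B where B: "\<And>s. s \<in> {0..T} \<Longrightarrow> norm (h s) \<le> B"
    using compact_imp_bounded[OF compact_continuous_image[OF h compact_Icc]]
    unfolding bounded_iff by (metis imageI)
  let ?C = "\<Sum>i<k. norm (\<xi> i \<omega>)"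
  have C: "norm (simple_integrand k \<tau> \<xi> s \<omega>) \<le> ?C" for s
    unfolding simple_integrand_def by (intro sum_norm_le) (auto simp: indicator_def)
  have [measurable]: "(\<lambda>s. indicator {0..T} s *\<^sub>R h s) \<in> borel_measurable borel"
    by (intro borel_measurable_continuous_on_indicator h) auto
  note [measurable] = simple_integrand_measurable
  have "(\<lambda>s. (norm (indicator {0..T} s *\<^sub>R simple_integrand k \<tau> \<xi> s \<omega> - indicator {0..T} s *\<^sub>R h s))\<^sup>2) \<in> borel_measurable lborel"
    by measurable
  also have "(\<lambda>s. (norm (indicator {0..T} s *\<^sub>R simple_integrand k \<tau> \<xi> s \<omega> - indicator {0..T} s *\<^sub>R h s))\<^sup>2) =
      (\<lambda>s. indicator {0..T} s *\<^sub>R (norm (simple_integrand k \<tau> \<xi> s \<omega> - h s))\<^sup>2)"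
    by (auto simp: indicator_def fun_eq_iff)
  finally show ?thesis
    unfolding set_integrable_def
  proof (rule integrableI_bounded_set[where A = "{0..T}" and B = "(?C + B)\<^sup>2", rotated])
    show "AE s in lborel. s \<in> {0..T} \<longrightarrow> norm (indicator {0..T} s *\<^sub>R (norm (simple_integrand k \<tau> \<xi> s \<omega> - h s))\<^sup>2) \<le> (?C + B)\<^sup>2"
      using C B by (auto intro!: AE_I2 power_mono order_trans[OF norm_triangle_ineq4] add_mono)
  qed (auto simp: emeasure_lborel_Icc_eq)
qed

section \<open>Convergence in probability\<close>

context prob_space
begin

text \<open>Dominated convergence for the indicators of the events. It turns pathwise statements,
  with constants that depend on the path, into limits of probabilities.\<close>

lemma prob_tendsto_0_if_AE:
  assumes E: "\<And>n. E n \<in> events" and AE: "AE \<omega> in M. \<forall>\<^sub>F n in sequentially. \<omega> \<notin> E n"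
  shows "(\<lambda>n. prob (E n)) \<longlonglongrightarrow> 0"
proof -
  have "(\<lambda>n. \<integral>\<omega>. indicator (E n) \<omega> \<partial>M) \<longlonglongrightarrow> (\<integral>\<omega>. (0::real) \<partial>M)"
  proof (rule integral_dominated_convergence[where w = "\<lambda>_. 1"])
    show "AE \<omega> in M. (\<lambda>n. indicator (E n) \<omega> :: real) \<longlonglongrightarrow> 0"
      using AE
    proof eventually_elim
      case (elim \<omega>)
      then have "\<forall>\<^sub>F n in sequentially. (indicator (E n) \<omega> :: real) = 0"
        by eventually_elim simp
      then show ?case by (rule tendsto_eventually)
    qed
  qed (use E in \<open>auto simp: indicator_def\<close>)
  then show ?thesis using E by simp
qed

lemma AE_tendsto_imp_conv_in_prob:
  fixes Y :: "nat \<Rightarrow> 'a \<Rightarrow> 'b::euclidean_space"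
  assumes [measurable]: "\<And>n. Y n \<in> borel_measurable M" "L \<in> borel_measurable M"
    and AE: "AE \<omega> in M. (\<lambda>n. Y n \<omega>) \<longlonglongrightarrow> L \<omega>"
  shows "conv_in_prob M Y L"
  unfolding conv_in_prob_def
proof (intro conjI allI impI)
  fix \<epsilon> :: real assume \<epsilon>: "0 < \<epsilon>"
  show "(\<lambda>n. prob {\<omega> \<in> space M. \<epsilon> < dist (Y n \<omega>) (L \<omega>)}) \<longlonglongrightarrow> 0"
  proof (rule prob_tendsto_0_if_AE)
    show "AE \<omega> in M. \<forall>\<^sub>F n in sequentially. \<omega> \<notin> {\<omega> \<in> space M. \<epsilon> < dist (Y n \<omega>) (L \<omega>)}"
      using AE
    proof eventually_elim
      case (elim \<omega>)
      then have "\<forall>\<^sub>F n in sequentially. dist (Y n \<omega>) (L \<omega>) < \<epsilon>"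
        using \<epsilon> by (rule tendstoD)
      then show ?case by eventually_elim auto
    qed
  qed measurable
qed measurable

lemma conv_in_prob_subseq:
  "conv_in_prob M Y L \<Longrightarrow> filterlim r at_top sequentially \<Longrightarrow> conv_in_prob M (\<lambda>n. Y (r n)) L"
  unfolding conv_in_prob_def by (auto intro: filterlim_compose[of _ _ sequentially])

lemma prob_le_add:
  assumes "A \<subseteq> B \<union> C" "B \<in> events" "C \<in> events"
  shows "prob A \<le> prob B + prob C"
  by (rule order_trans[OF finite_measure_mono[OF assms(1) sets.Un[OF assms(2,3)]] measure_Un_le[OF assms(2,3)]])

lemma tendsto_0_if_eventually_small:
  fixes p :: "nat \<Rightarrow> real"
  assumes "\<And>n. 0 \<le> p n" and "\<And>\<eta>. 0 < \<eta> \<Longrightarrow> \<forall>\<^sub>F n in sequentially. p n < \<eta>"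
  shows "p \<longlonglongrightarrow> 0"
  using assms by (intro tendstoI) (auto simp: dist_real_def)

text \<open>Borel-Cantelli with \<open>(1/2)^i\<close> both as the threshold and as the bound on the
  probability. The events involve all nodes of a grid at once, which gives uniform
  vanishing.\<close>

lemma AE_subsequence:
  fixes U :: "nat \<Rightarrow> nat \<Rightarrow> 'a \<Rightarrow> 'b::euclidean_space"
  assumes U: "\<And>n k. k \<le> n \<Longrightarrow> U n k \<in> borel_measurable M"
    and lim: "\<And>e. 0 < e \<Longrightarrow> (\<lambda>n. prob {\<omega>\<in>space M. \<exists>k\<le>n. e < norm (U n k \<omega>)}) \<longlonglongrightarrow> 0"
  obtains r where "strict_mono r" "\<And>i. 0 < r i" "AE \<omega> in M. unif_vanishing r (\<lambda>i k. U (r i) k \<omega>)"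
proof -
  let ?E = "\<lambda>n e. {\<omega>\<in>space M. \<exists>k\<le>n. e < norm (U n k \<omega>)}"
  have "\<exists>n>m. prob (?E n ((1/2)^i)) < (1/2)^i" for m i :: nat
  proof -
    have "\<forall>\<^sub>F n in sequentially. prob (?E n ((1/2)^i)) < (1/2)^i"
      by (rule order_tendstoD(2)[OF lim]) auto
    then obtain n0 where "\<And>n. n0 \<le> n \<Longrightarrow> prob (?E n ((1/2)^i)) < (1/2)^i"
      unfolding eventually_sequentially by auto
    from this[of "max n0 (Suc m)"] show ?thesis by (intro exI[of _ "max n0 (Suc m)"]) auto
  qed
  then have "\<forall>m i. \<exists>n. m < n \<and> prob (?E n ((1/2)^i)) < (1/2)^i" by auto
  then obtain f where "\<forall>m i. m < f m i \<and> prob (?E (f m i) ((1/2)^i)) < (1/2)^i"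
    unfolding choice_iff by blast
  then have f: "\<And>m i. m < f m i" "\<And>m i. prob (?E (f m i) ((1/2)^i)) < (1/2)^i" by auto
  \<comment> \<open>\<open>f m i\<close> is a grid size beyond \<open>m\<close> that is good at
    level \<open>i\<close>; feeding each choice into the next makes the sequence strictly
    increasing.\<close>
  define r where "r = rec_nat (f 0 0) (\<lambda>i m. f m (Suc i))"
  have r: "r 0 = f 0 0" "\<And>i. r (Suc i) = f (r i) (Suc i)" by (simp_all add: r_def)
  have mono: "strict_mono r"
    by (rule strict_monoI_Suc) (simp add: r f)
  have pos: "0 < r i" for i
    using f(1)[of 0 0] strict_mono_less_eq[OF mono, of 0 i] by (simp add: r)
  have small: "prob (?E (r i) ((1/2)^i)) < (1/2)^i" for i
    by (cases i) (simp_all only: r f)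
  have "AE \<omega> in M. \<forall>\<^sub>F i in sequentially. \<omega> \<in> space M - ?E (r i) ((1/2)^i)"
  proof (rule borel_cantelli_AE1)
    show "summable (\<lambda>i. prob (?E (r i) ((1/2)^i)))"
      by (rule summable_comparison_test'[OF summable_geometric[of "1/2::real"], of 0])
         (use small in \<open>auto intro: less_imp_le\<close>)
    show "?E (r i) ((1/2)^i) \<in> events" for i by (intro exceeds_event U)
    show "emeasure M (?E (r i) ((1/2)^i)) < \<infinity>" for i by (simp add: emeasure_eq_measure)
  qed
  then have "AE \<omega> in M. unif_vanishing r (\<lambda>i k. U (r i) k \<omega>)"
  proof (rule AE_mp[OF _ AE_I2], intro impI)
    fix \<omega> assume elim: "\<forall>\<^sub>F i in sequentially. \<omega> \<in> space M - ?E (r i) ((1/2)^i)"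
    show "unif_vanishing r (\<lambda>i k. U (r i) k \<omega>)"
      unfolding unif_vanishing_def
    proof (intro allI impI)
      fix e :: real assume "0 < e"
      have "(\<lambda>i. (1/2::real)^i) \<longlonglongrightarrow> 0" by (rule LIMSEQ_power_zero) simp
      then have "\<forall>\<^sub>F i in sequentially. (1/2)^i < e"
        using \<open>0 < e\<close> by (rule order_tendstoD)
      then show "\<forall>\<^sub>F i in sequentially. \<forall>k\<le>r i. norm (U (r i) k \<omega>) < e"
        using elim
      proof eventually_elim
        case (elim i)
        then show ?case by (simp add: not_less) (meson order.strict_trans1)
      qed
    qed
  qed
  then show ?thesis using that mono pos by blast
qed

end

section \<open>Progressive processes\<close>

lemma progressive_compose:
  assumes "progressive F X" and "continuous_on UNIV \<phi>"
  shows "progressive F (\<lambda>t \<omega>. \<phi> (X t \<omega>))"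
  unfolding progressive_def
proof (intro allI impI)
  fix t :: real assume "0 \<le> t"
  then have "(\<lambda>p. X (fst p) (snd p)) \<in> borel_measurable (restrict_space borel {0..t} \<Otimes>\<^sub>M F t)"
    using assms(1) by (simp add: progressive_def)
  then show "(\<lambda>p. \<phi> (X (fst p) (snd p))) \<in> borel_measurable (restrict_space borel {0..t} \<Otimes>\<^sub>M F t)"
    by (rule measurable_compose[OF _ borel_measurable_continuous_onI[OF assms(2)]])
qed

lemma progressive_adapted:
  assumes "progressive F X" and "0 \<le> t"
  shows "X t \<in> borel_measurable (F t)"
proof -
  have X: "(\<lambda>p. X (fst p) (snd p)) \<in> borel_measurable (restrict_space borel {0..t} \<Otimes>\<^sub>M F t)"
    using assms by (simp add: progressive_def)
  have "t \<in> space (restrict_space borel {0..t})"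
    using assms(2) by (simp add: space_restrict_space)
  then have "Pair t \<in> F t \<rightarrow>\<^sub>M restrict_space borel {0..t} \<Otimes>\<^sub>M F t"
    by (rule measurable_Pair1')
  from measurable_compose[OF this X] show ?thesis by simp
qed

text \<open>Fubini's theorem; this is where joint measurability of a progressive process in time and
  chance is used.\<close>

lemma path_integral_measurable:
  fixes g :: "real \<Rightarrow> 'w \<Rightarrow> 'b::euclidean_space"
  assumes g: "(\<lambda>p. g (fst p) (snd p)) \<in> borel_measurable (restrict_space borel {0..t} \<Otimes>\<^sub>M N)"
  shows "(\<lambda>\<omega>. LINT s:{0..t}|lborel. g s \<omega>) \<in> borel_measurable N"
proof -
  interpret R: sigma_finite_measure "restrict_space lborel {0..t}"
    by (rule sigma_finite_measure_restrict_space) (auto intro: lborel.sigma_finite_measure_axioms)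
  have "(\<lambda>p. g (fst p) (snd p)) \<in> borel_measurable (restrict_space lborel {0..t} \<Otimes>\<^sub>M N)"
    using g by (simp cong: measurable_cong_sets sets_pair_measure_cong sets_restrict_space_cong)
  then have "(\<lambda>(\<omega>, s). g s \<omega>) \<in> borel_measurable (N \<Otimes>\<^sub>M restrict_space lborel {0..t})"
    using measurable_compose[OF measurable_pair_swap', of "\<lambda>p. g (fst p) (snd p)"] by (simp add: case_prod_beta')
  then have "(\<lambda>\<omega>. \<integral>s. g s \<omega> \<partial>restrict_space lborel {0..t}) \<in> borel_measurable N"
    by (rule R.borel_measurable_lebesgue_integral)
  then show ?thesis
    by (simp add: integral_restrict_space set_lebesgue_integral_def)
qed

context brownian_setting
begin

lemma progressive_measurable_M:
  assumes "progressive F X" and "0 \<le> t"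
  shows "(\<lambda>p. X (fst p) (snd p)) \<in> borel_measurable (restrict_space borel {0..t} \<Otimes>\<^sub>M M)"
proof -
  have "(\<lambda>p. (fst p, snd p)) \<in> restrict_space borel {0..t} \<Otimes>\<^sub>M M \<rightarrow>\<^sub>M restrict_space borel {0..t} \<Otimes>\<^sub>M F t"
    by (intro measurable_Pair measurable_fst measurable_compose[OF measurable_snd]
        measurable_from_subalg[OF subalgebra_F[OF assms(2)]] measurable_ident_sets refl)
  moreover have "(\<lambda>p. X (fst p) (snd p)) \<in> borel_measurable (restrict_space borel {0..t} \<Otimes>\<^sub>M F t)"
    using assms by (simp add: progressive_def)
  ultimately show ?thesis
    using measurable_compose[of "\<lambda>p. (fst p, snd p)" _ _ "\<lambda>p. X (fst p) (snd p)" borel] by simp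
qed

lemma simple_L2_distance_measurable:
  fixes H :: "real \<Rightarrow> 'w \<Rightarrow> 'b::euclidean_space"
  assumes H: "progressive F H" and T: "0 \<le> T" and \<xi>: "\<And>i. i < k \<Longrightarrow> \<xi> i \<in> borel_measurable M"
  shows "(\<lambda>\<omega>. LINT s:{0..T}|lborel. (norm (simple_integrand k \<tau> \<xi> s \<omega> - H s \<omega>))\<^sup>2) \<in> borel_measurable M"
proof (rule path_integral_measurable)
  note [measurable] = progressive_measurable_M[OF H T]
  have "(\<lambda>p. simple_integrand k \<tau> \<xi> (fst p) (snd p)) \<in> borel_measurable (restrict_space borel {0..T} \<Otimes>\<^sub>M M)"
    unfolding simple_integrand_def
  proof (rule borel_measurable_sum)
    fix i assume "i \<in> {..<k}"
    then have [measurable]: "\<xi> i \<in> borel_measurable M" using \<xi> by simp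
    have [measurable]: "(\<lambda>p. indicator {\<tau> i<..\<tau> (Suc i)} (fst p) :: real) \<in> borel_measurable (restrict_space borel {0..T} \<Otimes>\<^sub>M M)"
      by (intro measurable_compose[OF measurable_fst] measurable_restrict_space1) measurable
    show "(\<lambda>p. indicator {\<tau> i<..\<tau> (Suc i)} (fst p) *\<^sub>R \<xi> i (snd p)) \<in> borel_measurable (restrict_space borel {0..T} \<Otimes>\<^sub>M M)"
      by measurable
  qed
  then show "(\<lambda>p. (norm (simple_integrand k \<tau> \<xi> (fst p) (snd p) - H (fst p) (snd p)))\<^sup>2)
      \<in> borel_measurable (restrict_space borel {0..T} \<Otimes>\<^sub>M M)"
    by measurable
qed

lemma adapted_data_measurable:
  assumes "adapted_data F T k \<tau> \<xi>" and "i < k"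
  shows "\<xi> i \<in> borel_measurable M"
  using assms adapted_data_mono[OF assms(1), of 0 i] measurable_F_M[of "\<xi> i" "\<tau> i"] by (simp add: adapted_data_def)

lemma simple_ito_integral_measurable:
  assumes a: "adapted_data F T k \<tau> \<xi>"
  shows "simple_ito_integral W k \<tau> \<xi> \<in> borel_measurable M"
proof -
  have W: "W (\<tau> i) \<in> borel_measurable M" if "i \<le> k" for i
    using adapted_data_mono[OF a, of 0 i] a that by (intro measurable_F_M[OF W_adapted]) (auto simp: adapted_data_def)
  show ?thesis
    unfolding simple_ito_integral_def[abs_def]
    by (intro borel_measurable_sum borel_measurable_scaleR borel_measurable_diff W adapted_data_measurable[OF a]) auto
qed

lemma L2_close_triangle:
  fixes h :: "real \<Rightarrow> 'b::euclidean_space"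
  assumes h: "continuous_on {0..T} h"
  shows "(LINT s:{0..T}|lborel. (norm (simple_integrand k \<tau> \<xi> s \<omega> - simple_integrand k' \<tau>' \<xi>' s \<omega>))\<^sup>2) \<le>
    2 * (LINT s:{0..T}|lborel. (norm (simple_integrand k \<tau> \<xi> s \<omega> - h s))\<^sup>2) +
    2 * (LINT s:{0..T}|lborel. (norm (simple_integrand k' \<tau>' \<xi>' s \<omega> - h s))\<^sup>2)"
proof -
  note i1 = simple_integrand_diff_integrable[OF h, of k \<tau> \<xi> \<omega>]
  note i2 = simple_integrand_diff_integrable[OF h, of k' \<tau>' \<xi>' \<omega>]
  have *: "(norm (a - b))\<^sup>2 \<le> 2 * (norm (a - c))\<^sup>2 + 2 * (norm (b - c))\<^sup>2" for a b c :: 'b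
  proof -
    have "norm (a - b) \<le> norm (a - c) + norm (b - c)"
      using norm_triangle_ineq4[of "a - c" "b - c"] by simp
    then have "(norm (a - b))\<^sup>2 \<le> (norm (a - c) + norm (b - c))\<^sup>2"
      by (rule power_mono) simp
    also have "\<dots> \<le> 2 * (norm (a - c))\<^sup>2 + 2 * (norm (b - c))\<^sup>2"
      using zero_le_power2[of "norm (a - c) - norm (b - c)"] by (simp add: power2_sum power2_diff)
    finally show ?thesis .
  qed
  have "(LINT s:{0..T}|lborel. (norm (simple_integrand k \<tau> \<xi> s \<omega> - simple_integrand k' \<tau>' \<xi>' s \<omega>))\<^sup>2) \<le>
      (LINT s:{0..T}|lborel. 2 * (norm (simple_integrand k \<tau> \<xi> s \<omega> - h s))\<^sup>2 + 2 * (norm (simple_integrand k' \<tau>' \<xi>' s \<omega> - h s))\<^sup>2)"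
    unfolding set_lebesgue_integral_def
  proof (rule integral_mono')
    show "integrable lborel (\<lambda>s. indicator {0..T} s *\<^sub>R (2 * (norm (simple_integrand k \<tau> \<xi> s \<omega> - h s))\<^sup>2 + 2 * (norm (simple_integrand k' \<tau>' \<xi>' s \<omega> - h s))\<^sup>2))"
      using set_integral_add(1)[OF set_integrable_mult_right[of 2, OF i1] set_integrable_mult_right[of 2, OF i2]]
      by (simp add: set_integrable_def)
  qed (use * in \<open>auto simp: indicator_def\<close>)
  also have "\<dots> = 2 * (LINT s:{0..T}|lborel. (norm (simple_integrand k \<tau> \<xi> s \<omega> - h s))\<^sup>2) +
    2 * (LINT s:{0..T}|lborel. (norm (simple_integrand k' \<tau>' \<xi>' s \<omega> - h s))\<^sup>2)"
    using i1 i2 by (subst set_integral_add) auto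
  finally show ?thesis .
qed

end

section \<open>Riemann sums converge to the Ito integral\<close>

text \<open>Convergence of Riemann sums at a node is available for grids of the interval ending
  there; these are initial pieces of grids of the full interval.\<close>

lemma grid_grid: "0 < k \<Longrightarrow> grid (grid T n k) (k * m) j = grid T (n * m) j"
  by (simp add: grid_def field_simps)

text \<open>Every \<open>m\<close>-th node of the refined grid is a node of the coarse one.\<close>

lemma grid_multiple: "0 < m \<Longrightarrow> grid T (n * m) (k * m) = grid T n k"
  by (simp add: grid_def)

lemma grid_div:
  assumes "0 \<le> T" "0 < m" "0 < n"
  shows "grid T n (j div m) \<le> grid T (n * m) j" and "grid T (n * m) j - grid T n (j div m) \<le> T / real n"
proof -
  have "real j = real m * real (j div m) + real (j mod m)"
    by (metis mult_div_mod_eq of_nat_add of_nat_mult)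
  then have eq: "grid T (n * m) j - grid T n (j div m) = T / real n * (real (j mod m) / real m)"
    using assms by (simp add: grid_def field_simps)
  have "0 \<le> real (j mod m) / real m" "real (j mod m) / real m \<le> 1"
    using assms by (auto simp: divide_simps)
  then have "0 \<le> T / real n * (real (j mod m) / real m)" "T / real n * (real (j mod m) / real m) \<le> T / real n * 1"
    using assms by (intro mult_nonneg_nonneg mult_left_mono; simp)+
  then show "grid T n (j div m) \<le> grid T (n * m) j" "grid T (n * m) j - grid T n (j div m) \<le> T / real n"
    using eq by linarith+
qed

text \<open>A coarse Riemann sum is rewritten over the refined grid with the integrand frozen at the
  coarse node \<open>i div m\<close>, so that it can be subtracted from the fine sum term by
  term.\<close>

lemma riemann_sum_refine:
  fixes H :: "nat \<Rightarrow> 'b::real_vector" and w :: "real \<Rightarrow> real"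
  assumes m: "0 < m"
  shows "(\<Sum>j<k. (w (grid T n (Suc j)) - w (grid T n j)) *\<^sub>R H j) =
    (\<Sum>i<k * m. (w (grid T (n * m) (Suc i)) - w (grid T (n * m) i)) *\<^sub>R H (i div m))"
proof (induction k)
  case (Suc k)
  let ?f = "\<lambda>i. (w (grid T (n * m) (Suc i)) - w (grid T (n * m) i)) *\<^sub>R H (i div m)"
  have "(\<Sum>i=k*m..<k*m+m. ?f i) = (\<Sum>i=k*m..<k*m+m. (w (grid T (n * m) (Suc i)) - w (grid T (n * m) i)) *\<^sub>R H k)"
  proof (rule sum.cong)
    fix i assume i: "i \<in> {k*m..<k*m+m}"
    then have "i div m = k"
      using m by (intro div_nat_eqI) (auto simp: algebra_simps)
    then show "?f i = (w (grid T (n * m) (Suc i)) - w (grid T (n * m) i)) *\<^sub>R H k" by simp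
  qed simp
  also have "\<dots> = (w (grid T (n * m) (k*m+m)) - w (grid T (n * m) (k*m))) *\<^sub>R H k"
    using sum_Suc_diff'[of "k*m" "k*m+m" "\<lambda>i. w (grid T (n * m) i)"] by (simp add: scaleR_sum_left[symmetric])
  also have "\<dots> = (w (grid T n (Suc k)) - w (grid T n k)) *\<^sub>R H k"
    using grid_multiple[OF m, of T n k] grid_multiple[OF m, of T n "Suc k"] by (simp add: add.commute)
  finally have "(\<Sum>i=k*m..<k*m+m. ?f i) = (w (grid T n (Suc k)) - w (grid T n k)) *\<^sub>R H k" .
  moreover have "{..<Suc k * m} = {..<k*m} \<union> {k*m..<k*m+m}" by auto
  ultimately show ?case
    using Suc by (simp add: sum.union_disjoint ivl_disj_int)
qed simp

context brownian_setting
begin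

lemma riemann_data:
  assumes "progressive F H" "0 \<le> T" "0 < n"
  shows "adapted_data F T n (grid T n) (\<lambda>i. H (grid T n i))"
  unfolding adapted_data_def
proof (intro conjI allI impI)
  fix i assume "i < n"
  then have "0 \<le> grid T n i" using grid_in[OF assms(2), of i n] by simp
  then show "H (grid T n i) \<in> borel_measurable (F (grid T n i))"
    by (rule progressive_adapted[OF assms(1)])
qed (use assms grid_le_Suc in auto)

text \<open>The definition supplies some unknown approximating integrands. The Riemann integrands
  are close to \<open>H\<close> in L2 along continuous paths, hence close to the given ones in
  probability, and \<open>simple_integral_diff_inequality\<close> carries this over to the
  integrals.\<close>

lemma riemann_sums_converge:
  fixes H :: "real \<Rightarrow> 'w \<Rightarrow> 'b::euclidean_space"
  assumes I: "has_ito_integral M F W H T I" and T: "0 \<le> T"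
    and cont: "AE \<omega> in M. continuous_on {0..} (\<lambda>t. H t \<omega>)"
  shows "conv_in_prob M (\<lambda>n. simple_ito_integral W (Suc n) (grid T (Suc n)) (\<lambda>i. H (grid T (Suc n) i))) I"
proof -
  obtain k \<tau> \<xi> where simple: "\<And>n. simple_data M F T (k n) (\<tau> n) (\<xi> n)"
    and L2: "conv_in_prob M (\<lambda>n \<omega>. LINT s:{0..T}|lborel. (norm (simple_integrand (k n) (\<tau> n) (\<xi> n) s \<omega> - H s \<omega>))\<^sup>2) (\<lambda>\<omega>. 0)"
    and J: "conv_in_prob M (\<lambda>n. simple_ito_integral W (k n) (\<tau> n) (\<xi> n)) I"
    using I unfolding has_ito_integral_def by blast
  have prog: "progressive F H" using I by (simp add: has_ito_integral_def)
  note sd = simple_data_imp_adapted[OF simple]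
  define g where "g n = grid T (Suc n)" for n
  define \<zeta> where "\<zeta> n i = H (g n i)" for n i
  define S where "S n = simple_ito_integral W (Suc n) (g n) (\<zeta> n)" for n
  define J where "J n = simple_ito_integral W (k n) (\<tau> n) (\<xi> n)" for n
  have rd: "adapted_data F T (Suc n) (g n) (\<zeta> n)" for n
    using riemann_data[OF prog T, of "Suc n"] by (simp add: g_def \<zeta>_def[abs_def])
  define A where "A n \<omega> = (LINT s:{0..T}|lborel. (norm (simple_integrand (Suc n) (g n) (\<zeta> n) s \<omega> - H s \<omega>))\<^sup>2)" for n \<omega>
  define B where "B n \<omega> = (LINT s:{0..T}|lborel. (norm (simple_integrand (k n) (\<tau> n) (\<xi> n) s \<omega> - H s \<omega>))\<^sup>2)" for n \<omega>
  define D where "D n \<omega> = (LINT s:{0..T}|lborel. (norm (simple_integrand (Suc n) (g n) (\<zeta> n) s \<omega> - simple_integrand (k n) (\<tau> n) (\<xi> n) s \<omega>))\<^sup>2)" for n \<omega>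
  have SM[measurable]: "S n \<in> borel_measurable M" for n
    unfolding S_def by (rule simple_ito_integral_measurable[OF rd])
  have JM[measurable]: "J n \<in> borel_measurable M" for n
    unfolding J_def by (rule simple_ito_integral_measurable[OF sd])
  have IM[measurable]: "I \<in> borel_measurable M"
    using J by (simp add: conv_in_prob_def)
  have AM[measurable]: "A n \<in> borel_measurable M" for n
    unfolding A_def[abs_def] by (intro simple_L2_distance_measurable prog T adapted_data_measurable[OF rd])
  have BM[measurable]: "B n \<in> borel_measurable M" for n
    unfolding B_def[abs_def] by (intro simple_L2_distance_measurable prog T adapted_data_measurable[OF sd])
  have cont_T: "continuous_on {0..T} (\<lambda>t. H t \<omega>)" if "continuous_on {0..} (\<lambda>t. H t \<omega>)" for \<omega>
    using that by (rule continuous_on_subset) auto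
  have "conv_in_prob M A (\<lambda>_. 0)"
  proof (rule AE_tendsto_imp_conv_in_prob)
    show "AE \<omega> in M. (\<lambda>n. A n \<omega>) \<longlonglongrightarrow> 0"
      using cont
    proof (rule AE_mp[OF _ AE_I2], intro impI)
      fix \<omega> assume "continuous_on {0..} (\<lambda>t. H t \<omega>)"
      from simple_integrand_L2_limit[OF cont_T[OF this] T filterlim_Suc, of "\<lambda>n. \<zeta> n" \<omega>]
      show "(\<lambda>n. A n \<omega>) \<longlonglongrightarrow> 0"
        by (simp add: A_def \<zeta>_def g_def)
    qed
  qed measurable
  then have A0: "(\<lambda>n. prob {\<omega>\<in>space M. d < A n \<omega>}) \<longlonglongrightarrow> 0" if "0 < d" for d
  proof (rule_tac tendsto_sandwich[OF _ _ tendsto_const])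
    assume "conv_in_prob M A (\<lambda>_. 0)"
    then show "(\<lambda>n. prob {\<omega>\<in>space M. d < dist (A n \<omega>) 0}) \<longlonglongrightarrow> 0"
      using that by (simp add: conv_in_prob_def)
    show "\<forall>\<^sub>F n in sequentially. prob {\<omega>\<in>space M. d < A n \<omega>} \<le> prob {\<omega>\<in>space M. d < dist (A n \<omega>) 0}"
      by (intro always_eventually allI finite_measure_mono) (auto simp: dist_real_def)
  qed auto
  have B0: "(\<lambda>n. prob {\<omega>\<in>space M. d < B n \<omega>}) \<longlonglongrightarrow> 0" if "0 < d" for d
  proof (rule tendsto_sandwich[OF _ _ tendsto_const])
    show "(\<lambda>n. prob {\<omega>\<in>space M. d < dist (B n \<omega>) 0}) \<longlonglongrightarrow> 0"
      using that L2 by (simp add: conv_in_prob_def B_def)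
    show "\<forall>\<^sub>F n in sequentially. prob {\<omega>\<in>space M. d < B n \<omega>} \<le> prob {\<omega>\<in>space M. d < dist (B n \<omega>) 0}"
      by (intro always_eventually allI finite_measure_mono) (auto simp: dist_real_def)
  qed auto
  \<comment> \<open>The bound \<open>D n \<omega> \<le> 2 * A n \<omega> + 2 * B n \<omega>\<close>
    requires a continuous path and so holds almost surely; if \<open>D\<close> exceeds
    \<open>d\<close>, then \<open>A\<close> or \<open>B\<close> exceeds \<open>d/4\<close>.\<close>
  have D_le: "prob {\<omega>\<in>space M. d < D n \<omega>} \<le> prob {\<omega>\<in>space M. d/4 < A n \<omega>} + prob {\<omega>\<in>space M. d/4 < B n \<omega>}" for d n
  proof -
    have "AE \<omega> in M. D n \<omega> \<le> 2 * A n \<omega> + 2 * B n \<omega>"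
      using cont
    proof (rule AE_mp[OF _ AE_I2], intro impI)
      fix \<omega> assume "continuous_on {0..} (\<lambda>t. H t \<omega>)"
      from L2_close_triangle[OF cont_T[OF this]]
      show "D n \<omega> \<le> 2 * A n \<omega> + 2 * B n \<omega>"
        unfolding A_def B_def D_def .
    qed
    then have "prob {\<omega>\<in>space M. d < D n \<omega>} \<le> prob ({\<omega>\<in>space M. d/4 < A n \<omega>} \<union> {\<omega>\<in>space M. d/4 < B n \<omega>})"
      by (intro finite_measure_mono_AE) (auto elim!: eventually_mono)
    also have "\<dots> \<le> prob {\<omega>\<in>space M. d/4 < A n \<omega>} + prob {\<omega>\<in>space M. d/4 < B n \<omega>}"
      by (rule measure_Un_le) measurable
    finally show ?thesis .
  qed
  have SJ: "(\<lambda>n. prob {\<omega>\<in>space M. e < norm (S n \<omega> - J n \<omega>)}) \<longlonglongrightarrow> 0" if e: "0 < e" for e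
  proof (rule tendsto_0_if_eventually_small)
    fix \<eta> :: real assume \<eta>: "0 < \<eta>"
    \<comment> \<open>The deterministic term \<open>d / e\<^sup>2\<close> of the inequality becomes
      one third of the allowance; the probabilities for \<open>A\<close> and \<open>B\<close> share
      the rest.\<close>
    define d where "d = e\<^sup>2 * (\<eta> / 3)"
    have d: "0 < d" "d / e\<^sup>2 = \<eta> / 3" using e \<eta> by (auto simp: d_def)
    have "\<forall>\<^sub>F n in sequentially. prob {\<omega>\<in>space M. d/4 < A n \<omega>} < \<eta>/3"
      "\<forall>\<^sub>F n in sequentially. prob {\<omega>\<in>space M. d/4 < B n \<omega>} < \<eta>/3"
      using order_tendstoD(2)[OF A0[of "d/4"], of "\<eta>/3"] order_tendstoD(2)[OF B0[of "d/4"], of "\<eta>/3"] d \<eta> by auto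
    then show "\<forall>\<^sub>F n in sequentially. prob {\<omega>\<in>space M. e < norm (S n \<omega> - J n \<omega>)} < \<eta>"
    proof eventually_elim
      case (elim n)
      have "prob {\<omega>\<in>space M. e < norm (S n \<omega> - J n \<omega>)} \<le> prob {\<omega>\<in>space M. d < D n \<omega>} + d / e\<^sup>2"
        unfolding S_def J_def D_def by (rule simple_integral_diff_inequality[OF rd sd e d(1)])
      then show ?case using D_le[of d n] elim d(2) by linarith
    qed
  qed simp
  have "conv_in_prob M S I"
    unfolding conv_in_prob_def
  proof (intro conjI allI impI SM IM)
    fix e :: real assume e: "0 < e"
    show "(\<lambda>n. prob {\<omega>\<in>space M. e < dist (S n \<omega>) (I \<omega>)}) \<longlonglongrightarrow> 0"
    proof (rule tendsto_sandwich[OF _ _ tendsto_const])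
      have "(\<lambda>n. prob {\<omega>\<in>space M. e/2 < dist (J n \<omega>) (I \<omega>)}) \<longlonglongrightarrow> 0"
        using \<open>conv_in_prob M (\<lambda>n. simple_ito_integral W (k n) (\<tau> n) (\<xi> n)) I\<close> half_gt_zero[OF e]
        unfolding conv_in_prob_def J_def by blast
      from tendsto_add[OF SJ this, of "e/2"] e
      show "(\<lambda>n. prob {\<omega>\<in>space M. e/2 < norm (S n \<omega> - J n \<omega>)} + prob {\<omega>\<in>space M. e/2 < dist (J n \<omega>) (I \<omega>)}) \<longlonglongrightarrow> 0"
        by simp
      show "\<forall>\<^sub>F n in sequentially. prob {\<omega>\<in>space M. e < dist (S n \<omega>) (I \<omega>)} \<le>
         prob {\<omega>\<in>space M. e/2 < norm (S n \<omega> - J n \<omega>)} + prob {\<omega>\<in>space M. e/2 < dist (J n \<omega>) (I \<omega>)}"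
      proof (intro always_eventually allI prob_le_add)
        fix n
        show "{\<omega>\<in>space M. e < dist (S n \<omega>) (I \<omega>)} \<subseteq> {\<omega>\<in>space M. e/2 < norm (S n \<omega> - J n \<omega>)} \<union> {\<omega>\<in>space M. e/2 < dist (J n \<omega>) (I \<omega>)}"
        proof
          fix \<omega> assume "\<omega> \<in> {\<omega>\<in>space M. e < dist (S n \<omega>) (I \<omega>)}"
          then show "\<omega> \<in> {\<omega>\<in>space M. e/2 < norm (S n \<omega> - J n \<omega>)} \<union> {\<omega>\<in>space M. e/2 < dist (J n \<omega>) (I \<omega>)}"
            using dist_triangle[of "S n \<omega>" "I \<omega>" "J n \<omega>"] by (auto simp: dist_norm)
        qed
      qed measurable
    qed auto
  qed
  then show ?thesis by (simp add: S_def[abs_def] g_def \<zeta>_def[abs_def])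
qed

section \<open>Riemann sums, uniformly over the nodes\<close>

definition riemann_ito :: "(real \<Rightarrow> 'w \<Rightarrow> 'b::euclidean_space) \<Rightarrow> real \<Rightarrow> nat \<Rightarrow> nat \<Rightarrow> 'w \<Rightarrow> 'b" where
  "riemann_ito H T n k \<omega> = (\<Sum>j<k. (W (grid T n (Suc j)) \<omega> - W (grid T n j) \<omega>) *\<^sub>R H (grid T n j) \<omega>)"

lemma riemann_ito_measurable:
  assumes "progressive F H" "0 \<le> T" "k \<le> n"
  shows "riemann_ito H T n k \<in> borel_measurable M"
  unfolding riemann_ito_def[abs_def]
proof (rule borel_measurable_sum)
  fix j assume "j \<in> {..<k}"
  then have "0 \<le> grid T n j" "0 \<le> grid T n (Suc j)"
    using grid_in[OF assms(2), of j n] grid_in[OF assms(2), of "Suc j" n] assms(3) by auto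
  then show "(\<lambda>\<omega>. (W (grid T n (Suc j)) \<omega> - W (grid T n j) \<omega>) *\<^sub>R H (grid T n j) \<omega>) \<in> borel_measurable M"
    using assms(1)
    by (intro borel_measurable_scaleR borel_measurable_diff measurable_F_M[OF W_adapted] measurable_F_M[OF progressive_adapted[of F H]])
qed

lemma riemann_ito_pointwise_limit:
  fixes H :: "real \<Rightarrow> 'w \<Rightarrow> 'b::euclidean_space"
  assumes I: "\<And>t. 0 \<le> t \<Longrightarrow> has_ito_integral M F W H t (I t)" and T: "0 \<le> T"
    and cont: "AE \<omega> in M. continuous_on {0..} (\<lambda>t. H t \<omega>)" and k: "k \<le> n" and e: "0 < e"
  shows "(\<lambda>m. prob {\<omega>\<in>space M. e < norm (I (grid T n k) \<omega> - riemann_ito H T (n * Suc m) (k * Suc m) \<omega>)}) \<longlonglongrightarrow> 0"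
proof -
  have t: "0 \<le> grid T n k" using grid_in[OF T k] by simp
  note c = riemann_sums_converge[OF I[OF t] t cont]
  show ?thesis
  proof (cases "k = 0")
    \<comment> \<open>At node 0 all nodes of the grid of the degenerate interval coincide and the
      Riemann sums are 0, so their convergence says that \<open>I 0\<close> is almost surely
      0.\<close>
    case True
    then have "conv_in_prob M (\<lambda>n \<omega>. 0) (I 0)"
      using c by (simp add: simple_ito_integral_def[abs_def] grid_def)
    then show ?thesis
      using e True by (simp add: conv_in_prob_def riemann_ito_def)
  next
    case False
    \<comment> \<open>The Riemann sums were indexed with \<open>Suc n\<close> cells; subtracting 1
      selects those with \<open>k * Suc m\<close> cells.\<close>
    have "filterlim (\<lambda>m. k * Suc m - 1) at_top sequentially"
    proof (rule filterlim_at_top_mono[OF filterlim_ident], rule always_eventually, rule allI)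
      fix m have "1 * Suc m \<le> k * Suc m" using False by (intro mult_right_mono) auto
      then show "m \<le> k * Suc m - 1" by simp
    qed
    from conv_in_prob_subseq[OF c this]
    have lim: "(\<lambda>m. prob {\<omega>\<in>space M. e < dist (simple_ito_integral W (Suc (k * Suc m - 1)) (grid (grid T n k) (Suc (k * Suc m - 1)))
        (\<lambda>i. H (grid (grid T n k) (Suc (k * Suc m - 1)) i)) \<omega>) (I (grid T n k) \<omega>)}) \<longlonglongrightarrow> 0"
      using e unfolding conv_in_prob_def by blast
    have S: "Suc (k * Suc m - 1) = k * Suc m" for m using False by simp
    have g: "grid (grid T n k) (k * Suc m) = grid T (n * Suc m)" for m
      using grid_grid[of k T n "Suc m"] False by auto
    show ?thesis
      using lim unfolding S g simple_ito_integral_def riemann_ito_def dist_norm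
      by (simp only: norm_minus_commute)
  qed
qed

lemma ito_integral_measurable: "has_ito_integral M F W H T I \<Longrightarrow> I \<in> borel_measurable M"
  by (auto simp: has_ito_integral_def conv_in_prob_def)

lemma riemann_ito_error_measurable:
  fixes H :: "real \<Rightarrow> 'w \<Rightarrow> 'b::euclidean_space"
  assumes I: "\<And>t. 0 \<le> t \<Longrightarrow> has_ito_integral M F W H t (I t)" and T: "0 \<le> T" and "k \<le> n"
  shows "(\<lambda>\<omega>. I (grid T n k) \<omega> - riemann_ito H T n k \<omega>) \<in> borel_measurable M"
proof (rule borel_measurable_diff)
  show "I (grid T n k) \<in> borel_measurable M"
    using grid_in[OF T \<open>k \<le> n\<close>] by (intro ito_integral_measurable[OF I]) simp
  show "riemann_ito H T n k \<in> borel_measurable M"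
    using I[OF T] by (intro riemann_ito_measurable T \<open>k \<le> n\<close>) (simp add: has_ito_integral_def)
qed

text \<open>The integral at the nodes of the \<open>n\<close>-grid is compared with the Riemann sums of the grids
  refining it by a factor \<open>m\<close>; the maximal inequality controls the difference of the two Riemann
  sums by the modulus of continuity of the integrand, uniformly in \<open>m\<close>.\<close>

lemma riemann_sums_converge_uniformly:
  fixes H :: "real \<Rightarrow> 'w \<Rightarrow> 'b::euclidean_space"
  assumes I: "\<And>t. 0 \<le> t \<Longrightarrow> has_ito_integral M F W H t (I t)" and T: "0 < T"
    and cont: "AE \<omega> in M. continuous_on {0..} (\<lambda>t. H t \<omega>)" and e: "0 < e"
  shows "(\<lambda>n. prob {\<omega>\<in>space M. \<exists>k\<le>n. e < norm (I (grid T n k) \<omega> - riemann_ito H T n k \<omega>)}) \<longlonglongrightarrow> 0"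
proof (rule tendsto_0_if_eventually_small)
  fix \<eta> :: real assume \<eta>: "0 < \<eta>"
  have T0: "0 \<le> T" using T by simp
  have prog: "progressive F H" using I[OF T0] by (simp add: has_ito_integral_def)
  define \<delta> where "\<delta> = (e/2)\<^sup>2 * (\<eta>/3)"
  have \<delta>: "0 < \<delta>" "\<delta> / (e/2)\<^sup>2 = \<eta>/3" using e \<eta> by (auto simp: \<delta>_def)
  define \<Delta> where "\<Delta> n m j \<omega> = H (grid T (n * Suc m) j) \<omega> - H (grid T n (j div Suc m)) \<omega>" for n m j \<omega>
  \<comment> \<open>The event that the quadratic variation of fine minus coarse Riemann sum exceeds
    its budget.\<close>
  define V where "V n m = {\<omega>\<in>space M. \<delta> < (\<Sum>j<n * Suc m. (grid T (n * Suc m) (Suc j) - grid T (n * Suc m) j) * (norm (\<Delta> n m j \<omega>))\<^sup>2)}" for n m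
  have \<Delta>F: "\<Delta> n m j \<in> borel_measurable (F (grid T (n * Suc m) j))" if "0 < n" "j < n * Suc m" for n m j
  proof -
    have "grid T n (j div Suc m) \<le> grid T (n * Suc m) j"
      using T0 that by (intro grid_div) auto
    moreover have "0 \<le> grid T n (j div Suc m)" "0 \<le> grid T (n * Suc m) j"
      using T0 by (auto simp: grid_def)
    ultimately show ?thesis
      unfolding \<Delta>_def[abs_def]
      by (intro borel_measurable_diff progressive_adapted[OF prog] measurable_F_mono[OF progressive_adapted[OF prog]])
  qed
  have V: "V n m \<in> events" for n m
  proof (cases "n = 0")
    case False
    have "\<Delta> n m j \<in> borel_measurable M" if "j < n * Suc m" for j
      using \<Delta>F[of n j m] that False T0 by (intro measurable_F_M[OF \<Delta>F]) (auto simp: grid_def)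
    then have [measurable]: "(\<lambda>\<omega>. \<Sum>j<n * Suc m. (grid T (n * Suc m) (Suc j) - grid T (n * Suc m) j) * (norm (\<Delta> n m j \<omega>))\<^sup>2) \<in> borel_measurable M"
      by (intro borel_measurable_sum borel_measurable_times borel_measurable_power
          borel_measurable_const measurable_compose[OF _ borel_measurable_norm]) auto
    show ?thesis unfolding V_def by measurable
  qed (simp add: V_def)
  \<comment> \<open>One event covers all refinements: \<open>\<Delta>\<close> compares times at
    distance at most \<open>T / n\<close> whatever \<open>m\<close> is. This allows \<open>m\<close>
    to be chosen after \<open>n\<close>.\<close>
  have "(\<lambda>n. prob (\<Union>m. V n m)) \<longlonglongrightarrow> 0"
  proof (rule prob_tendsto_0_if_AE)
    show "AE \<omega> in M. \<forall>\<^sub>F n in sequentially. \<omega> \<notin> (\<Union>m. V n m)"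
      using cont
    proof (rule AE_mp[OF _ AE_I2], intro impI)
      fix \<omega> assume "continuous_on {0..} (\<lambda>t. H t \<omega>)"
      then have c: "continuous_on {0..T} (\<lambda>t. H t \<omega>)" by (rule continuous_on_subset) auto
      \<comment> \<open>If every \<open>\<Delta>\<close> is below \<open>d\<close>, the quadratic
        variation is at most \<open>T * d\<^sup>2\<close>, which is the budget
        \<open>\<delta>\<close>.\<close>
      define d where "d = sqrt (\<delta> / T)"
      have d: "0 < d" "T * d\<^sup>2 = \<delta>" using \<delta> T by (auto simp: d_def)
      from grid_modulus[OF c T0 filterlim_ident d(1)]
      show "\<forall>\<^sub>F n in sequentially. \<omega> \<notin> (\<Union>m. V n m)"
      proof eventually_elim
        case (elim n)
        have "(\<Sum>j<n * Suc m. (grid T (n * Suc m) (Suc j) - grid T (n * Suc m) j) * (norm (\<Delta> n m j \<omega>))\<^sup>2) \<le> \<delta>" for m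
        proof -
          have "(\<Sum>j<n * Suc m. (grid T (n * Suc m) (Suc j) - grid T (n * Suc m) j) * (norm (\<Delta> n m j \<omega>))\<^sup>2)
              \<le> (\<Sum>j<n * Suc m. T / real (n * Suc m) * d\<^sup>2)"
          proof (rule sum_mono)
            fix j assume j: "j \<in> {..<n * Suc m}"
            have n: "0 < n" using elim by simp
            note gd = grid_div[OF T0 zero_less_Suc[of m] n, of j]
            have "grid T (n * Suc m) j \<in> {0..T}" using j by (intro grid_in T0) auto
            moreover have "grid T n (j div Suc m) \<in> {0..T}"
              using gd(1) \<open>grid T (n * Suc m) j \<in> {0..T}\<close> T0 by (auto simp: grid_def)
            ultimately have "norm (\<Delta> n m j \<omega>) < d"
              unfolding \<Delta>_def using elim gd by auto
            then show "(grid T (n * Suc m) (Suc j) - grid T (n * Suc m) j) * (norm (\<Delta> n m j \<omega>))\<^sup>2 \<le> T / real (n * Suc m) * d\<^sup>2"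
              unfolding grid_diff using T0 by (intro mult_left_mono power_mono) auto
          qed
          also have "\<dots> = T * d\<^sup>2"
          proof -
            have "real (n * Suc m) \<noteq> 0" using elim by (simp only: of_nat_eq_0_iff mult_eq_0_iff) simp
            then show ?thesis by (simp del: of_nat_mult of_nat_Suc mult_Suc_right)
          qed
          finally show ?thesis using d by simp
        qed
        then show ?case by (auto simp: V_def not_less)
      qed
    qed
  qed (use V in auto)
  then have "\<forall>\<^sub>F n in sequentially. prob (\<Union>m. V n m) < \<eta>/3"
    using \<eta> by (intro order_tendstoD(2)[where y = 0]) auto
  then show "\<forall>\<^sub>F n in sequentially. prob {\<omega>\<in>space M. \<exists>k\<le>n. e < norm (I (grid T n k) \<omega> - riemann_ito H T n k \<omega>)} < \<eta>"
    using eventually_gt_at_top[of 0]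
  proof eventually_elim
    case (elim n)
    define Q where "Q k m = {\<omega>\<in>space M. e/2 < norm (I (grid T n k) \<omega> - riemann_ito H T (n * Suc m) (k * Suc m) \<omega>)}" for k m
    \<comment> \<open>With \<open>n\<close> fixed there are finitely many nodes, so convergence at
      each of them yields one \<open>m\<close> that is good for all.\<close>
    have "(\<lambda>m. \<Sum>k\<le>n. prob (Q k m)) \<longlonglongrightarrow> (\<Sum>k\<le>n. 0)"
      unfolding Q_def using e by (intro tendsto_sum riemann_ito_pointwise_limit[OF I T0 cont]) auto
    then have "\<forall>\<^sub>F m in sequentially. (\<Sum>k\<le>n. prob (Q k m)) < \<eta>/3"
      using \<eta> by (intro order_tendstoD(2)) auto
    then obtain m where m: "(\<Sum>k\<le>n. prob (Q k m)) < \<eta>/3"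
      using eventually_happens by fastforce
    let ?q = "grid T (n * Suc m)" and ?N = "n * Suc m"
    have sm: "strict_mono_on {..?N} ?q"
      using T elim by (intro grid_strict_mono) auto
    interpret noise_sequence M "\<lambda>i. F (?q i)" "\<lambda>i \<omega>. W (?q (Suc i)) \<omega> - W (?q i) \<omega>" "\<lambda>i. ?q (Suc i) - ?q i" ?N
      by (rule brownian_noise(1)[OF sm]) simp
    have \<eta>F: "\<Delta> n m j \<in> borel_measurable (F (?q j))" if "j < ?N" for j
      using \<Delta>F that elim by simp
    define R where "R = {\<omega>\<in>space M. \<exists>k\<le>?N. e/2 < norm (\<Sum>j<k. (W (?q (Suc j)) \<omega> - W (?q j) \<omega>) *\<^sub>R \<Delta> n m j \<omega>)}"
    have "prob R \<le> prob (V n m) + \<delta> / (e/2)\<^sup>2"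
      unfolding R_def V_def using e by (intro max_transform_inequality[OF \<eta>F _ \<delta>(1)]) auto
    also have "prob (V n m) \<le> prob (\<Union>m. V n m)"
      using V by (intro finite_measure_mono) auto
    finally have R: "prob R < \<eta>/3 + \<eta>/3" using elim \<delta>(2) by simp
    have RE: "R \<in> events" unfolding R_def by (rule transform_exceeds_event[OF \<eta>F])
    have QE: "Q k m \<in> events" if "k \<le> n" for k
    proof -
      have [measurable]: "I (grid T n k) \<in> borel_measurable M"
        using grid_in[OF T0 that] by (intro ito_integral_measurable[OF I]) simp
      have "k * Suc m \<le> n * Suc m" using that by (intro mult_right_mono) auto
      note [measurable] = riemann_ito_measurable[OF prog T0 this]
      show ?thesis unfolding Q_def by measurable
    qed
    have sub: "{\<omega>\<in>space M. \<exists>k\<le>n. e < norm (I (grid T n k) \<omega> - riemann_ito H T n k \<omega>)} \<subseteq> (\<Union>k\<le>n. Q k m) \<union> R"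
    proof (rule subsetI, elim CollectE conjE exE)
      fix \<omega> k assume \<omega>: "\<omega> \<in> space M" "k \<le> n" "e < norm (I (grid T n k) \<omega> - riemann_ito H T n k \<omega>)"
      have k: "k * Suc m \<le> n * Suc m" using \<omega>(2) by (intro mult_right_mono) auto
      have eq: "riemann_ito H T (n * Suc m) (k * Suc m) \<omega> - riemann_ito H T n k \<omega> =
          (\<Sum>j<k * Suc m. (W (?q (Suc j)) \<omega> - W (?q j) \<omega>) *\<^sub>R \<Delta> n m j \<omega>)"
        unfolding riemann_ito_def riemann_sum_refine[OF zero_less_Suc[of m], of "\<lambda>t. W t \<omega>" T n "\<lambda>j. H (grid T n j) \<omega>" k]
        by (simp only: \<Delta>_def sum_subtractf scaleR_diff_right)
      have "e < norm (I (grid T n k) \<omega> - riemann_ito H T (n * Suc m) (k * Suc m) \<omega>) +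
          norm (riemann_ito H T (n * Suc m) (k * Suc m) \<omega> - riemann_ito H T n k \<omega>)"
        using \<omega>(3) norm_triangle_ineq[of "I (grid T n k) \<omega> - riemann_ito H T (n * Suc m) (k * Suc m) \<omega>"
            "riemann_ito H T (n * Suc m) (k * Suc m) \<omega> - riemann_ito H T n k \<omega>"] by simp
      then have "e/2 < norm (I (grid T n k) \<omega> - riemann_ito H T (n * Suc m) (k * Suc m) \<omega>) \<or>
          e/2 < norm (\<Sum>j<k * Suc m. (W (?q (Suc j)) \<omega> - W (?q j) \<omega>) *\<^sub>R \<Delta> n m j \<omega>)"
        unfolding eq[symmetric] by linarith
      then show "\<omega> \<in> (\<Union>k\<le>n. Q k m) \<union> R"
        using \<omega>(1,2) k unfolding Q_def R_def by blast
    qed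
    have "prob {\<omega>\<in>space M. \<exists>k\<le>n. e < norm (I (grid T n k) \<omega> - riemann_ito H T n k \<omega>)} \<le> prob (\<Union>k\<le>n. Q k m) + prob R"
      using QE RE by (intro prob_le_add[OF sub]) auto
    also have "prob (\<Union>k\<le>n. Q k m) \<le> (\<Sum>k\<le>n. prob (Q k m))"
      using QE by (intro finite_measure_subadditive_finite) auto
    finally show ?case using m R by simp
  qed
qed simp

end

section \<open>The pathwise second-order expansion\<close>

lemma unif_vanishing_mult:
  assumes "unif_vanishing N u" and "\<And>r j. norm (v r j) \<le> C * norm (u r j)"
  shows "unif_vanishing N v"
  by (rule unif_vanishing_le[OF assms(1), of _ C]) (use assms(2) in auto)

lemma unif_vanishing_diff:
  assumes "unif_vanishing N u" "unif_vanishing N v"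
  shows "unif_vanishing N (\<lambda>r j. u r j - v r j)"
  using unif_vanishing_add[OF assms(1) unif_vanishing_mult[OF assms(2), of "\<lambda>r j. - v r j" 1]] by simp

lemma unif_vanishing_scaleR: "unif_vanishing N u \<Longrightarrow> unif_vanishing N (\<lambda>r j. a *\<^sub>R u r j)"
  by (erule unif_vanishing_mult[where C = "\<bar>a\<bar>"]) simp

lemma unif_vanishing_fst: "unif_vanishing N u \<Longrightarrow> unif_vanishing N (\<lambda>r j. fst (u r j))"
  by (erule unif_vanishing_mult[where C = 1]) (metis norm_fst_le prod.collapse mult_1)

lemma unif_vanishing_snd: "unif_vanishing N u \<Longrightarrow> unif_vanishing N (\<lambda>r j. snd (u r j))"
  by (erule unif_vanishing_mult[where C = 1]) (metis norm_snd_le prod.collapse mult_1)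

lemma unif_vanishing_bounded:
  assumes "unif_vanishing N (\<lambda>r k. Y r k - z r k)" and "\<And>r k. k \<le> N r \<Longrightarrow> norm (z r k) \<le> R"
  shows "\<forall>\<^sub>F r in sequentially. \<forall>k\<le>N r. norm (Y r k) \<le> R + 1"
  using unif_vanishingD[OF assms(1), of 1, simplified]
proof eventually_elim
  case (elim r)
  show ?case
  proof (intro allI impI)
    fix k assume k: "k \<le> N r"
    have "norm (Y r k) \<le> norm (z r k) + norm (Y r k - z r k)"
      using norm_triangle_ineq[of "z r k" "Y r k - z r k"] by simp
    then show "norm (Y r k) \<le> R + 1" using elim k assms(2)[OF k] by fastforce
  qed
qed

lemma unif_vanishing_continuous:
  fixes \<Psi> :: "'a::euclidean_space \<times> 'b::euclidean_space \<Rightarrow> 'c::real_normed_vector"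
    and Y z :: "nat \<Rightarrow> nat \<Rightarrow> 'a" and x :: "nat \<Rightarrow> nat \<Rightarrow> 'b"
  assumes \<Psi>: "continuous_on UNIV \<Psi>" and Y: "unif_vanishing N (\<lambda>r k. Y r k - z r k)"
    and z: "\<And>r k. k \<le> N r \<Longrightarrow> norm (z r k) \<le> R" and x: "\<And>r k. k \<le> N r \<Longrightarrow> norm (x r k) \<le> R"
  shows "unif_vanishing N (\<lambda>r k. \<Psi> (Y r k, x r k) - \<Psi> (z r k, x r k))"
  unfolding unif_vanishing_def
proof (intro allI impI)
  fix e :: real assume e: "0 < e"
  \<comment> \<open>The radius is enlarged by 1 for \<open>Y\<close>, which is eventually within 1
    of \<open>z\<close>.\<close>
  let ?K = "cball 0 (R + 1) \<times> cball 0 R :: ('a \<times> 'b) set"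
  have "uniformly_continuous_on ?K \<Psi>"
    by (intro compact_uniformly_continuous compact_Times compact_cball continuous_on_subset[OF \<Psi>]) auto
  then obtain d where d: "0 < d" "\<And>p p'. p \<in> ?K \<Longrightarrow> p' \<in> ?K \<Longrightarrow> dist p p' < d \<Longrightarrow> dist (\<Psi> p) (\<Psi> p') < e"
    unfolding uniformly_continuous_on_def using e by metis
  show "\<forall>\<^sub>F r in sequentially. \<forall>k\<le>N r. norm (\<Psi> (Y r k, x r k) - \<Psi> (z r k, x r k)) < e"
    using unif_vanishingD[OF Y d(1)] unif_vanishing_bounded[where z = z and R = R, OF Y z, simplified]
  proof eventually_elim
    case (elim r)
    show ?case
    proof (intro allI impI)
      fix k assume k: "k \<le> N r"
      have "dist (\<Psi> (Y r k, x r k)) (\<Psi> (z r k, x r k)) < e"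
      proof (rule d(2))
        show "(Y r k, x r k) \<in> ?K" using elim k x[OF k] by simp
        show "(z r k, x r k) \<in> ?K" using z[OF k] x[OF k] by simp
        show "dist (Y r k, x r k) (z r k, x r k) < d"
          using elim k by (simp add: dist_Pair_Pair dist_norm)
      qed
      then show "norm (\<Psi> (Y r k, x r k) - \<Psi> (z r k, x r k)) < e" by (simp add: dist_norm)
    qed
  qed
qed

text \<open>The pair (y, x) is one parameter of the curve, so \<open>smooth_curve_taylor\<close>
  applies with base points in a compact set of pairs and yields coefficients continuous in
  both.\<close>

definition curve_step ::
    "('a::euclidean_space \<Rightarrow> 'b::euclidean_space) \<Rightarrow> ('a \<Rightarrow> real \<Rightarrow> 'a) \<Rightarrow> ('a \<times> 'a) \<times> real \<Rightarrow> 'b" where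
  "curve_step g \<gamma> = (\<lambda>((y, x), s). g (y + (\<gamma> x s - x)))"

lemma smooth_curve_step:
  fixes \<gamma> :: "'a::euclidean_space \<Rightarrow> real \<Rightarrow> 'a"
  assumes "smooth_family \<gamma>" "smooth_map g"
  shows "smooth_map (curve_step g \<gamma>)"
proof -
  have "smooth_map (\<lambda>p::('a \<times> 'a) \<times> real. (\<lambda>q. \<gamma> (fst q) (snd q)) (snd (fst p), snd p))"
    using assms(1) unfolding smooth_family_def
    by (rule smooth_map_compose)
       (intro smooth_map_bounded_linear bounded_linear_Pair bounded_linear_compose[OF bounded_linear_snd] bounded_linear_fst bounded_linear_snd)
  then have "smooth_map (\<lambda>p::('a \<times> 'a) \<times> real. \<gamma> (snd (fst p)) (snd p))" by simp
  moreover have "smooth_map (\<lambda>p::('a \<times> 'a) \<times> real. fst (fst p) - snd (fst p))"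
    by (intro smooth_map_bounded_linear bounded_linear_sub
        bounded_linear_compose[OF bounded_linear_fst bounded_linear_fst]
        bounded_linear_compose[OF bounded_linear_snd bounded_linear_fst])
  ultimately have "smooth_map (\<lambda>p::('a \<times> 'a) \<times> real. (fst (fst p) - snd (fst p)) + \<gamma> (snd (fst p)) (snd p))"
    by (intro smooth_map_add)
  then have "smooth_map (\<lambda>p::('a \<times> 'a) \<times> real. g ((fst (fst p) - snd (fst p)) + \<gamma> (snd (fst p)) (snd p)))"
    by (rule smooth_map_compose[OF assms(2)])
  moreover have "curve_step g \<gamma> = (\<lambda>p::('a \<times> 'a) \<times> real. g ((fst (fst p) - snd (fst p)) + \<gamma> (snd (fst p)) (snd p)))"
    by (auto simp: curve_step_def fun_eq_iff algebra_simps)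
  ultimately show ?thesis by simp
qed

locale curve_field =
  fixes \<gamma> :: "'a::euclidean_space \<Rightarrow> real \<Rightarrow> 'a" and g :: "'a \<Rightarrow> 'c::euclidean_space"
  assumes \<gamma>: "smooth_family \<gamma>" and \<gamma>_0: "\<gamma> x 0 = x" and g: "smooth_map g"
begin

abbreviation "c1 p \<equiv> first_deriv0 (\<gamma> p)"
abbreviation "c2 p \<equiv> second_deriv0 (\<gamma> p)"
abbreviation "d1 p \<equiv> first_deriv0 (g \<circ> \<gamma> p)"
abbreviation "d2 p \<equiv> second_deriv0 (g \<circ> \<gamma> p)"

text \<open>The Taylor coefficients along the scheme, where \<open>y\<close> and \<open>x\<close>
  differ; the wanted derivatives of \<open>g \<circ> \<gamma> x\<close> are their values on the
  diagonal.\<close>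

definition G1 :: "'a \<times> 'a \<Rightarrow> 'c" where "G1 p = first_deriv0 (\<lambda>s. curve_step g \<gamma> (p, s))"
definition G2 :: "'a \<times> 'a \<Rightarrow> 'c" where "G2 p = second_deriv0 (\<lambda>s. curve_step g \<gamma> (p, s))"

lemma G_diagonal: "G1 (x, x) = first_deriv0 (g \<circ> \<gamma> x)" "G2 (x, x) = second_deriv0 (g \<circ> \<gamma> x)"
  by (simp_all add: G1_def G2_def curve_step_def o_def)

lemma smooth_\<gamma>: "smooth_map (\<lambda>(x, s). \<gamma> x s)"
  using \<gamma> by (simp add: smooth_family_def case_prod_beta')

lemma smooth_curve: "smooth_map (\<gamma> x)"
proof -
  have "smooth_map (\<lambda>s::real. (x, 0) + (0, s))"
    by (intro smooth_map_add smooth_map_const smooth_map_bounded_linear bounded_linear_Pair bounded_linear_zero bounded_linear_ident)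
  from smooth_map_compose[OF smooth_\<gamma> this] show ?thesis by simp
qed

lemma smooth_image_curve: "smooth_map (g \<circ> \<gamma> x)"
  using smooth_map_compose[OF g smooth_curve] by (simp add: o_def)

lemma continuous_G: "continuous_on UNIV G1" "continuous_on UNIV G2"
  unfolding G1_def[abs_def] G2_def[abs_def]
  by (rule smooth_curve_taylor smooth_curve_step \<gamma> g)+

lemma continuous_coefficients:
  "continuous_on UNIV (\<lambda>x. first_deriv0 (\<gamma> x))" "continuous_on UNIV (\<lambda>x. second_deriv0 (\<gamma> x))"
  "continuous_on UNIV (\<lambda>x. first_deriv0 (g \<circ> \<gamma> x))" "continuous_on UNIV (\<lambda>x. second_deriv0 (g \<circ> \<gamma> x))"
proof -
  show "continuous_on UNIV (\<lambda>x. first_deriv0 (\<gamma> x))" "continuous_on UNIV (\<lambda>x. second_deriv0 (\<gamma> x))"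
    using smooth_curve_taylor(1,2)[OF smooth_\<gamma>] by simp_all
  show "continuous_on UNIV (\<lambda>x. first_deriv0 (g \<circ> \<gamma> x))" "continuous_on UNIV (\<lambda>x. second_deriv0 (g \<circ> \<gamma> x))"
    unfolding G_diagonal[symmetric]
    by (intro continuous_on_compose2[OF continuous_G(1)] continuous_on_compose2[OF continuous_G(2)] continuous_intros; simp)+
qed

end

section \<open>The scheme along one fixed path\<close>

text \<open>Here \<open>x\<close> and \<open>w\<close> are ordinary continuous functions, later the
  paths of \<open>X\<close> and \<open>W\<close> at one outcome.\<close>

locale curve_scheme_path = curve_field \<gamma> g
  for \<gamma> :: "'a::euclidean_space \<Rightarrow> real \<Rightarrow> 'a" and g :: "'a \<Rightarrow> 'c::euclidean_space" +
  fixes x :: "real \<Rightarrow> 'a" and w :: "real \<Rightarrow> real" and T :: real and N :: "nat \<Rightarrow> nat"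
  assumes x: "continuous_on {0..T} x" and w: "continuous_on {0..T} w" and T: "0 \<le> T"
    and N: "filterlim N at_top sequentially" and N_pos: "0 < N r"
begin

abbreviation "t r j \<equiv> grid T (N r) j"
abbreviation "h r \<equiv> T / real (N r)"
definition "dw r j = w (t r (Suc j)) - w (t r j)"
definition "Y r k = x 0 + (\<Sum>j<k. \<gamma> (x (t r j)) (dw r j) - x (t r j))"

lemma t_in: "j \<le> N r \<Longrightarrow> t r j \<in> {0..T}"
  by (rule grid_in[OF T])

text \<open>The last index is masked because \<open>dw r (N r)\<close> would involve a node beyond
  \<open>T\<close>, where \<open>w\<close> is not controlled.\<close>

lemma dw_vanishing: "unif_vanishing N (\<lambda>r j. if j < N r then dw r j else 0)"
  unfolding unif_vanishing_def
proof (intro allI impI)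
  fix e :: real assume e: "0 < e"
  then have "\<forall>\<^sub>F r in sequentially. \<forall>j<N r. norm (dw r j) < e"
    using grid_increment_vanishing[OF w T N] by (simp add: dw_def)
  then show "\<forall>\<^sub>F r in sequentially. \<forall>j\<le>N r. norm (if j < N r then dw r j else 0) < e"
    by eventually_elim (use e in auto)
qed

lemma dw_small: "\<forall>\<^sub>F r in sequentially. \<forall>j<N r. \<bar>dw r j\<bar> \<le> 1"
  using unif_vanishingD[OF dw_vanishing, of 1, simplified]
proof eventually_elim
  case (elim r)
  show ?case
  proof (intro allI impI)
    fix j assume "j < N r"
    then have "\<bar>if j < N r then dw r j else 0\<bar> < 1" using elim less_imp_le by blast
    then show "\<bar>dw r j\<bar> \<le> 1" using \<open>j < N r\<close> by simp
  qed
qed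

text \<open>All input from probability. The triple in \<open>quadratic\<close> covers three uses of
  replacing dw^2 by the step length: \<open>c2\<close> in comparing the scheme with
  \<open>x\<close>, the constant 1 for the sum of squares, and \<open>d2\<close> in the expansion of
  \<open>g\<close>.\<close>

context
  assumes ito: "unif_vanishing N (\<lambda>r k. x (t r k) - x 0 - (LINT s:{0..t r k}|lborel. (1/2) *\<^sub>R c2 (x s))
      - (\<Sum>j<k. dw r j *\<^sub>R c1 (x (t r j))))"
    and quadratic: "unif_vanishing N (\<lambda>r k. \<Sum>j<k. ((dw r j)\<^sup>2 - h r) *\<^sub>R (c2 (x (t r j)), 1::real, d2 (x (t r j))))"
begin

lemma quadratic_components:
  "unif_vanishing N (\<lambda>r k. \<Sum>j<k. ((dw r j)\<^sup>2 - h r) *\<^sub>R c2 (x (t r j)))"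
  "unif_vanishing N (\<lambda>r k. \<Sum>j<k. (dw r j)\<^sup>2 - h r)"
  "unif_vanishing N (\<lambda>r k. \<Sum>j<k. ((dw r j)\<^sup>2 - h r) *\<^sub>R d2 (x (t r j)))"
  using unif_vanishing_fst[OF quadratic] unif_vanishing_fst[OF unif_vanishing_snd[OF quadratic]]
    unif_vanishing_snd[OF unif_vanishing_snd[OF quadratic]]
  by (simp_all add: fst_sum snd_sum)

lemma sum_squares_bounded: "\<forall>\<^sub>F r in sequentially. (\<Sum>j<N r. (dw r j)\<^sup>2) \<le> T + 1"
  using unif_vanishingD[OF quadratic_components(2), of 1, simplified]
proof eventually_elim
  case (elim r)
  have "\<bar>\<Sum>j<N r. (dw r j)\<^sup>2 - h r\<bar> < 1" using elim by simp
  moreover have "(\<Sum>j<N r. (dw r j)\<^sup>2 - h r) = (\<Sum>j<N r. (dw r j)\<^sup>2) - T"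
    using N_pos[of r] by (simp add: sum_subtractf)
  ultimately show ?case by linarith
qed

text \<open>One factor |dw| is uniformly small and the sum of the remaining squares is eventually at
  most \<open>T + 1\<close>.\<close>

lemma cubic_remainder_vanishing:
  assumes "0 \<le> C" and "\<forall>\<^sub>F r in sequentially. \<forall>j<N r. norm (v r j) \<le> C * \<bar>dw r j\<bar>^3"
  shows "unif_vanishing N (\<lambda>r k. \<Sum>j<k. v r j)"
proof (rule unif_vanishing_sum[OF unif_vanishing_scaleR[OF dw_vanishing, of C] sum_squares_bounded])
  show "\<forall>\<^sub>F r in sequentially. \<forall>j<N r. norm (v r j) \<le> norm (C *\<^sub>R (if j < N r then dw r j else 0)) * (dw r j)\<^sup>2"
    using assms(2) by eventually_elim (use assms(1) in \<open>auto simp: abs_mult power3_eq_cube power2_eq_square\<close>)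
qed simp

lemma riemann_coefficient:
  fixes \<phi> :: "'a \<Rightarrow> 'b::euclidean_space"
  assumes "continuous_on UNIV \<phi>"
  shows "unif_vanishing N (\<lambda>r k. (\<Sum>j<k. h r *\<^sub>R (1/2) *\<^sub>R \<phi> (x (t r j))) - (LINT s:{0..t r k}|lborel. (1/2) *\<^sub>R \<phi> (x s)))"
  by (rule riemann_sum_vanishing[OF _ T N, where h = "\<lambda>s. (1/2) *\<^sub>R \<phi> (x s)"])
     (intro continuous_intros continuous_on_compose2[OF assms x], simp)

lemma scheme_close: "unif_vanishing N (\<lambda>r k. Y r k - x (t r k))"
proof -
  have "compact (x ` {0..T})"
    by (intro compact_continuous_image x) simp
  from smooth_curve_taylor(3)[OF smooth_\<gamma> this]
  obtain C where C: "0 \<le> C" "\<And>p s. p \<in> x ` {0..T} \<Longrightarrow> \<bar>s\<bar> \<le> 1 \<Longrightarrow>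
      norm (\<gamma> p s - p - s *\<^sub>R c1 p - (s\<^sup>2/2) *\<^sub>R c2 p) \<le> C * \<bar>s\<bar>^3"
    by (auto simp: \<gamma>_0)
  have rem: "unif_vanishing N (\<lambda>r k. \<Sum>j<k. \<gamma> (x (t r j)) (dw r j) - x (t r j) - dw r j *\<^sub>R c1 (x (t r j)) - ((dw r j)\<^sup>2/2) *\<^sub>R c2 (x (t r j)))"
  proof (rule cubic_remainder_vanishing[OF C(1)])
    show "\<forall>\<^sub>F r in sequentially. \<forall>j<N r. norm (\<gamma> (x (t r j)) (dw r j) - x (t r j) - dw r j *\<^sub>R c1 (x (t r j))
       - ((dw r j)\<^sup>2/2) *\<^sub>R c2 (x (t r j))) \<le> C * \<bar>dw r j\<bar>^3"
      using dw_small by eventually_elim (use t_in C(2) in auto)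
  qed
  \<comment> \<open>The difference splits into the Taylor remainder, the Ito error with a minus
    sign, half the quadratic error and the Riemann error of the drift.\<close>
  have eq: "Y r k - x (t r k) =
      (\<Sum>j<k. \<gamma> (x (t r j)) (dw r j) - x (t r j) - dw r j *\<^sub>R c1 (x (t r j)) - ((dw r j)\<^sup>2/2) *\<^sub>R c2 (x (t r j)))
      - (x (t r k) - x 0 - (LINT s:{0..t r k}|lborel. (1/2) *\<^sub>R c2 (x s)) - (\<Sum>j<k. dw r j *\<^sub>R c1 (x (t r j))))
      + (1/2) *\<^sub>R (\<Sum>j<k. ((dw r j)\<^sup>2 - h r) *\<^sub>R c2 (x (t r j)))
      + ((\<Sum>j<k. h r *\<^sub>R (1/2) *\<^sub>R c2 (x (t r j))) - (LINT s:{0..t r k}|lborel. (1/2) *\<^sub>R c2 (x s)))" for r k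
  proof -
    have "(1/2) *\<^sub>R (\<Sum>j<k. ((dw r j)\<^sup>2 - h r) *\<^sub>R c2 (x (t r j))) + (\<Sum>j<k. h r *\<^sub>R (1/2) *\<^sub>R c2 (x (t r j)))
        = (\<Sum>j<k. ((dw r j)\<^sup>2/2) *\<^sub>R c2 (x (t r j)))"
      unfolding scaleR_sum_right sum.distrib[symmetric]
      by (intro sum.cong) (simp_all add: scaleR_left_diff_distrib scaleR_right_diff_distrib)
    then show ?thesis
      unfolding Y_def by (simp only: sum_subtractf) (simp add: algebra_simps)
  qed
  show ?thesis
    unfolding eq
    by (intro unif_vanishing_add unif_vanishing_diff rem ito unif_vanishing_scaleR quadratic_components riemann_coefficient continuous_coefficients)
qed

lemma path_bounded: obtains R where "\<And>r k. k \<le> N r \<Longrightarrow> norm (x (t r k)) \<le> R"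
proof -
  have "bounded (x ` {0..T})"
    by (intro compact_imp_bounded compact_continuous_image x) simp
  then obtain R where "\<And>s. s \<in> {0..T} \<Longrightarrow> norm (x s) \<le> R" unfolding bounded_iff by (metis imageI)
  then show ?thesis using that t_in by blast
qed

lemma coefficient_close:
  fixes \<Psi> :: "'a \<times> 'a \<Rightarrow> 'b::real_normed_vector"
  assumes "continuous_on UNIV \<Psi>"
  shows "unif_vanishing N (\<lambda>r k. \<Psi> (Y r k, x (t r k)) - \<Psi> (x (t r k), x (t r k)))"
proof -
  obtain R where R: "\<And>r k. k \<le> N r \<Longrightarrow> norm (x (t r k)) \<le> R" using path_bounded by blast
  show ?thesis by (rule unif_vanishing_continuous[OF assms scheme_close R R])
qed

lemma integrand_close: "unif_vanishing N (\<lambda>r k. G1 (Y r k, x (t r k)) - d1 (x (t r k)))"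
  using coefficient_close[OF continuous_G(1)] by (simp add: G_diagonal)

text \<open>The values of \<open>g\<close> telescope along the scheme, and the Taylor expansion is
  solved for its first-order sum. All other terms have limits at every node, and what remains is the
  required value of the Ito integral.\<close>

lemma scheme_expansion:
  "unif_vanishing N (\<lambda>r k. (\<Sum>j<k. dw r j *\<^sub>R G1 (Y r j, x (t r j)))
     - (g (x (t r k)) - g (x 0) - (LINT s:{0..t r k}|lborel. (1/2) *\<^sub>R d2 (x s))))"
proof -
  obtain R where R: "\<And>r k. k \<le> N r \<Longrightarrow> norm (x (t r k)) \<le> R" using path_bounded by blast
  let ?K = "cball 0 (R + 1) \<times> cball 0 R :: ('a \<times> 'a) set"
  have "compact ?K" by (intro compact_Times compact_cball)
  from smooth_curve_taylor(3)[OF smooth_curve_step[OF \<gamma> g] this]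
  obtain C where C: "0 \<le> C" "\<And>p s. p \<in> ?K \<Longrightarrow> \<bar>s\<bar> \<le> 1 \<Longrightarrow>
      norm (curve_step g \<gamma> (p, s) - curve_step g \<gamma> (p, 0) - s *\<^sub>R G1 p - (s\<^sup>2/2) *\<^sub>R G2 p) \<le> C * \<bar>s\<bar>^3"
    unfolding G1_def G2_def by blast
  let ?rem = "\<lambda>r j. g (Y r (Suc j)) - g (Y r j) - dw r j *\<^sub>R G1 (Y r j, x (t r j)) - ((dw r j)\<^sup>2/2) *\<^sub>R G2 (Y r j, x (t r j))"
  have rem: "unif_vanishing N (\<lambda>r k. \<Sum>j<k. ?rem r j)"
  proof (rule cubic_remainder_vanishing[OF C(1)])
    show "\<forall>\<^sub>F r in sequentially. \<forall>j<N r. norm (?rem r j) \<le> C * \<bar>dw r j\<bar>^3"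
      using dw_small unif_vanishing_bounded[where R = R, OF scheme_close R, simplified]
    proof eventually_elim
      case (elim r)
      show ?case
      proof (intro allI impI)
        fix j assume j: "j < N r"
        have "(Y r j, x (t r j)) \<in> ?K" using elim(2) R[of j r] j by simp
        from C(2)[OF this, of "dw r j"] elim(1) j
        show "norm (?rem r j) \<le> C * \<bar>dw r j\<bar>^3"
          by (simp add: curve_step_def \<gamma>_0 Y_def add.assoc)
      qed
    qed
  qed
  have G2: "unif_vanishing N (\<lambda>r k. G2 (Y r k, x (t r k)) - d2 (x (t r k)))"
    using coefficient_close[OF continuous_G(2)] by (simp add: G_diagonal)
  \<comment> \<open>Moving \<open>G2\<close> to the diagonal costs its largest deviation times the
    sum of squares.\<close>
  have err: "unif_vanishing N (\<lambda>r k. \<Sum>j<k. ((dw r j)\<^sup>2/2) *\<^sub>R (G2 (Y r j, x (t r j)) - d2 (x (t r j))))"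
  proof (rule unif_vanishing_sum[OF G2 sum_squares_bounded])
    show "\<forall>\<^sub>F r in sequentially. \<forall>j<N r. norm (((dw r j)\<^sup>2/2) *\<^sub>R (G2 (Y r j, x (t r j)) - d2 (x (t r j)))) \<le>
        norm (G2 (Y r j, x (t r j)) - d2 (x (t r j))) * (dw r j)\<^sup>2"
      by (intro always_eventually allI impI) (simp add: mult.commute[of _ "(dw _ _)\<^sup>2"] mult_right_mono)
  qed simp
  have gY: "unif_vanishing N (\<lambda>r k. g (Y r k) - g (x (t r k)))"
    using coefficient_close[of "\<lambda>p. g (fst p)"] smooth_map_imp_continuous[OF g]
    by (simp add: continuous_on_compose2[of UNIV g _ fst] continuous_on_fst continuous_on_id)
  have eq: "(\<Sum>j<k. dw r j *\<^sub>R G1 (Y r j, x (t r j))) - (g (x (t r k)) - g (x 0) - (LINT s:{0..t r k}|lborel. (1/2) *\<^sub>R d2 (x s)))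
    = (g (Y r k) - g (x (t r k))) - (\<Sum>j<k. ?rem r j)
      - (\<Sum>j<k. ((dw r j)\<^sup>2/2) *\<^sub>R (G2 (Y r j, x (t r j)) - d2 (x (t r j))))
      - (1/2) *\<^sub>R (\<Sum>j<k. ((dw r j)\<^sup>2 - h r) *\<^sub>R d2 (x (t r j)))
      - ((\<Sum>j<k. h r *\<^sub>R (1/2) *\<^sub>R d2 (x (t r j))) - (LINT s:{0..t r k}|lborel. (1/2) *\<^sub>R d2 (x s)))" for r k
  proof -
    have "(\<Sum>j<k. ((dw r j)\<^sup>2/2) *\<^sub>R (G2 (Y r j, x (t r j)) - d2 (x (t r j)))) + (1/2) *\<^sub>R (\<Sum>j<k. ((dw r j)\<^sup>2 - h r) *\<^sub>R d2 (x (t r j)))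
        + (\<Sum>j<k. h r *\<^sub>R (1/2) *\<^sub>R d2 (x (t r j))) = (\<Sum>j<k. ((dw r j)\<^sup>2/2) *\<^sub>R G2 (Y r j, x (t r j)))"
      unfolding scaleR_sum_right sum.distrib[symmetric]
      by (intro sum.cong) (simp_all add: scaleR_left_diff_distrib scaleR_right_diff_distrib)
    moreover have "(\<Sum>j<k. g (Y r (Suc j)) - g (Y r j)) = g (Y r k) - g (x 0)"
      using sum_lessThan_telescope[of "\<lambda>j. g (Y r j)" k] by (simp add: Y_def)
    ultimately show ?thesis
      by (simp only: sum_subtractf) (simp add: algebra_simps)
  qed
  show ?thesis
    unfolding eq
    by (intro unif_vanishing_diff gY rem err unif_vanishing_scaleR quadratic_components riemann_coefficient continuous_coefficients)
qed

end

end

section \<open>Ito's formula along a field of curves\<close>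

text \<open>The transform by dW^2 - dt has quadratic variation a sum of \<open>n\<close> terms of
  size 1/n^2, hence of order 1/n along every continuous path. The maximal inequality turns this into
  uniform smallness over the nodes.\<close>

lemma (in brownian_setting) quadratic_variation_vanishes:
  fixes \<Phi> :: "'d::euclidean_space \<Rightarrow> 'b::euclidean_space"
  assumes X: "progressive F X" "AE \<omega> in M. continuous_on {0..} (\<lambda>s. X s \<omega>)"
    and \<Phi>: "continuous_on UNIV \<Phi>" and T: "0 < T" and e: "0 < e"
  defines "V \<equiv> \<lambda>n k \<omega>. \<Sum>j<k. ((W (grid T n (Suc j)) \<omega> - W (grid T n j) \<omega>)\<^sup>2 - T / real n) *\<^sub>R \<Phi> (X (grid T n j) \<omega>)"
  shows "k \<le> n \<Longrightarrow> V n k \<in> borel_measurable M"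
    and "(\<lambda>n. prob {\<omega>\<in>space M. \<exists>k\<le>n. e < norm (V n k \<omega>)}) \<longlonglongrightarrow> 0"
proof -
  have T0: "0 \<le> T" using T by simp
  have prog: "progressive F (\<lambda>s \<omega>. \<Phi> (X s \<omega>))" by (rule progressive_compose[OF X(1) \<Phi>])
  have \<eta>: "(\<lambda>\<omega>. \<Phi> (X (grid T n j) \<omega>)) \<in> borel_measurable (F (grid T n j))" if "j < n" for n j
    using grid_in[OF T0, of j n] that by (intro progressive_adapted[OF prog]) auto
  have noise: "noise_sequence M (\<lambda>i. F (grid T n i)) (\<lambda>i \<omega>. (W (grid T n (Suc i)) \<omega> - W (grid T n i) \<omega>)\<^sup>2 - T / real n)
      (\<lambda>i. 2 * (T / real n)\<^sup>2) n" if "0 < n" for n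
    using brownian_noise(2)[OF grid_strict_mono[OF T that]] by simp
  show "V n k \<in> borel_measurable M" if "k \<le> n"
  proof (cases "n = 0")
    case False
    then interpret noise_sequence M "\<lambda>i. F (grid T n i)" "\<lambda>i \<omega>. (W (grid T n (Suc i)) \<omega> - W (grid T n i) \<omega>)\<^sup>2 - T / real n"
      "\<lambda>i. 2 * (T / real n)\<^sup>2" n
      using noise by simp
    show ?thesis unfolding V_def[abs_def] by (intro measurable_M[OF transform_measurable] \<eta> that)
  qed (use that in \<open>simp add: V_def[abs_def]\<close>)
  define A where "A n \<omega> = (\<Sum>j<n. 2 * (T / real n)\<^sup>2 * (norm (\<Phi> (X (grid T n j) \<omega>)))\<^sup>2)" for n \<omega>
  have [measurable]: "A n \<in> borel_measurable M" for n
  proof -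
    have "(\<lambda>\<omega>. \<Phi> (X (grid T n j) \<omega>)) \<in> borel_measurable M" if "j < n" for j
      using grid_in[OF T0, of j n] that by (intro measurable_F_M[OF \<eta>]) auto
    then show ?thesis
      unfolding A_def[abs_def]
      by (intro borel_measurable_sum borel_measurable_times borel_measurable_power
          borel_measurable_const measurable_compose[OF _ borel_measurable_norm]) auto
  qed
  have A0: "(\<lambda>n. prob {\<omega>\<in>space M. d < A n \<omega>}) \<longlonglongrightarrow> 0" if d: "0 < d" for d
  proof (rule prob_tendsto_0_if_AE)
    show "AE \<omega> in M. \<forall>\<^sub>F n in sequentially. \<omega> \<notin> {\<omega>\<in>space M. d < A n \<omega>}"
      using X(2)
    proof (rule AE_mp[OF _ AE_I2], intro impI)
      fix \<omega> assume "continuous_on {0..} (\<lambda>s. X s \<omega>)"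
      then have "continuous_on {0..T} (\<lambda>s. \<Phi> (X s \<omega>))"
        by (intro continuous_on_compose2[OF \<Phi>] continuous_on_subset[of "{0..}" _ "{0..T}"]) auto
      then have "bounded ((\<lambda>s. \<Phi> (X s \<omega>)) ` {0..T})"
        by (intro compact_imp_bounded compact_continuous_image) auto
      then obtain B where B: "\<And>s. s \<in> {0..T} \<Longrightarrow> norm (\<Phi> (X s \<omega>)) \<le> B"
        unfolding bounded_iff by (metis imageI)
      \<comment> \<open>\<open>n\<close> terms, each at most
        \<open>2 * (T / real n)\<^sup>2 * B\<^sup>2\<close>; the bound \<open>B\<close> depends on
        the path.\<close>
      have "(\<lambda>n. 2 * T\<^sup>2 * B\<^sup>2 / real n) \<longlonglongrightarrow> 0"
        by (rule lim_const_over_n)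
      then have "\<forall>\<^sub>F n in sequentially. 2 * T\<^sup>2 * B\<^sup>2 / real n < d"
        using d by (intro order_tendstoD(2)) auto
      then show "\<forall>\<^sub>F n in sequentially. \<omega> \<notin> {\<omega>\<in>space M. d < A n \<omega>}"
      proof eventually_elim
        case (elim n)
        have "A n \<omega> \<le> (\<Sum>j<n. 2 * (T / real n)\<^sup>2 * B\<^sup>2)"
          unfolding A_def using grid_in[OF T0] by (intro sum_mono mult_left_mono power_mono B) auto
        also have "\<dots> = 2 * T\<^sup>2 * B\<^sup>2 / real n"
          by (cases "n = 0") (simp_all add: power2_eq_square field_simps)
        finally show ?case using elim by simp
      qed
    qed
  qed measurable
  show "(\<lambda>n. prob {\<omega>\<in>space M. \<exists>k\<le>n. e < norm (V n k \<omega>)}) \<longlonglongrightarrow> 0"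
  proof (rule tendsto_0_if_eventually_small)
    fix \<eta>' :: real assume \<eta>': "0 < \<eta>'"
    define d where "d = e\<^sup>2 * (\<eta>' / 2)"
    have d: "0 < d" "d / e\<^sup>2 = \<eta>' / 2" using e \<eta>' by (auto simp: d_def)
    have "\<forall>\<^sub>F n in sequentially. prob {\<omega>\<in>space M. d < A n \<omega>} < \<eta>' / 2"
      using A0[OF d(1)] \<eta>' by (intro order_tendstoD(2)) auto
    then show "\<forall>\<^sub>F n in sequentially. prob {\<omega>\<in>space M. \<exists>k\<le>n. e < norm (V n k \<omega>)} < \<eta>'"
      using eventually_gt_at_top[of 0]
    proof eventually_elim
      case (elim n)
      then interpret noise_sequence M "\<lambda>i. F (grid T n i)" "\<lambda>i \<omega>. (W (grid T n (Suc i)) \<omega> - W (grid T n i) \<omega>)\<^sup>2 - T / real n"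
        "\<lambda>i. 2 * (T / real n)\<^sup>2" n
        using noise by simp
      have "prob {\<omega>\<in>space M. \<exists>k\<le>n. e < norm (V n k \<omega>)} \<le> prob {\<omega>\<in>space M. d < A n \<omega>} + d / e\<^sup>2"
        unfolding V_def A_def by (rule max_transform_inequality[OF \<eta> e d(1)])
      then show ?case using elim d by simp
    qed
  qed simp
qed

lemma set_integral_point:
  fixes f :: "real \<Rightarrow> 'b::euclidean_space"
  shows "(LINT s:{a}|lborel. f s) = 0"
  unfolding set_lebesgue_integral_def
proof (rule integral_eq_zero_AE)
  show "AE s in lborel. indicator {a} s *\<^sub>R f s = 0"
    using AE_lborel_singleton[of a] by eventually_elim auto
qed

text \<open>Treated separately because the grids of a degenerate interval have steps of length 0;
  the simple integrands with no cells serve as approximation.\<close>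

lemma has_ito_integral_0:
  assumes M: "prob_space M" and H: "progressive F H"
  shows "has_ito_integral M F W H 0 (\<lambda>\<omega>. 0)"
proof -
  interpret prob_space M by fact
  have "set_integrable lborel {0..0::real} (\<lambda>s. (norm (H s \<omega>))\<^sup>2)" for \<omega>
    unfolding set_integrable_def
  proof (rule integrable_cong_AE_imp[of _ "\<lambda>_. 0"])
    have "(\<lambda>s. indicator {0..0} s *\<^sub>R (norm (H s \<omega>))\<^sup>2) = (\<lambda>s. indicator {0::real} s * (norm (H 0 \<omega>))\<^sup>2)"
      by (auto simp: indicator_def fun_eq_iff)
    then show "(\<lambda>s. indicator {0..0} s *\<^sub>R (norm (H s \<omega>))\<^sup>2) \<in> borel_measurable lborel" by simp
    show "AE s in lborel. 0 = indicator {0..0} s *\<^sub>R (norm (H s \<omega>))\<^sup>2"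
      using AE_lborel_singleton[of 0] by eventually_elim simp
  qed simp
  moreover have "simple_data M F 0 0 (\<lambda>_. 0) (\<lambda>_ _. 0 :: 'b)" by (simp add: simple_data_def)
  moreover have "conv_in_prob M (\<lambda>n. simple_ito_integral W 0 (\<lambda>_. 0) (\<lambda>_ _. 0 :: 'b)) (\<lambda>\<omega>. 0)"
    by (simp add: conv_in_prob_def simple_ito_integral_def[abs_def])
  moreover have "conv_in_prob M (\<lambda>n \<omega>. LINT s:{0..0}|lborel. (norm (simple_integrand 0 (\<lambda>_. 0) (\<lambda>_ _. 0) s \<omega> - H s \<omega>))\<^sup>2) (\<lambda>\<omega>. 0)"
    by (simp add: conv_in_prob_def set_integral_point)
  ultimately show ?thesis
    unfolding has_ito_integral_def using H
    by (intro conjI AE_I2 exI[of _ "\<lambda>_. 0"] exI[of _ "\<lambda>_ _. 0"] exI[of _ "\<lambda>_ _ _. 0"]) auto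
qed

section \<open>The scheme as a random process\<close>

locale curve_sde = brownian_setting M F W + curve_field \<gamma> g
  for M :: "'w measure" and F :: "real \<Rightarrow> 'w measure" and W :: "real \<Rightarrow> 'w \<Rightarrow> real"
    and \<gamma> :: "'a::euclidean_space \<Rightarrow> real \<Rightarrow> 'a" and g :: "'a \<Rightarrow> 'c::euclidean_space" +
  fixes X :: "real \<Rightarrow> 'w \<Rightarrow> 'a"
  assumes sde: "ito_equation M F W X (\<lambda>t \<omega>. (1/2) *\<^sub>R second_deriv0 (\<gamma> (X t \<omega>))) (\<lambda>t \<omega>. first_deriv0 (\<gamma> (X t \<omega>)))"
begin

lemma X_progressive: "progressive F X" and X_continuous: "AE \<omega> in M. continuous_on {0..} (\<lambda>t. X t \<omega>)"
  using sde by (simp_all add: ito_equation_def)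

lemma g_continuous: "continuous_on UNIV g"
  by (rule smooth_map_imp_continuous[OF g])

lemma image_continuous:
  "continuous_on UNIV \<phi> \<Longrightarrow> continuous_on {0..} (\<lambda>t. X t \<omega>) \<Longrightarrow> continuous_on {0..T} (\<lambda>t. \<phi> (X t \<omega>))"
  by (rule continuous_on_compose2[of UNIV \<phi>]) (auto intro: continuous_on_subset)

lemma image_set_integrable:
  fixes \<phi> :: "'a \<Rightarrow> 'b::euclidean_space"
  assumes "continuous_on UNIV \<phi>"
  shows "AE \<omega> in M. set_integrable lborel {0..T} (\<lambda>t. \<phi> (X t \<omega>))"
  using X_continuous
  by eventually_elim (simp add: set_integrable_def borel_integrable_compact image_continuous[OF assms])

text \<open>The version of the Ito integral of \<open>c1 (X t)\<close> that the equation itself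
  provides. Having this expression rather than an arbitrary version makes its error the one assumed
  on each path in \<open>curve_scheme_path\<close>.\<close>

definition I :: "real \<Rightarrow> 'w \<Rightarrow> 'a" where
  "I t \<omega> = X t \<omega> - X 0 \<omega> - (LINT s:{0..t}|lborel. (1/2) *\<^sub>R c2 (X s \<omega>))"

lemma I_integral: "0 \<le> t \<Longrightarrow> has_ito_integral M F W (\<lambda>t \<omega>. c1 (X t \<omega>)) t (I t)"
  using sde unfolding ito_equation_def I_def[abs_def] by simp

text \<open>Both errors are kept in one vector so that a single subsequence of grids serves all of
  them.\<close>

definition errors :: "real \<Rightarrow> nat \<Rightarrow> nat \<Rightarrow> 'w \<Rightarrow> 'a \<times> ('a \<times> real \<times> 'c)" where
  "errors T n k \<omega> = (I (grid T n k) \<omega> - riemann_ito (\<lambda>t \<omega>. c1 (X t \<omega>)) T n k \<omega>,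
     \<Sum>j<k. ((W (grid T n (Suc j)) \<omega> - W (grid T n j) \<omega>)\<^sup>2 - T / real n) *\<^sub>R
       (c2 (X (grid T n j) \<omega>), 1::real, d2 (X (grid T n j) \<omega>)))"

lemma errors_subsequence:
  assumes T: "0 < T"
  obtains r where "strict_mono r" "\<And>i. 0 < r i" "AE \<omega> in M. unif_vanishing r (\<lambda>i k. errors T (r i) k \<omega>)"
proof -
  let ?H = "\<lambda>t \<omega>. c1 (X t \<omega>)" and ?\<Phi> = "\<lambda>p. (c2 p, 1::real, d2 p)"
  have T0: "0 \<le> T" using T by simp
  have cont: "AE \<omega> in M. continuous_on {0..} (\<lambda>t. c1 (X t \<omega>))"
    using X_continuous by eventually_elim (auto intro: continuous_on_compose2[OF continuous_coefficients(1)])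
  have \<Phi>: "continuous_on UNIV ?\<Phi>"
    by (intro continuous_intros continuous_coefficients)
  note q = quadratic_variation_vanishes[OF X_progressive X_continuous \<Phi> T]
  let ?E1 = "\<lambda>n e. {\<omega>\<in>space M. \<exists>k\<le>n. e < norm (fst (errors T n k \<omega>))}"
  let ?E2 = "\<lambda>n e. {\<omega>\<in>space M. \<exists>k\<le>n. e < norm (snd (errors T n k \<omega>))}"
  have m1: "(\<lambda>\<omega>. fst (errors T n k \<omega>)) \<in> borel_measurable M" if "k \<le> n" for n k
    using riemann_ito_error_measurable[OF I_integral T0 that] by (simp add: errors_def)
  have m2: "(\<lambda>\<omega>. snd (errors T n k \<omega>)) \<in> borel_measurable M" if "k \<le> n" for n k
    using q(1)[OF zero_less_one that] by (simp add: errors_def)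
  have E1: "?E1 n e \<in> events" for n e
    by (rule exceeds_event[of n "\<lambda>k \<omega>. fst (errors T n k \<omega>)"]) (rule m1)
  have E2: "?E2 n e \<in> events" for n e
    by (rule exceeds_event[of n "\<lambda>k \<omega>. snd (errors T n k \<omega>)"]) (rule m2)
  have L1: "(\<lambda>n. prob (?E1 n e)) \<longlonglongrightarrow> 0" if "0 < e" for e
    using riemann_sums_converge_uniformly[OF I_integral T cont that] by (simp add: errors_def)
  have L2: "(\<lambda>n. prob (?E2 n e)) \<longlonglongrightarrow> 0" if "0 < e" for e
    using q(2)[OF that] by (simp add: errors_def)
  show ?thesis
  proof (rule AE_subsequence[of "errors T"])
    fix n k :: nat assume "k \<le> n"
    then show "errors T n k \<in> borel_measurable M"
      using borel_measurable_Pair[OF m1 m2, of k n k n] by simp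
  next
    fix e :: real assume e: "0 < e"
    have sub: "{\<omega>\<in>space M. \<exists>k\<le>n. e < norm (errors T n k \<omega>)} \<subseteq> ?E1 n (e/2) \<union> ?E2 n (e/2)" for n
    proof (rule subsetI, elim CollectE conjE exE)
      fix \<omega> k assume *: "\<omega> \<in> space M" "k \<le> n" "e < norm (errors T n k \<omega>)"
      have "norm (errors T n k \<omega>) \<le> norm (fst (errors T n k \<omega>)) + norm (snd (errors T n k \<omega>))"
        using norm_Pair_le[of "fst (errors T n k \<omega>)" "snd (errors T n k \<omega>)"] by simp
      then have "e/2 < norm (fst (errors T n k \<omega>)) \<or> e/2 < norm (snd (errors T n k \<omega>))"
        using *(3) by linarith
      then show "\<omega> \<in> ?E1 n (e/2) \<union> ?E2 n (e/2)" using *(1,2) by blast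
    qed
    show "(\<lambda>n. prob {\<omega>\<in>space M. \<exists>k\<le>n. e < norm (errors T n k \<omega>)}) \<longlonglongrightarrow> 0"
    proof (rule tendsto_sandwich[OF _ _ tendsto_const])
      show "(\<lambda>n. prob (?E1 n (e/2)) + prob (?E2 n (e/2))) \<longlonglongrightarrow> 0"
        using tendsto_add[OF L1 L2, of "e/2" "e/2"] e by simp
      show "\<forall>\<^sub>F n in sequentially. prob {\<omega>\<in>space M. \<exists>k\<le>n. e < norm (errors T n k \<omega>)} \<le> prob (?E1 n (e/2)) + prob (?E2 n (e/2))"
        by (intro always_eventually allI prob_le_add[OF sub E1 E2])
    qed simp
  qed (use that in blast)
qed

definition scheme :: "real \<Rightarrow> nat \<Rightarrow> nat \<Rightarrow> 'w \<Rightarrow> 'a" where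
  "scheme T n k \<omega> = X 0 \<omega> +
     (\<Sum>j<k. \<gamma> (X (grid T n j) \<omega>) (W (grid T n (Suc j)) \<omega> - W (grid T n j) \<omega>) - X (grid T n j) \<omega>)"

text \<open>Simple data must be bounded, so a coefficient larger than \<open>n\<close> is replaced
  by 0. The bound grows with the grid, and on each relevant path the cut-off is eventually
  inactive.\<close>

definition integrand :: "real \<Rightarrow> nat \<Rightarrow> nat \<Rightarrow> 'w \<Rightarrow> 'c" where
  "integrand T n k \<omega> = (let v = G1 (scheme T n k \<omega>, X (grid T n k) \<omega>) in if norm v \<le> real n then v else 0)"

text \<open>The \<open>k\<close>-th value involves \<open>W\<close> only up to the
  \<open>k\<close>-th node, as needed for a coefficient on the cell that begins there.\<close>

lemma scheme_measurable:
  assumes T: "0 \<le> T" and k: "k \<le> n"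
  shows "scheme T n k \<in> borel_measurable (F (grid T n k))"
proof -
  have pos: "0 \<le> grid T n j" for j using T by (simp add: grid_def)
  have le: "grid T n j \<le> grid T n k" if "j \<le> k" for j
    using T that by (simp add: grid_def divide_right_mono mult_left_mono)
  have X: "X (grid T n j) \<in> borel_measurable (F (grid T n k))" if "j \<le> k" for j
    by (rule measurable_F_mono[OF progressive_adapted[OF X_progressive pos] le[OF that]])
  have W: "W (grid T n j) \<in> borel_measurable (F (grid T n k))" if "j \<le> k" for j
    by (rule measurable_F_mono[OF W_adapted[OF pos] le[OF that]])
  have \<gamma>: "(\<lambda>\<omega>. \<gamma> (X (grid T n j) \<omega>) (W (grid T n (Suc j)) \<omega> - W (grid T n j) \<omega>)) \<in> borel_measurable (F (grid T n k))" if "j < k" for j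
    using borel_measurable_continuous_Pair[OF X[of j] borel_measurable_diff[OF W[of "Suc j"] W[of j]], of "\<gamma>"] that
      smooth_map_imp_continuous[OF smooth_\<gamma>] by (simp add: case_prod_beta')
  show ?thesis
    unfolding scheme_def[abs_def]
    using X[of 0] by (intro borel_measurable_add borel_measurable_sum borel_measurable_diff \<gamma> X) auto
qed

lemma integrand_measurable:
  assumes T: "0 \<le> T" and k: "k \<le> n"
  shows "integrand T n k \<in> borel_measurable (F (grid T n k))"
proof -
  have "0 \<le> grid T n k" using T by (simp add: grid_def)
  note [measurable] = scheme_measurable[OF T k] progressive_adapted[OF X_progressive this]
    borel_measurable_continuous_onI[OF continuous_G(1)]
  show ?thesis unfolding integrand_def[abs_def] Let_def by measurable
qed

lemma integrand_data:
  assumes T: "0 \<le> T" and n: "0 < n"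
  shows "simple_data M F T n (grid T n) (integrand T n)"
  unfolding simple_data_def
proof (intro conjI allI impI exI ballI)
  show "integrand T n i \<in> borel_measurable (F (grid T n i))" if "i < n" for i
    using integrand_measurable[OF T] that by simp
  show "norm (integrand T n i \<omega>) \<le> real n" for i \<omega>
    by (simp add: integrand_def Let_def)
qed (use n grid_le_Suc[OF T] in auto)

lemma scheme_converges_pathwise:
  assumes T: "0 < T" and r: "filterlim r at_top sequentially" "\<And>i. 0 < r i"
    and X: "continuous_on {0..} (\<lambda>t. X t \<omega>)" and W: "continuous_on {0..} (\<lambda>t. W t \<omega>)"
    and err: "unif_vanishing r (\<lambda>i k. errors T (r i) k \<omega>)"
  shows "\<forall>e>0. \<forall>\<^sub>F i in sequentially. \<forall>j<r i. norm (integrand T (r i) j \<omega> - d1 (X (grid T (r i) j) \<omega>)) < e"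
    and "(\<lambda>i. simple_ito_integral W (r i) (grid T (r i)) (integrand T (r i)) \<omega>) \<longlonglongrightarrow>
      g (X T \<omega>) - g (X 0 \<omega>) - (LINT s:{0..T}|lborel. (1/2) *\<^sub>R d2 (X s \<omega>))"
proof -
  interpret curve_scheme_path \<gamma> g "\<lambda>t. X t \<omega>" "\<lambda>t. W t \<omega>" T r
    using T r X W by unfold_locales (auto intro: continuous_on_subset)
  have ito: "unif_vanishing r (\<lambda>i k. X (grid T (r i) k) \<omega> - X 0 \<omega> - (LINT s:{0..grid T (r i) k}|lborel. (1/2) *\<^sub>R c2 (X s \<omega>))
      - (\<Sum>j<k. dw i j *\<^sub>R c1 (X (grid T (r i) j) \<omega>)))"
    using unif_vanishing_fst[OF err] by (simp add: errors_def I_def riemann_ito_def dw_def)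
  have quadratic: "unif_vanishing r (\<lambda>i k. \<Sum>j<k. ((dw i j)\<^sup>2 - T / real (r i)) *\<^sub>R (c2 (X (grid T (r i) j) \<omega>), 1::real, d2 (X (grid T (r i) j) \<omega>)))"
    using unif_vanishing_snd[OF err] by (simp add: errors_def dw_def)
  note close = integrand_close[OF ito quadratic] and expansion = scheme_expansion[OF ito quadratic]
  have Y: "Y i k = scheme T (r i) k \<omega>" for i k
    by (simp add: Y_def scheme_def dw_def)
  have "bounded ((\<lambda>t. d1 (X t \<omega>)) ` {0..T})"
    by (intro compact_imp_bounded compact_continuous_image image_continuous continuous_coefficients X) simp
  then obtain B where B: "\<And>s. s \<in> {0..T} \<Longrightarrow> norm (d1 (X s \<omega>)) \<le> B"
    unfolding bounded_iff by (metis imageI)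
  \<comment> \<open>The coefficients are eventually within 1 of \<open>d1\<close> along the path,
    which is bounded by \<open>B\<close>; once \<open>r i\<close> exceeds \<open>B + 1\<close>
    nothing is cut off.\<close>
  have "\<forall>\<^sub>F i in sequentially. B + 1 \<le> real (r i)"
    using eventually_compose_filterlim[OF eventually_ge_at_top filterlim_compose[OF filterlim_real_sequentially r(1)]] .
  then have untruncated: "\<forall>\<^sub>F i in sequentially. \<forall>j<r i. integrand T (r i) j \<omega> = G1 (Y i j, X (grid T (r i) j) \<omega>)"
    using unif_vanishing_bounded[where R = B, OF close B[OF t_in], simplified]
    by eventually_elim (auto simp: integrand_def Let_def Y dest!: less_imp_le intro: order_trans)
  show "\<forall>e>0. \<forall>\<^sub>F i in sequentially. \<forall>j<r i. norm (integrand T (r i) j \<omega> - d1 (X (grid T (r i) j) \<omega>)) < e"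
  proof (intro allI impI)
    fix e :: real assume "0 < e"
    from untruncated unif_vanishingD[OF close this]
    show "\<forall>\<^sub>F i in sequentially. \<forall>j<r i. norm (integrand T (r i) j \<omega> - d1 (X (grid T (r i) j) \<omega>)) < e"
      by eventually_elim auto
  qed
  let ?L = "g (X T \<omega>) - g (X 0 \<omega>) - (LINT s:{0..T}|lborel. (1/2) *\<^sub>R d2 (X s \<omega>))"
  show "(\<lambda>i. simple_ito_integral W (r i) (grid T (r i)) (integrand T (r i)) \<omega>) \<longlonglongrightarrow> ?L"
  proof (rule tendstoI)
    fix e :: real assume "0 < e"
    from untruncated unif_vanishingD[OF expansion this]
    show "\<forall>\<^sub>F i in sequentially. dist (simple_ito_integral W (r i) (grid T (r i)) (integrand T (r i)) \<omega>) ?L < e"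
    proof eventually_elim
      case (elim i)
      have "simple_ito_integral W (r i) (grid T (r i)) (integrand T (r i)) \<omega> = (\<Sum>j<r i. dw i j *\<^sub>R G1 (Y i j, X (grid T (r i) j) \<omega>))"
        unfolding simple_ito_integral_def dw_def using elim(1) by (intro sum.cong) auto
      then show ?case using elim(2)[rule_format, of "r i"] r(2)[of i] by (simp add: dist_norm)
    qed
  qed
qed

text \<open>The truncated coefficients on the subsequence of grids are the witnesses for the
  existential in \<open>has_ito_integral\<close>. Both required convergences hold almost surely,
  hence in probability.\<close>

lemma ito_formula_integral:
  assumes T: "0 \<le> T"
  shows "has_ito_integral M F W (\<lambda>t \<omega>. d1 (X t \<omega>)) T
    (\<lambda>\<omega>. g (X T \<omega>) - g (X 0 \<omega>) - (LINT s:{0..T}|lborel. (1/2) *\<^sub>R d2 (X s \<omega>)))"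
proof -
  have prog: "progressive F (\<lambda>t \<omega>. d1 (X t \<omega>))"
    by (rule progressive_compose[OF X_progressive continuous_coefficients(3)])
  show ?thesis
  proof (cases "T = 0")
    case True
    then show ?thesis
      using has_ito_integral_0[OF prob_space_axioms prog] by (simp add: set_integral_point)
  next
    case False
    then have T': "0 < T" using T by simp
    obtain r where r: "strict_mono r" "\<And>i. 0 < r i" "AE \<omega> in M. unif_vanishing r (\<lambda>i k. errors T (r i) k \<omega>)"
      using errors_subsequence[OF T'] by blast
    have rlim: "filterlim r at_top sequentially"
      by (rule filterlim_subseq[OF r(1)])
    let ?I = "\<lambda>\<omega>. g (X T \<omega>) - g (X 0 \<omega>) - (LINT s:{0..T}|lborel. (1/2) *\<^sub>R d2 (X s \<omega>))"
    note data = integrand_data[OF T r(2)]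
    note ad = simple_data_imp_adapted[OF data]
    have AE: "AE \<omega> in M. continuous_on {0..} (\<lambda>t. X t \<omega>) \<and> continuous_on {0..} (\<lambda>t. W t \<omega>) \<and> unif_vanishing r (\<lambda>i k. errors T (r i) k \<omega>)"
      using X_continuous W_continuous r(3) by eventually_elim simp
    show ?thesis
      unfolding has_ito_integral_def
    proof (intro conjI prog exI[of _ r] exI[of _ "\<lambda>i. grid T (r i)"] exI[of _ "\<lambda>i. integrand T (r i)"] allI data)
      show "AE \<omega> in M. set_integrable lborel {0..T} (\<lambda>s. (norm (d1 (X s \<omega>)))\<^sup>2)"
        by (rule image_set_integrable) (intro continuous_intros continuous_coefficients)
      show "conv_in_prob M (\<lambda>i \<omega>. LINT s:{0..T}|lborel. (norm (simple_integrand (r i) (grid T (r i)) (integrand T (r i)) s \<omega> - d1 (X s \<omega>)))\<^sup>2) (\<lambda>\<omega>. 0)"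
      proof (rule AE_tendsto_imp_conv_in_prob)
        show "(\<lambda>\<omega>. LINT s:{0..T}|lborel. (norm (simple_integrand (r i) (grid T (r i)) (integrand T (r i)) s \<omega> - d1 (X s \<omega>)))\<^sup>2) \<in> borel_measurable M" for i
          by (rule simple_L2_distance_measurable[OF prog T adapted_data_measurable[OF ad]])
        show "AE \<omega> in M. (\<lambda>i. LINT s:{0..T}|lborel. (norm (simple_integrand (r i) (grid T (r i)) (integrand T (r i)) s \<omega> - d1 (X s \<omega>)))\<^sup>2) \<longlonglongrightarrow> 0"
          using AE
        proof (rule AE_mp[OF _ AE_I2], intro impI)
          fix \<omega> assume *: "continuous_on {0..} (\<lambda>t. X t \<omega>) \<and> continuous_on {0..} (\<lambda>t. W t \<omega>) \<and> unif_vanishing r (\<lambda>i k. errors T (r i) k \<omega>)"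
          show "(\<lambda>i. LINT s:{0..T}|lborel. (norm (simple_integrand (r i) (grid T (r i)) (integrand T (r i)) s \<omega> - d1 (X s \<omega>)))\<^sup>2) \<longlonglongrightarrow> 0"
            using * by (intro simple_integrand_L2_limit T rlim scheme_converges_pathwise(1)[OF T' rlim r(2)] image_continuous continuous_coefficients) auto
        qed
      qed simp
      show "conv_in_prob M (\<lambda>i. simple_ito_integral W (r i) (grid T (r i)) (integrand T (r i))) ?I"
      proof (rule AE_tendsto_imp_conv_in_prob)
        show "simple_ito_integral W (r i) (grid T (r i)) (integrand T (r i)) \<in> borel_measurable M" for i
          by (rule simple_ito_integral_measurable[OF ad])
        have [measurable]: "(\<lambda>\<omega>. LINT s:{0..T}|lborel. (1/2) *\<^sub>R d2 (X s \<omega>)) \<in> borel_measurable M"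
          by (intro path_integral_measurable progressive_measurable_M[OF _ T] progressive_compose[OF X_progressive] continuous_intros continuous_coefficients)
        have [measurable]: "X T \<in> borel_measurable M" "X 0 \<in> borel_measurable M"
          by (rule measurable_F_M[OF progressive_adapted[OF X_progressive]]; use T in simp)+
        note [measurable] = borel_measurable_continuous_onI[OF g_continuous]
        show "?I \<in> borel_measurable M" by measurable
        show "AE \<omega> in M. (\<lambda>i. simple_ito_integral W (r i) (grid T (r i)) (integrand T (r i)) \<omega>) \<longlonglongrightarrow> ?I \<omega>"
          using AE by (rule AE_mp[OF _ AE_I2]) (use scheme_converges_pathwise(2)[OF T' rlim r(2)] in blast)
      qed
    qed
  qed
qed

theorem ito_formula:
  "ito_equation M F W (\<lambda>t \<omega>. g (X t \<omega>)) (\<lambda>t \<omega>. (1/2) *\<^sub>R d2 (X t \<omega>)) (\<lambda>t \<omega>. d1 (X t \<omega>))"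
  unfolding ito_equation_def
proof (intro conjI allI impI ito_formula_integral)
  show "progressive F (\<lambda>t \<omega>. g (X t \<omega>))"
    by (rule progressive_compose[OF X_progressive g_continuous])
  show "AE \<omega> in M. continuous_on {0..} (\<lambda>t. g (X t \<omega>))"
    using X_continuous by eventually_elim (auto intro: continuous_on_compose2[OF g_continuous])
  have c: "continuous_on UNIV (\<lambda>p. (1/2) *\<^sub>R d2 p)"
    by (intro continuous_intros continuous_coefficients)
  show "progressive F (\<lambda>t \<omega>. (1/2) *\<^sub>R d2 (X t \<omega>))"
    by (rule progressive_compose[OF X_progressive c])
  show "AE \<omega> in M. set_integrable lborel {0..T} (\<lambda>t. (1/2) *\<^sub>R d2 (X t \<omega>))" for T
    by (rule image_set_integrable[OF c])
qed

end

theorem lemma1: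
  fixes M :: "'w measure" and F :: "real \<Rightarrow> 'w measure" and W :: "real \<Rightarrow> 'w \<Rightarrow> real"
    and \<gamma> :: "real ^ 'n \<Rightarrow> real \<Rightarrow> real ^ 'n"
    and f :: "real ^ 'n \<Rightarrow> real ^ 'n"
    and X :: "real \<Rightarrow> 'w \<Rightarrow> real ^ 'n"
  assumes "filtered_prob_space M F"
    and "brownian_motion M F W"
    and "smooth_family \<gamma>"
    and "\<And>x. \<gamma> x 0 = x"
    and "smooth_map f"
    and "satisfies_2jet_SDE M F W X (\<lambda>t \<omega>. j2 (\<gamma> (X t \<omega>)))"
  shows "satisfies_2jet_SDE M F W (\<lambda>t \<omega>. (X t \<omega>, f (X t \<omega>)))
           (\<lambda>t \<omega>. j2 (curve_prod (\<gamma> (X t \<omega>)) (f \<circ> \<gamma> (X t \<omega>)))) \<and>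
         ito_equation M F W (\<lambda>t \<omega>. (X t \<omega>, f (X t \<omega>)))
           (\<lambda>t \<omega>. (1/2) *\<^sub>R (second_deriv0 (\<gamma> (X t \<omega>)), second_deriv0 (f \<circ> \<gamma> (X t \<omega>))))
           (\<lambda>t \<omega>. (first_deriv0 (\<gamma> (X t \<omega>)), first_deriv0 (f \<circ> \<gamma> (X t \<omega>))))"
proof -
  define g where "g = (\<lambda>x. (x, f x))"
  interpret curve_field \<gamma> g
    using smooth_map_Pair[OF smooth_map_bounded_linear[OF bounded_linear_ident] assms(5)] assms(3,4)
    by unfold_locales (simp_all add: g_def)
  have f\<gamma>: "smooth_map (f \<circ> \<gamma> x)" for x
    using smooth_map_compose[OF assms(5) smooth_curve] by (simp add: o_def)
  have prod: "g \<circ> \<gamma> x = curve_prod (\<gamma> x) (f \<circ> \<gamma> x)" for x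
    by (auto simp: g_def curve_prod_def)
  have smooth_prod: "smooth_map (curve_prod (\<gamma> x) (f \<circ> \<gamma> x))" for x
    using smooth_image_curve by (simp add: prod)
  have derivs: "first_deriv0 (g \<circ> \<gamma> x) = (first_deriv0 (\<gamma> x), first_deriv0 (f \<circ> \<gamma> x))"
    "second_deriv0 (g \<circ> \<gamma> x) = (second_deriv0 (\<gamma> x), second_deriv0 (f \<circ> \<gamma> x))" for x
    by (simp_all only: prod jets_curve_prod[OF smooth_curve f\<gamma>])
  \<comment> \<open>Jets of smooth curves return the derivatives of the curve, which turns the
    hypothesis on jets into an equation with explicit coefficients.\<close>
  interpret curve_sde M F W \<gamma> g X
    using assms(1,2,6) by unfold_locales
      (simp_all add: satisfies_2jet_SDE_def jet_deriv1_j2[OF smooth_curve] jet_deriv2_j2[OF smooth_curve])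
  have ito: "ito_equation M F W (\<lambda>t \<omega>. (X t \<omega>, f (X t \<omega>)))
           (\<lambda>t \<omega>. (1/2) *\<^sub>R (second_deriv0 (\<gamma> (X t \<omega>)), second_deriv0 (f \<circ> \<gamma> (X t \<omega>))))
           (\<lambda>t \<omega>. (first_deriv0 (\<gamma> (X t \<omega>)), first_deriv0 (f \<circ> \<gamma> (X t \<omega>))))"
    using ito_formula unfolding derivs by (simp only: g_def)
  \<comment> \<open>The base point condition is demanded at every outcome, not just almost surely,
    and is therefore shown for every \<open>x\<close>.\<close>
  moreover have "jet_point (j2 (curve_prod (\<gamma> x) (f \<circ> \<gamma> x))) = (x, f x)" for x
    by (simp add: jet_point_j2[OF smooth_prod] curve_prod_def assms(4))
  ultimately show ?thesis
    unfolding satisfies_2jet_SDE_def jet_deriv1_j2[OF smooth_prod] jet_deriv2_j2[OF smooth_prod]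
      jets_curve_prod[OF smooth_curve f\<gamma>] by simp
qed

end
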